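(* Let $b>0$, $0<\nu<1$, $0<\mu<1$, $q\ge 1$, $\gamma>0$, let $\flat\ge 2$ be an integer, and let the collocation parameters $0\le\xi_1<\dots<\xi_\flat\le 1$ satisfy $$\int_0^1\prod_{l=1}^\flat(\zeta-\xi_l)\,d\zeta=0.$$ Let $a,\chi\in C(\Lambda)$, $\mathscr K\in C^1(D_R)$, $\varphi_b\in\mathbb R$, let $\varphi$ be the solution of the adjoint Volterra integro-differential equation $$\varphi'(x)=a(x)\varphi(x)+\chi(x)+\int_x^b (s-x)^{\nu-1}\mathscr K(x,s)\varphi(s)\,ds,\quad 0\le x\le b,\qquad \varphi(b)=\varphi_b,$$ and let $\psi:=\varphi'$. Assume that $\widehat\psi(\rho):=\psi(\tau(\rho))\in C^{\flat+1,1-\gamma}[b-b^\mu,b)$. Then there exist $\mathscr M_0\in\mathbb N$ and a constant $C$, independent of $\mathscr M$, such that, for all $\mathscr M>\mathscr M_0$, the collocation approximations $\psi_h,\varphi_h$ (defined in the context) satisfy $$\|\varphi-\varphi_h\|_{L^\infty(\Lambda)}\le C\begin{cases}\varpi\bigl(q(1+\mu\min\{\flat,\gamma\}),\flat+1;\mathscr M\bigr),&\flat\ne\gamma,\\ \varpi\bigl(q(\mu\flat+1),\flat+1;\mathscr M\bigr)\ln\mathscr M,&\flat=\gamma,\end{cases}$$ at the collocation points, $$\max_{x\in\cup_{j=1}^{\mathscr M}X_j}|\psi(x)-\psi_h(x)|\le C\begin{cases}\varpi\bigl(q(1+\mu\min\{\flat,\gamma\}),\flat+1;\mathscr M\bigr),&\flat\ne\gamma,\\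 \varpi\bigl(q(\mu\flat+1),\flat+1;\mathscr M\bigr)\ln\mathscr M,&\flat=\gamma,\end{cases}$$ and, at $x=0$, $$|\psi(0)-\psi_h(0)|\le C\begin{cases}\varpi\bigl(q(1+\mu\min\{\flat,\gamma\}),\flat;\mathscr M\bigr),&\flat\ne\gamma,\\ \varpi\bigl(q(\mu\flat+1),\flat;\mathscr M\bigr)\ln\mathscr M,&\flat=\gamma.\end{cases}$$
   Context: $\mathbb N=\{1,2,\dots\}$, $\Lambda:=[0,b]$, $D_R:=\{(x,s):0\le x\le s\le b\}$, and $\tau(\rho):=b-(b-\rho)^{1/\mu}$ for $\rho\in[b-b^\mu,b]$. Mesh. For $\mathscr M\in\mathbb N$ set $x_j=b\bigl(1-(\frac{\mathscr M-j}{\mathscr M})^q\bigr)$, $j=0,\dots,\mathscr M$; $\varrho_j=(x_{j-1},x_j]$; $\rho_j=b-(b-x_j)^\mu$; $h_{j,\mu}=\rho_j-\rho_{j-1}$. Collocation points: $X_j=\{x_{j,l}:l=1,\dots,\flat\}$ with $x_{j,l}=\tau(\eta_{j,l})$, $\eta_{j,l}=\rho_{j-1}+\xi_l h_{j,\mu}$, $j=1,\dots,\mathscr M$. Fractional backward Lagrange basis on (the closure of) $\varrho_j$: $$L_{j,l}^{\mu}(x)=\prod_{i\ne l,\,1\le i\le\flat}\frac{(b-x)^{\mu}-(b-x_{j,i})^{\mu}}{(b-x_{j,l})^{\mu}-(b-x_{j,i})^{\mu}}.$$ Collocation approximations. $\psi_h$ is, on each $\varrho_j$, of the form $\psi_h(x)=\sum_{k=1}^{\flat}Y_{j,k}L_{j,k}^\mu(x)$,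 where $Y_{j,k}=\psi_h(x_{j,k})$ (value of the $j$-th piece; $\psi_h(0)$ is the value at $0$ of the piece on the first interval), and $\varphi_h$ is defined by $\varphi_h(b)=\varphi_b$ and $\varphi_h(x)=\varphi_h(x_j)-\int_x^{x_j}\psi_h(s)\,ds$ for $x\in[x_{j-1},x_j]$, $j=\mathscr M,\dots,1$. The coefficients $Y_{j,l}$ are determined by the collocation equations $$Y_{j,l}=a(x_{j,l})\varphi_h(x_{j,l})+\chi(x_{j,l})+\int_{x_{j,l}}^{b}(s-x_{j,l})^{\nu-1}\mathscr K(x_{j,l},s)\varphi_h(s)\,ds,\qquad 1\le j\le\mathscr M,\ 1\le l\le\flat.$$ Regularity class. For $m\in\mathbb N$ and $\gamma>0$, $C^{m,1-\gamma}[b-b^\mu,b)$ is the set of real-valued $f\in C[b-b^\mu,b]\cap C^m[b-b^\mu,b)$ such that, for some constants $c_k=c_k(f)$ and all $b-b^\mu\le\rho<b$, $k=0,\dots,m$: $|f^{(k)}(\rho)|\le c_k$ if $k<\gamma$; $|f^{(k)}(\rho)|\le c_k(1+|\ln(b-\rho)|)$ if $k=\gamma$; $|f^{(k)}(\rho)|\le c_k(b-\rho)^{\gamma-k}$ if $k>\gamma$. For $r,s>0$: $\varpi(r,s;\mathscr M)=\mathscr M^{-\min\{r,s\}}$ if $r\ne s$, and $\varpi(r,s;\mathscr M)=\mathscr M^{-\min\{r,s\}}\ln\mathscr M$ if $r=s$. *)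

theory Defs
  imports "HOL-Analysis.Analysis" "HOL-Probability.Essential_Supremum"
begin

definition triangle :: "real \<Rightarrow> (real \<times> real) set" where
  "triangle b = {(x, s). 0 \<le> x \<and> x \<le> s \<and> s \<le> b}"

text \<open>\<open>C1\<close> up to the boundary: the derivatives are taken within the closed triangle, where they
  are unique because every point of it is a limit of interior points.\<close>

definition C1_triangle :: "real \<Rightarrow> (real \<Rightarrow> real \<Rightarrow> real) \<Rightarrow> bool" where
  "C1_triangle b K \<longleftrightarrow> (\<exists>Kx Ks :: real \<times> real \<Rightarrow> real.
     continuous_on (triangle b) Kx \<and> continuous_on (triangle b) Ks \<and>
     (\<forall>p \<in> triangle b. ((\<lambda>(x, s). K x s) has_derivative (\<lambda>(u, v). Kx p * u + Ks p * v))
        (at p within triangle b)))"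

text \<open>The class \<open>C\<^sup>m\<^sup>,\<^sup>1\<^sup>-\<^sup>\<gamma>[lo, b)\<close>; \<open>F k\<close> is the \<open>k\<close>-th derivative of \<open>f\<close>, one-sided at \<open>lo\<close>.\<close>

definition weighted_C :: "nat \<Rightarrow> real \<Rightarrow> real \<Rightarrow> real \<Rightarrow> (real \<Rightarrow> real) \<Rightarrow> bool" where
  "weighted_C m \<gamma> lo b f \<longleftrightarrow> continuous_on {lo..b} f \<and>
     (\<exists>(F :: nat \<Rightarrow> real \<Rightarrow> real) (c :: nat \<Rightarrow> real). F 0 = f \<and>
        (\<forall>k<m. \<forall>\<rho>\<in>{lo..<b}. (F k has_real_derivative F (Suc k) \<rho>) (at \<rho> within {lo..<b})) \<and>
        continuous_on {lo..<b} (F m) \<and>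
        (\<forall>k\<le>m. \<forall>\<rho>\<in>{lo..<b}.
           (real k < \<gamma> \<longrightarrow> \<bar>F k \<rho>\<bar> \<le> c k) \<and>
           (real k = \<gamma> \<longrightarrow> \<bar>F k \<rho>\<bar> \<le> c k * (1 + \<bar>ln (b - \<rho>)\<bar>)) \<and>
           (real k > \<gamma> \<longrightarrow> \<bar>F k \<rho>\<bar> \<le> c k * (b - \<rho>) powr (\<gamma> - real k))))"

definition tau :: "real \<Rightarrow> real \<Rightarrow> real \<Rightarrow> real" where
  "tau b \<mu> \<rho> = b - (b - \<rho>) powr (1 / \<mu>)"

definition mesh_pt :: "real \<Rightarrow> real \<Rightarrow> nat \<Rightarrow> nat \<Rightarrow> real" where
  "mesh_pt b q M j = b * (1 - ((real M - real j) / real M) powr q)"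

definition rho_pt :: "real \<Rightarrow> real \<Rightarrow> real \<Rightarrow> nat \<Rightarrow> nat \<Rightarrow> real" where
  "rho_pt b \<mu> q M j = b - (b - mesh_pt b q M j) powr \<mu>"

definition eta_pt :: "real \<Rightarrow> real \<Rightarrow> real \<Rightarrow> (nat \<Rightarrow> real) \<Rightarrow> nat \<Rightarrow> nat \<Rightarrow> nat \<Rightarrow> real" where
  "eta_pt b \<mu> q \<xi> M j l =
     rho_pt b \<mu> q M (j - 1) + \<xi> l * (rho_pt b \<mu> q M j - rho_pt b \<mu> q M (j - 1))"

definition colloc_pt :: "real \<Rightarrow> real \<Rightarrow> real \<Rightarrow> (nat \<Rightarrow> real) \<Rightarrow> nat \<Rightarrow> nat \<Rightarrow> nat \<Rightarrow> real" where
  "colloc_pt b \<mu> q \<xi> M j l = tau b \<mu> (eta_pt b \<mu> q \<xi> M j l)"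

definition frac_lagrange ::
  "real \<Rightarrow> real \<Rightarrow> real \<Rightarrow> (nat \<Rightarrow> real) \<Rightarrow> nat \<Rightarrow> nat \<Rightarrow> nat \<Rightarrow> nat \<Rightarrow> real \<Rightarrow> real" where
  "frac_lagrange b \<mu> q \<xi> n M j l x =
     (\<Prod>i\<in>{1..n} - {l}.
        ((b - x) powr \<mu> - (b - colloc_pt b \<mu> q \<xi> M j i) powr \<mu>) /
        ((b - colloc_pt b \<mu> q \<xi> M j l) powr \<mu> - (b - colloc_pt b \<mu> q \<xi> M j i) powr \<mu>))"

definition psi_piece ::
  "real \<Rightarrow> real \<Rightarrow> real \<Rightarrow> (nat \<Rightarrow> real) \<Rightarrow> nat \<Rightarrow> nat \<Rightarrow> (nat \<Rightarrow> nat \<Rightarrow> real) \<Rightarrow> nat \<Rightarrow> real \<Rightarrow> real"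
where
  "psi_piece b \<mu> q \<xi> n M Y j x = (\<Sum>k=1..n. Y j k * frac_lagrange b \<mu> q \<xi> n M j k x)"

definition adjoint_rhs ::
  "real \<Rightarrow> real \<Rightarrow> (real \<Rightarrow> real) \<Rightarrow> (real \<Rightarrow> real) \<Rightarrow> (real \<Rightarrow> real \<Rightarrow> real) \<Rightarrow> (real \<Rightarrow> real) \<Rightarrow> real \<Rightarrow> real"
where
  "adjoint_rhs b \<nu> a g K u x =
     a x * u x + g x + integral {x..b} (\<lambda>s. (s - x) powr (\<nu> - 1) * K x s * u s)"

text \<open>\<open>\<psi>h\<close> and \<open>\<phi>h\<close> are constrained on \<open>[0, b]\<close> only.\<close>

definition colloc_approx ::
  "real \<Rightarrow> real \<Rightarrow> real \<Rightarrow> real \<Rightarrow> (nat \<Rightarrow> real) \<Rightarrow> nat \<Rightarrow>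
   (real \<Rightarrow> real) \<Rightarrow> (real \<Rightarrow> real) \<Rightarrow> (real \<Rightarrow> real \<Rightarrow> real) \<Rightarrow> real \<Rightarrow> nat \<Rightarrow>
   (nat \<Rightarrow> nat \<Rightarrow> real) \<Rightarrow> (real \<Rightarrow> real) \<Rightarrow> (real \<Rightarrow> real) \<Rightarrow> bool"
where
  "colloc_approx b \<mu> \<nu> q \<xi> n a g K \<phi>b M Y \<psi>h \<phi>h \<longleftrightarrow>
     (\<forall>j\<in>{1..M}. \<forall>x\<in>{mesh_pt b q M (j - 1)<..mesh_pt b q M j}.
        \<psi>h x = psi_piece b \<mu> q \<xi> n M Y j x) \<and>
     \<psi>h 0 = psi_piece b \<mu> q \<xi> n M Y 1 0 \<and>
     \<phi>h b = \<phi>b \<and>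
     (\<forall>j\<in>{1..M}. \<forall>x\<in>{mesh_pt b q M (j - 1)..mesh_pt b q M j}.
        \<phi>h x = \<phi>h (mesh_pt b q M j) - integral {x..mesh_pt b q M j} \<psi>h) \<and>
     (\<forall>j\<in>{1..M}. \<forall>l\<in>{1..n}.
        Y j l = adjoint_rhs b \<nu> a g K \<phi>h (colloc_pt b \<mu> q \<xi> M j l))"

text \<open>The maximum of \<open>\<bar>\<psi> - \<psi>h\<bar>\<close> over all collocation points, where at \<open>x\<^sub>j\<^sub>,\<^sub>l\<close> the value of the
  \<open>j\<close>-th piece is taken. This matters only if \<open>\<xi> 1 = 0\<close>: then \<open>x\<^sub>j\<^sub>,\<^sub>1\<close> is the left end point of
  the \<open>j\<close>-th interval, and for \<open>j \<ge> 2\<close> the function \<open>\<psi>h\<close> has the value of the piece \<open>j - 1\<close> there.\<close>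

definition colloc_max_err ::
  "real \<Rightarrow> real \<Rightarrow> real \<Rightarrow> (nat \<Rightarrow> real) \<Rightarrow> nat \<Rightarrow> nat \<Rightarrow> (real \<Rightarrow> real) \<Rightarrow> (nat \<Rightarrow> nat \<Rightarrow> real) \<Rightarrow> real"
where
  "colloc_max_err b \<mu> q \<xi> n M \<psi> Y =
     Max ((\<lambda>(j, l). \<bar>\<psi> (colloc_pt b \<mu> q \<xi> M j l)
             - psi_piece b \<mu> q \<xi> n M Y j (colloc_pt b \<mu> q \<xi> M j l)\<bar>) ` ({1..M} \<times> {1..n}))"

definition Linf_norm :: "real set \<Rightarrow> (real \<Rightarrow> real) \<Rightarrow> ereal" where
  "Linf_norm S f = esssup (lebesgue_on S) (\<lambda>x. ereal \<bar>f x\<bar>)"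

definition varpi :: "real \<Rightarrow> real \<Rightarrow> nat \<Rightarrow> real" where
  "varpi r s M = (if r \<noteq> s then real M powr (- min r s) else real M powr (- min r s) * ln (real M))"

end

theory Submission
  imports Defs
begin

text \<open>In the variable \<open>\<rho> = b - (b - s) powr \<mu>\<close> the approximation \<open>\<psi>\<^sub>h\<close> is a piecewise polynomial of degree
  below \<open>n\<close> that satisfies the integro-differential equation in the collocation points. Two facts give
  the convergence rates.

  First, the discrete problem is stable. With \<open>e = \<phi> - \<phi>\<^sub>h\<close>, the values of \<open>\<psi> - \<psi>\<^sub>h\<close> in the
  collocation points are those of a Volterra operator applied to \<open>e\<close>. Integration over the mesh
  intervals therefore gives a recursion for \<open>e\<close> from \<open>b\<close> downwards, perturbed only by the integrals
  \<open>\<integral>\<^sub>x\<^sup>b (\<psi> - P \<psi>)\<close>, where \<open>P\<close> is interpolation in the collocation points. A discrete Gronwall inequality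
  (lemmas \<open>backward_gronwall\<close> and \<open>stability\<close>) bounds \<open>e\<close> by the perturbation, and then so are
  the errors in the collocation points. The same estimate for the homogeneous problem shows that the
  linear system for the coefficients is uniquely solvable (\<open>colloc_approx_exists\<close>,
  \<open>colloc_approx_unique\<close>).

  Secondly, these integrals are smaller than the interpolation error itself. Let \<open>i\<close> count the
  intervals from the singular end \<open>b\<close>, and let \<open>\<alpha> = min n \<gamma>\<close> and \<open>r = q (1 + \<mu> \<alpha>)\<close>. On the graded mesh the
  width of the \<open>i\<close>-th interval is of the order of \<open>1 / i\<close> times the distance of its far end to \<open>b\<close>. Taylor expansion at the
  end away from \<open>b\<close> shows that the interpolation error is of the order of
  \<open>i powr (- n) (i / M) powr (q \<mu> \<alpha>)\<close> (\<open>res_pointwise\<close>), and that up to a factor \<open>1 / i\<close> it is a multiple of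
  \<open>\<Prod>\<^sub>l (\<zeta> - \<xi>\<^sub>l)\<close> in the coordinate \<open>\<zeta>\<close> of the interval. By assumption this polynomial has mean value
  \<open>0\<close>, and the Jacobian of \<open>\<zeta>\<close> is nearly constant on the interval, so that the integral over the whole
  interval gains the factor \<open>1 / i\<close> (\<open>integral_nodal_poly\<close>, \<open>integral_res_cell\<close>). With the length of the
  interval it is of the order of \<open>i powr (- n - 2) (i / M) powr r\<close>. The sum over \<open>i\<close> is
  \<open>varpi r (n + 1) M\<close> up to a constant; the single interval that is covered only partially when the
  integral starts between two mesh points satisfies the same bound. A logarithm in the \<open>n\<close>-th derivative for
  \<open>\<gamma> = n\<close> is at most of the order of \<open>ln M\<close> outside the interval at \<open>b\<close>, and integrable in it. At \<open>0\<close>, finally,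
  the interpolation error itself enters, with \<open>i = M\<close>, which explains the order \<open>n\<close> there.\<close>

section \<open>Lagrange interpolation and Taylor expansion on the unit interval\<close>

definition lagrange_basis :: "(nat \<Rightarrow> real) \<Rightarrow> nat \<Rightarrow> nat \<Rightarrow> real \<Rightarrow> real" where
  "lagrange_basis \<xi> n k t = (\<Prod>i\<in>{1..n} - {k}. (t - \<xi> i) / (\<xi> k - \<xi> i))"

lemma lagrange_basis_node:
  assumes "inj_on \<xi> {1..n}" "k \<in> {1..n}" "l \<in> {1..n}"
  shows "lagrange_basis \<xi> n k (\<xi> l) = (if k = l then 1 else 0)"
proof (cases "k = l")
  case True
  have "(\<xi> l - \<xi> i) / (\<xi> k - \<xi> i) = 1" if "i \<in> {1..n} - {k}" for i
    using that assms(2) inj_onD[OF assms(1), of k i] True by auto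
  then show ?thesis using True by (simp add: lagrange_basis_def)
next
  case False
  then have "l \<in> {1..n} - {k}" using assms by auto
  then have "lagrange_basis \<xi> n k (\<xi> l) = 0"
    unfolding lagrange_basis_def by (intro prod_zero) auto
  then show ?thesis using False by simp
qed

lemma continuous_on_lagrange_basis [continuous_intros]:
  "continuous_on S f \<Longrightarrow> continuous_on S (\<lambda>x. lagrange_basis \<xi> n k (f x))"
  unfolding lagrange_basis_def divide_inverse by (intro continuous_intros)

lemma lagrange_basis_bounded:
  obtains \<Lambda> where "\<Lambda> \<ge> 0"
    "\<And>k t. k \<in> {1..n} \<Longrightarrow> t \<in> {0..1} \<Longrightarrow> \<bar>lagrange_basis \<xi> n k t\<bar> \<le> \<Lambda>"
proof -
  have "\<exists>B. \<forall>t\<in>{0..1}. \<bar>lagrange_basis \<xi> n k t\<bar> \<le> B" for k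
  proof -
    have "compact ((\<lambda>t. lagrange_basis \<xi> n k t) ` {0..1})"
      by (intro compact_continuous_image continuous_intros) auto
    then show ?thesis
      using compact_imp_bounded bounded_iff by (metis imageI real_norm_def)
  qed
  then obtain B where B: "\<And>k t. t \<in> {0..1} \<Longrightarrow> \<bar>lagrange_basis \<xi> n k t\<bar> \<le> B k"
    by metis
  have nn: "0 \<le> B k" for k
    using B[of 0 k] by auto
  show thesis
  proof (rule that[of "\<Sum>k=1..n. B k"])
    show "0 \<le> (\<Sum>k=1..n. B k)" by (simp add: nn sum_nonneg)
    fix k and t :: real assume k: "k \<in> {1..n}" and t: "t \<in> {0..1}"
    have "B k \<le> (\<Sum>k=1..n. B k)"
      using k nn by (intro member_le_sum) auto
    then show "\<bar>lagrange_basis \<xi> n k t\<bar> \<le> (\<Sum>k=1..n. B k)"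
      using B[OF t, of k] by linarith
  qed
qed

text \<open>Both sides are polynomials of degree at most \<open>n\<close> that have the same coefficient of order \<open>n\<close> and
  agree in the \<open>n\<close> nodes. In particular interpolation reproduces degrees below \<open>n\<close>, and in degree \<open>n\<close>
  its error is known exactly; the superconvergence rests on this last term.\<close>

lemma lagrange_interpolation_poly:
  assumes inj: "inj_on \<xi> {1..n}" and n: "n \<ge> 1" and deg: "degree p \<le> n"
  shows "poly p t = (\<Sum>k=1..n. poly p (\<xi> k) * lagrange_basis \<xi> n k t)
           + coeff p n * (\<Prod>l=1..n. (t - \<xi> l))"
proof -
  define L where "L k = (\<Prod>i\<in>{1..n} - {k}. smult (1 / (\<xi> k - \<xi> i)) [:- \<xi> i, 1:])" for k
  have L: "poly (L k) t = lagrange_basis \<xi> n k t" for k t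
    unfolding L_def lagrange_basis_def poly_prod by (intro prod.cong) (simp_all add: diff_divide_distrib)
  have dL: "degree (L k) < n" if "k \<in> {1..n}" for k
  proof -
    have "degree (L k) \<le> (\<Sum>i\<in>{1..n} - {k}. degree (smult (1 / (\<xi> k - \<xi> i)) [:- \<xi> i, 1:]))"
      unfolding L_def by (rule degree_prod_sum_le[unfolded o_def]) simp
    also have "\<dots> \<le> (\<Sum>i\<in>{1..n} - {k}. 1)"
      by (intro sum_mono) auto
    also have "\<dots> < n" using that n by (simp add: card_Diff_singleton)
    finally show ?thesis .
  qed
  define W where "W = (\<Prod>l=1..n. [:- \<xi> l, 1:])"
  have W: "poly W t = (\<Prod>l=1..n. (t - \<xi> l))" for t
    unfolding W_def poly_prod by (intro prod.cong) auto
  have dW: "degree W = n"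
    unfolding W_def by (subst degree_prod_eq_sum_degree) auto
  have lW: "lead_coeff W = 1"
    unfolding W_def by (simp add: lead_coeff_prod)
  define P where "P = (\<Sum>k=1..n. smult (poly p (\<xi> k)) (L k)) + smult (coeff p n) W"
  have P: "poly P t = (\<Sum>k=1..n. poly p (\<xi> k) * lagrange_basis \<xi> n k t)
           + coeff p n * (\<Prod>l=1..n. (t - \<xi> l))" for t
    by (simp add: P_def poly_sum L W)
  have dsum: "degree (\<Sum>k=1..n. smult (poly p (\<xi> k)) (L k)) < n"
    using n dL by (intro degree_sum_less) (auto intro: le_less_trans[OF degree_smult_le])
  have "p = P"
  proof (rule poly_eqI_degree_lead_coeff[of _ n _ "\<xi> ` {1..n}"])
    show "coeff p n = coeff P n"
      using dsum dW lW by (simp add: P_def coeff_eq_0)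
    show "card (\<xi> ` {1..n}) \<ge> n"
      using inj by (simp add: card_image)
    show "degree P \<le> n"
      unfolding P_def using dsum dW
      by (intro degree_add_le) (auto intro: order_trans[OF degree_smult_le])
    show "poly p z = poly P z" if z: "z \<in> \<xi> ` {1..n}" for z
    proof -
      obtain l where l: "l \<in> {1..n}" "z = \<xi> l" using z by auto
      have "(\<Prod>l=1..n. (z - \<xi> l)) = 0" using l by (intro prod_zero) auto
      moreover have "(\<Sum>k=1..n. poly p (\<xi> k) * lagrange_basis \<xi> n k z)
          = (\<Sum>k=1..n. if k = l then poly p (\<xi> k) else 0)"
        using l inj by (intro sum.cong) (auto simp: lagrange_basis_node)
      ultimately show ?thesis using l by (simp add: P)
    qed
  qed (fact deg)
  then show ?thesis using P by metis
qed

text \<open>Apart from what interpolation does to \<open>p\<close>, the error for \<open>G\<close> is that for the small function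
  \<open>G - p\<close>, to which each node contributes at most \<open>\<Lambda> \<epsilon>\<close>.\<close>

lemma interpolation_error_near_poly:
  assumes inj: "inj_on \<xi> {1..n}" and n: "n \<ge> 1" and deg: "degree p \<le> n"
    and \<Lambda>: "\<And>k. k \<in> {1..n} \<Longrightarrow> \<bar>lagrange_basis \<xi> n k t\<bar> \<le> \<Lambda>"
    and nodes: "\<And>k. k \<in> {1..n} \<Longrightarrow> \<bar>G (\<xi> k) - poly p (\<xi> k)\<bar> \<le> \<epsilon>"
    and t: "\<bar>G t - poly p t\<bar> \<le> \<epsilon>"
  shows "\<bar>G t - (\<Sum>k=1..n. G (\<xi> k) * lagrange_basis \<xi> n k t)
            - coeff p n * (\<Prod>l=1..n. (t - \<xi> l))\<bar> \<le> (1 + real n * \<Lambda>) * \<epsilon>"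
proof -
  have "G t - (\<Sum>k=1..n. G (\<xi> k) * lagrange_basis \<xi> n k t) - coeff p n * (\<Prod>l=1..n. (t - \<xi> l))
    = (G t - poly p t) - (\<Sum>k=1..n. (G (\<xi> k) - poly p (\<xi> k)) * lagrange_basis \<xi> n k t)"
    using lagrange_interpolation_poly[OF inj n deg, of t]
    by (simp add: algebra_simps sum_subtractf)
  also have "\<bar>\<dots>\<bar> \<le> \<bar>G t - poly p t\<bar>
      + (\<Sum>k=1..n. \<bar>G (\<xi> k) - poly p (\<xi> k)\<bar> * \<bar>lagrange_basis \<xi> n k t\<bar>)"
    by (intro order_trans[OF abs_triangle_ineq4] add_left_mono order_trans[OF sum_abs])
       (simp add: abs_mult)
  also have "\<dots> \<le> \<epsilon> + (\<Sum>k=1..n. \<epsilon> * \<Lambda>)"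
    using t nodes \<Lambda> order_trans[OF abs_ge_zero t] by (intro add_mono sum_mono mult_mono) simp_all
  finally show ?thesis by (simp add: algebra_simps)
qed

text \<open>Taylor's formula at \<open>0\<close> for a function whose \<open>p\<close>-th derivative may blow up at \<open>1\<close>. The
  factor \<open>(t - s)\<^sup>p\<^sup>-\<^sup>1\<close> in the integral remainder is at most \<open>(1 - s)\<^sup>p\<^sup>-\<^sup>1\<close>, so that the remainder is
  controlled by the integral of \<open>(1 - s) powr (\<beta> - 1)\<close>. The choice \<open>\<beta> = p\<close> covers a bounded
  derivative.\<close>

lemma taylor_remainder_weighted:
  fixes G :: "nat \<Rightarrow> real \<Rightarrow> real"
  assumes p: "p \<ge> 1" and \<beta>: "\<beta> > 0" and B: "B \<ge> 0"
    and cont: "continuous_on {0..1} (G 0)"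
    and deriv: "\<And>k s. k < p \<Longrightarrow> s \<in> {0..<1} \<Longrightarrow>
                  (G k has_real_derivative G (Suc k) s) (at s within {0..<1})"
    and bound: "\<And>s. s \<in> {0..<1} \<Longrightarrow> \<bar>G p s\<bar> \<le> B * (1 - s) powr (\<beta> - real p)"
    and t: "t \<in> {0..1}"
  shows "\<bar>G 0 t - (\<Sum>i<p. G i 0 / fact i * t ^ i)\<bar> \<le> B / \<beta>"
proof -
  have inner: "\<bar>G 0 t - (\<Sum>i<p. G i 0 / fact i * t ^ i)\<bar> \<le> B / \<beta>" if t: "t \<in> {0..<1}" for t
  proof -
    define R where "R = (\<lambda>s. ((t - s) ^ (p - 1) / fact (p - 1)) *\<^sub>R G p s)"
    have R: "(R has_integral (G 0 t - (\<Sum>i<p. ((t - 0) ^ i / fact i) *\<^sub>R G i 0))) {0..t}"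
      unfolding R_def
    proof (rule Taylor_has_integral)
      fix m s assume "m < p" "0 \<le> s" "s \<le> t"
      then have "(G m has_real_derivative G (Suc m) s) (at s within {0..t})"
        using t by (intro has_field_derivative_subset[OF deriv]) auto
      then show "(G m has_vector_derivative G (Suc m) s) (at s within {0..t})"
        by (simp add: has_real_derivative_iff_has_vector_derivative)
    qed (use p t in auto)
    have W: "((\<lambda>s. B * (1 - s) powr (\<beta> - 1)) has_integral
               ((- B / \<beta> * (1 - t) powr \<beta>) - (- B / \<beta> * (1 - 0) powr \<beta>))) {0..t}"
      using t \<beta>
      by (intro fundamental_theorem_of_calculus)
         (auto simp: has_real_derivative_iff_has_vector_derivative[symmetric]
               intro!: derivative_eq_intros)
    have le: "norm (R s) \<le> B * (1 - s) powr (\<beta> - 1)" if s: "s \<in> {0..t}" for s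
    proof -
      have "(t - s) ^ (p - 1) / fact (p - 1) \<le> (t - s) ^ (p - 1) / 1"
        using s by (intro divide_left_mono) auto
      also have "\<dots> \<le> (1 - s) ^ (p - 1)"
        using s t by (auto intro!: power_mono)
      also have "\<dots> = (1 - s) powr (real p - 1)"
        using s t p by (simp add: powr_realpow[symmetric] of_nat_diff)
      finally have 1: "(t - s) ^ (p - 1) / fact (p - 1) \<le> (1 - s) powr (real p - 1)" .
      have "norm (R s) = (t - s) ^ (p - 1) / fact (p - 1) * \<bar>G p s\<bar>"
        using s by (simp add: R_def abs_mult)
      also have "\<dots> \<le> (1 - s) powr (real p - 1) * (B * (1 - s) powr (\<beta> - real p))"
        using 1 bound[of s] s t by (intro mult_mono) auto
      also have "\<dots> = B * (1 - s) powr (\<beta> - 1)"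
        by (simp add: powr_add[symmetric] mult.left_commute)
      finally show ?thesis .
    qed
    have "\<bar>integral {0..t} R\<bar> \<le> integral {0..t} (\<lambda>s. B * (1 - s) powr (\<beta> - 1))"
      using integral_norm_bound_integral[OF has_integral_integrable[OF R]
              has_integral_integrable[OF W] le] by simp
    also have "\<dots> = (- B / \<beta> * (1 - t) powr \<beta>) - (- B / \<beta> * (1 - 0) powr \<beta>)"
      using W by (rule integral_unique)
    also have "\<dots> \<le> B / \<beta>"
      using B \<beta> by simp
    finally have "\<bar>integral {0..t} R\<bar> \<le> B / \<beta>" .
    then show ?thesis
      by (simp add: integral_unique[OF R] mult.commute)
  qed
  \<comment> \<open>at the singular point itself only continuity is available\<close>
  show ?thesis
  proof (cases "t = 1")
    case True
    define D where "D = (\<lambda>t. \<bar>G 0 t - (\<Sum>i<p. G i 0 / fact i * t ^ i)\<bar>)"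
    have "continuous_on {0..1} D"
      unfolding D_def by (intro continuous_intros cont)
    then have 1: "continuous_on (closure {0..<1}) D" by simp
    have 2: "D t \<le> B / \<beta>" if "t \<in> {0..<1}" for t
      using inner[OF that] by (simp add: D_def)
    have "D 1 \<le> B / \<beta>"
      using continuous_le_on_closure[OF 1 _ 2, of 1] by simp
    then show ?thesis unfolding D_def True .
  next
    case False
    then have "t \<in> {0..<1}" using t by auto
    then show ?thesis by (rule inner)
  qed
qed

text \<open>Used with \<open>p = n\<close> for pointwise bounds and with
  \<open>p = n + 1\<close> for integrals, where the nodal polynomial is the leading term of the error.\<close>

lemma interpolation_error_taylor:
  fixes G :: "nat \<Rightarrow> real \<Rightarrow> real"
  assumes inj: "inj_on \<xi> {1..n}" and n: "n \<ge> 1" and \<xi>: "\<And>k. k \<in> {1..n} \<Longrightarrow> \<xi> k \<in> {0..1}"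
    and \<Lambda>: "\<And>k t. k \<in> {1..n} \<Longrightarrow> t \<in> {0..1} \<Longrightarrow> \<bar>lagrange_basis \<xi> n k t\<bar> \<le> \<Lambda>"
    and p: "p \<ge> 1" "p \<le> n + 1" and \<beta>: "\<beta> > 0" and B: "B \<ge> 0"
    and cont: "continuous_on {0..1} (G 0)"
    and deriv: "\<And>k s. k < p \<Longrightarrow> s \<in> {0..<1} \<Longrightarrow>
                  (G k has_real_derivative G (Suc k) s) (at s within {0..<1})"
    and bound: "\<And>s. s \<in> {0..<1} \<Longrightarrow> \<bar>G p s\<bar> \<le> B * (1 - s) powr (\<beta> - real p)"
    and t: "t \<in> {0..1}"
  shows "\<bar>G 0 t - (\<Sum>k=1..n. G 0 (\<xi> k) * lagrange_basis \<xi> n k t)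
          - (if p = n + 1 then G n 0 / fact n else 0) * (\<Prod>l=1..n. (t - \<xi> l))\<bar>
         \<le> (1 + real n * \<Lambda>) * (B / \<beta>)"
proof -
  define P where "P = (\<Sum>i<p. monom (G i 0 / fact i) i)"
  have P: "poly P t = (\<Sum>i<p. G i 0 / fact i * t ^ i)" for t
    by (simp add: P_def poly_sum poly_monom)
  have cP: "coeff P i = (if i < p then G i 0 / fact i else 0)" for i
    by (simp add: P_def coeff_sum)
  have "degree P \<le> n"
    using p by (intro degree_le) (auto simp: cP)
  have err: "\<bar>G 0 t - poly P t\<bar> \<le> B / \<beta>" if "t \<in> {0..1}" for t
    unfolding P using taylor_remainder_weighted[of p \<beta> B G, OF p(1) \<beta> B cont deriv bound that] .
  have "coeff P n = (if p = n + 1 then G n 0 / fact n else 0)"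
    using p by (auto simp: cP)
  then show ?thesis
    using interpolation_error_near_poly[OF inj n \<open>degree P \<le> n\<close> \<Lambda>[OF _ t] err[OF \<xi>] err[OF t]]
    by simp
qed

section \<open>Finite linear systems and a discrete Gronwall inequality\<close>

text \<open>Gaussian elimination: if the equation \<open>j\<close> involves an unknown \<open>p\<close>, it can be solved for it, and
  the remaining equations lose one unknown; otherwise it holds for any choice.\<close>

lemma homogeneous_system_nontrivial:
  fixes A :: "'j \<Rightarrow> 'i \<Rightarrow> real"
  assumes "finite J" "finite I" "card J < card I"
  shows "\<exists>f. (\<exists>i\<in>I. f i \<noteq> 0) \<and> (\<forall>j\<in>J. (\<Sum>i\<in>I. A j i * f i) = 0)"
  using assms
proof (induction J arbitrary: I A rule: finite_induct)
  case empty
  then obtain i where "i \<in> I" by (metis card.empty not_less_zero ex_in_conv)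
  then show ?case by (intro exI[of _ "\<lambda>_. 1"]) auto
next
  case (insert j J)
  show ?case
  proof (cases "\<forall>i\<in>I. A j i = 0")
    case True
    obtain f where "\<exists>i\<in>I. f i \<noteq> 0" "\<forall>j\<in>J. (\<Sum>i\<in>I. A j i * f i) = 0"
      using insert.IH[of I A] insert.prems insert.hyps by (auto simp: card_insert_if)
    moreover have "(\<Sum>i\<in>I. A j i * f i) = 0"
      using True by (intro sum.neutral) simp
    ultimately show ?thesis by (intro exI[of _ f]) auto
  next
    case False
    then obtain p where p: "p \<in> I" "A j p \<noteq> 0" by auto
    define A' where "A' k i = A k i - A k p * A j i / A j p" for k i
    have "card J < card (I - {p})"
      using insert.prems insert.hyps p by (simp add: card_insert_if)
    then obtain f where f: "\<exists>i\<in>I - {p}. f i \<noteq> 0"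
        "\<forall>k\<in>J. (\<Sum>i\<in>I - {p}. A' k i * f i) = 0"
      using insert.IH[of "I - {p}" A'] insert.prems by auto
    define s where "s = (\<Sum>i\<in>I - {p}. A j i * f i)"
    define f' where "f' = f(p := - s / A j p)"
    have split: "(\<Sum>i\<in>I. A k i * f' i) = A k p * (- s / A j p) + (\<Sum>i\<in>I - {p}. A k i * f i)" for k
    proof -
      have "(\<Sum>i\<in>I. A k i * f' i) = A k p * f' p + (\<Sum>i\<in>I - {p}. A k i * f' i)"
        using p insert.prems by (simp add: sum.remove)
      also have "(\<Sum>i\<in>I - {p}. A k i * f' i) = (\<Sum>i\<in>I - {p}. A k i * f i)"
        by (intro sum.cong) (auto simp: f'_def)
      finally show ?thesis by (simp add: f'_def)
    qed
    have "(\<Sum>i\<in>I. A j i * f' i) = 0"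
      using p by (simp add: split s_def)
    moreover have "(\<Sum>i\<in>I. A k i * f' i) = 0" if "k \<in> J" for k
    proof -
      have "(\<Sum>i\<in>I - {p}. A' k i * f i)
          = (\<Sum>i\<in>I - {p}. A k i * f i) - (A k p / A j p) * s"
        unfolding A'_def s_def sum_distrib_left sum_subtractf[symmetric]
        by (intro sum.cong) (simp_all add: left_diff_distrib)
      then show ?thesis using f(2) that by (simp add: split)
    qed
    moreover have "\<exists>i\<in>I. f' i \<noteq> 0" using f(1) by (auto simp: f'_def)
    ultimately show ?thesis by auto
  qed
qed

text \<open>Uniqueness implies existence in finite dimension. The right-hand side is treated as the column
  of an additional unknown, which makes the homogeneous system underdetermined. In a nontrivial
  solution the additional unknown cannot vanish, by uniqueness, and it can be scaled to one.\<close>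

lemma linear_fixed_point_exists:
  fixes T :: "('i \<Rightarrow> real) \<Rightarrow> 'i \<Rightarrow> real"
  assumes I: "finite I"
    and add: "\<And>f g i. i \<in> I \<Longrightarrow> T (\<lambda>k. f k + g k) i = T f i + T g i"
    and scale: "\<And>c f i. i \<in> I \<Longrightarrow> T (\<lambda>k. c * f k) i = c * T f i"
    and local: "\<And>f g i. i \<in> I \<Longrightarrow> (\<And>k. k \<in> I \<Longrightarrow> f k = g k) \<Longrightarrow> T f i = T g i"
    and inj: "\<And>f. (\<And>i. i \<in> I \<Longrightarrow> f i = T f i) \<Longrightarrow> (\<And>i. i \<in> I \<Longrightarrow> f i = 0)"
  shows "\<exists>f. \<forall>i\<in>I. f i = T f i + c i"
proof -
  define e where "e k = (\<lambda>i. if i = k then 1 else 0 :: real)" for k :: 'i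
  have zero: "T (\<lambda>_. 0) i = 0" if "i \<in> I" for i
    using scale[OF that, of 0 "\<lambda>_. 0"] by simp
  have lin: "T (\<lambda>i. \<Sum>k\<in>S. f k * e k i) i = (\<Sum>k\<in>S. f k * T (e k) i)"
    if "finite S" "i \<in> I" for S f i
    using that by (induction S rule: finite_induct) (auto simp: zero add scale)
  have T: "T f i = (\<Sum>k\<in>I. f k * T (e k) i)" if i: "i \<in> I" for f i
  proof -
    have "T f i = T (\<lambda>i. \<Sum>k\<in>I. f k * e k i) i"
    proof (rule local[OF i])
      fix l assume l: "l \<in> I"
      have "(\<Sum>k\<in>I. f k * e k l) = (\<Sum>k\<in>I. if k = l then f k else 0)"
        by (intro sum.cong) (auto simp: e_def)
      then show "f l = (\<Sum>k\<in>I. f k * e k l)" using l I by simp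
    qed
    then show ?thesis using lin[OF I i] by simp
  qed
  \<comment> \<open>\<open>None\<close> is the additional unknown\<close>
  define A where "A i k = (case k of None \<Rightarrow> - c i | Some k \<Rightarrow> e k i - T (e k) i)" for i k
  have "card I < card (insert None (Some ` I))"
    using I by (simp add: card_image)
  then obtain F where F: "\<exists>k\<in>insert None (Some ` I). F k \<noteq> 0"
      "\<forall>i\<in>I. (\<Sum>k\<in>insert None (Some ` I). A i k * F k) = 0"
    using homogeneous_system_nontrivial[of I "insert None (Some ` I)" A] I by auto
  define f where "f k = F (Some k)" for k
  have f: "f i = T f i + F None * c i" if i: "i \<in> I" for i
  proof -
    have "(\<Sum>k\<in>I. e k i * f k) = (\<Sum>k\<in>I. if k = i then f k else 0)"
      by (intro sum.cong) (auto simp: e_def)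
    then have "(\<Sum>k\<in>I. e k i * f k) = f i" using i I by simp
    moreover have "(\<Sum>k\<in>insert None (Some ` I). A i k * F k)
       = - c i * F None + (\<Sum>k\<in>I. (e k i - T (e k) i) * f k)"
      using I by (subst sum.insert) (auto simp: A_def f_def sum.reindex)
    moreover have "(\<Sum>k\<in>I. (e k i - T (e k) i) * f k) = (\<Sum>k\<in>I. e k i * f k) - T f i"
      unfolding T[OF i, of f] by (simp add: algebra_simps sum_subtractf)
    ultimately show ?thesis using F(2) i by (simp add: mult.commute)
  qed
  have "F None \<noteq> 0"
  proof
    assume 0: "F None = 0"
    then have "f i = 0" if "i \<in> I" for i using f that inj[of f] by simp
    then show False using F(1) 0 by (auto simp: f_def)
  qed
  then have "(1 / F None) * f i = T (\<lambda>k. (1 / F None) * f k) i + c i" if "i \<in> I" for i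
    unfolding scale[OF that] by (subst f[OF that]) (simp add: distrib_left add_divide_distrib)
  then show ?thesis by (intro exI[of _ "\<lambda>k. (1 / F None) * f k"] ballI)
qed

text \<open>Going from \<open>x M\<close> down, the bound \<open>S\<close> on \<open>[x\<^sub>j\<^sub>-\<^sub>1, x\<^sub>M]\<close> occurs on both sides. As \<open>h \<le> 1 / 2\<close>, it
  can be absorbed at the cost of a factor \<open>1 / (1 - h) \<le> 1 + 2 h\<close> per interval. The two kinds of
  perturbation have to be kept apart: those at the points \<open>x j\<close> accumulate, whereas \<open>R\<close> is
  suffered only inside the interval where the function is evaluated.\<close>

lemma backward_gronwall:
  fixes x d :: "nat \<Rightarrow> real" and e :: "real \<Rightarrow> real"
  assumes mono: "\<And>j. j \<in> {1..M} \<Longrightarrow> x (j - 1) \<le> x j"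
    and e: "continuous_on {x 0..x M} e" "e (x M) = 0"
    and h: "h \<ge> 0" "h \<le> 1 / 2" and R: "R \<ge> 0" and d: "\<And>j. j \<in> {1..M} \<Longrightarrow> d j \<ge> 0"
    and step: "\<And>j S s. j \<in> {1..M} \<Longrightarrow> (\<And>t. t \<in> {x (j - 1)..x M} \<Longrightarrow> \<bar>e t\<bar> \<le> S) \<Longrightarrow>
        s \<in> {x (j - 1)..x j} \<Longrightarrow> \<bar>e s - e (x j)\<bar> \<le> h * S + R"
    and step_node: "\<And>j S. j \<in> {1..M} \<Longrightarrow> (\<And>t. t \<in> {x (j - 1)..x M} \<Longrightarrow> \<bar>e t\<bar> \<le> S) \<Longrightarrow>
        \<bar>e (x (j - 1)) - e (x j)\<bar> \<le> h * S + d j"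
    and t: "t \<in> {x 0..x M}"
  shows "\<bar>e t\<bar> \<le> exp (2 * h * real M) * (R + (\<Sum>j=1..M. d j))"
proof -
  define W where "W k = (1 + 2 * h) ^ k * (R + (\<Sum>j\<in>{M - k<..M}. d j))" for k
  have x_mono: "x i \<le> x j" if "i \<le> j" "j \<le> M" for i j
    using that by (induction j rule: dec_induct) (use mono in \<open>force+\<close>)
  have "\<bar>e (x (M - k))\<bar> + R \<le> W k \<and> (\<forall>t\<in>{x (M - k)..x M}. \<bar>e t\<bar> \<le> W k)" if "k \<le> M" for k
    using that
  proof (induction k)
    case 0
    then show ?case using e R by (auto simp: W_def)
  next
    case (Suc k)
    define j where "j = M - k"
    have j: "j \<in> {1..M}" "M - Suc k = j - 1" using Suc.prems by (auto simp: j_def)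
    have IH: "\<bar>e (x j)\<bar> + R \<le> W k" "\<And>t. t \<in> {x j..x M} \<Longrightarrow> \<bar>e t\<bar> \<le> W k"
      using Suc by (auto simp: j_def)
    have W0: "0 \<le> W k" using IH(1) R by linarith
    have sub: "{x (j - 1)..x M} \<subseteq> {x 0..x M}"
      using x_mono[of 0 "j - 1"] j by auto
    have "x (j - 1) \<le> x M" using x_mono[of "j - 1" M] j by auto
    then have "\<exists>t0\<in>{x (j - 1)..x M}. \<forall>t\<in>{x (j - 1)..x M}. \<bar>e t\<bar> \<le> \<bar>e t0\<bar>"
      using e(1) sub
      by (intro continuous_attains_sup) (auto intro!: continuous_intros intro: continuous_on_subset)
    then obtain t0 where t0: "t0 \<in> {x (j - 1)..x M}"
      and max: "\<And>t. t \<in> {x (j - 1)..x M} \<Longrightarrow> \<bar>e t\<bar> \<le> \<bar>e t0\<bar>" by blast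
    \<comment> \<open>the maximum itself is an admissible bound in the two assumed inequalities\<close>
    define S where "S = \<bar>e t0\<bar>"
    have S0: "0 \<le> S" by (simp add: S_def)
    have "S \<le> W k + h * S"
    proof (cases "t0 \<le> x j")
      case True
      then have "\<bar>e t0 - e (x j)\<bar> \<le> h * S + R"
        using step[OF j(1), of S t0] max t0 by (auto simp: S_def)
      then show ?thesis using IH(1) unfolding S_def by linarith
    next
      case False
      then have "S \<le> W k" using IH(2)[of t0] t0 by (auto simp: S_def)
      moreover have "0 \<le> h * S" using S0 h by simp
      ultimately show ?thesis by linarith
    qed
    then have SW: "S * (1 - h) \<le> W k" by (simp add: algebra_simps)
    have "S * 1 \<le> S * ((1 - h) * (1 + 2 * h))"
    proof (intro mult_left_mono S0)
      have "h * h \<le> h * (1 / 2)" using h by (intro mult_left_mono) auto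
      then show "1 \<le> (1 - h) * (1 + 2 * h)" by (simp add: algebra_simps)
    qed
    also have "\<dots> \<le> W k * (1 + 2 * h)"
      unfolding mult.assoc[symmetric] using SW h by (intro mult_right_mono) auto
    finally have SW': "S \<le> W k * (1 + 2 * h)" by simp
    have dnn: "0 \<le> d j" using d j by auto
    have "{M - Suc k<..M} = insert j {M - k<..M}"
      using Suc.prems by (auto simp: j_def)
    then have sumd: "(\<Sum>i\<in>{M - Suc k<..M}. d i) = d j + (\<Sum>i\<in>{M - k<..M}. d i)"
      by (simp add: j_def)
    have "d j * 1 \<le> d j * (1 + 2 * h) ^ Suc k"
      using h dnn by (intro mult_left_mono one_le_power) auto
    then have WS: "W k * (1 + 2 * h) + d j \<le> W (Suc k)"
      unfolding W_def sumd by (simp add: algebra_simps)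
    have "\<bar>e (x (j - 1)) - e (x j)\<bar> \<le> h * S + d j"
      using step_node[OF j(1), of S] max by (auto simp: S_def)
    then have "\<bar>e (x (j - 1))\<bar> + R \<le> W k + h * S + d j" using IH(1) by linarith
    also have "h * S \<le> h * (2 * W k)"
    proof (intro mult_left_mono h)
      have "W k * (1 + 2 * h) \<le> W k * 2" using W0 h by (intro mult_left_mono) auto
      then show "S \<le> 2 * W k" using SW' by linarith
    qed
    finally have "\<bar>e (x (j - 1))\<bar> + R \<le> W (Suc k)"
      using WS by (simp add: algebra_simps)
    moreover have "\<bar>e t\<bar> \<le> W (Suc k)" if "t \<in> {x (j - 1)..x M}" for t
      using max[OF that] SW' WS dnn unfolding S_def by linarith
    ultimately show ?case using j by auto
  qed
  from this[of M] t have "\<bar>e t\<bar> \<le> W M" by auto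
  also have "\<dots> = (1 + 2 * h) ^ M * (R + (\<Sum>j=1..M. d j))"
    by (simp add: W_def atLeastSucAtMost_greaterThanAtMost)
  also have "\<dots> \<le> exp (2 * h) ^ M * (R + (\<Sum>j=1..M. d j))"
    using h R d
    by (intro mult_right_mono power_mono exp_ge_add_one_self add_nonneg_nonneg sum_nonneg) auto
  also have "exp (2 * h) ^ M = exp (2 * h * real M)"
    by (simp add: exp_of_nat_mult[symmetric] mult.commute)
  finally show ?thesis .
qed

section \<open>The weakly singular Volterra operator\<close>

lemma kernel_bounds:
  assumes K: "C1_triangle b K" and b: "b > 0"
  obtains KB where "KB \<ge> 0" "\<And>x s. 0 \<le> x \<Longrightarrow> x \<le> s \<Longrightarrow> s \<le> b \<Longrightarrow> \<bar>K x s\<bar> \<le> KB"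
    and "\<And>x. 0 \<le> x \<Longrightarrow> continuous_on {x..b} (K x)"
proof -
  have cont: "continuous_on (triangle b) (\<lambda>(x, s). K x s)"
    using K unfolding C1_triangle_def
    by (meson differentiable_imp_continuous_on differentiable_on_def differentiable_def)
  have tri: "triangle b = ({0..b} \<times> {0..b}) \<inter> {p. fst p \<le> snd p}"
    by (auto simp: triangle_def)
  have "closed {p :: real \<times> real. fst p \<le> snd p}"
    by (intro closed_Collect_le continuous_intros)
  then have "compact (triangle b)"
    unfolding tri by (intro compact_Int_closed compact_Times) auto
  then have "bounded ((\<lambda>(x, s). K x s) ` triangle b)"
    using cont by (intro compact_imp_bounded compact_continuous_image)
  then obtain KB where KB: "\<And>p. p \<in> triangle b \<Longrightarrow> norm ((\<lambda>(x, s). K x s) p) \<le> KB"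
    unfolding bounded_iff by blast
  show thesis
  proof (rule that[of KB])
    have "(0, 0) \<in> triangle b" using b by (auto simp: triangle_def)
    from KB[OF this] show "KB \<ge> 0" by auto
    show "\<bar>K x s\<bar> \<le> KB" if "0 \<le> x" "x \<le> s" "s \<le> b" for x s
      using KB[of "(x, s)"] that by (auto simp: triangle_def)
    show "continuous_on {x..b} (K x)" if "0 \<le> x" for x
    proof -
      have "continuous_on {x..b} (\<lambda>s. (\<lambda>(x, s). K x s) (x, s))"
        using that by (intro continuous_on_compose2[OF cont]) (auto simp: triangle_def intro!: continuous_intros)
      then show ?thesis by simp
    qed
  qed
qed

lemma weakly_singular_has_integral:
  fixes \<nu> x b :: real
  assumes "\<nu> > 0" "x \<le> b"
  shows "((\<lambda>s. (s - x) powr (\<nu> - 1)) has_integral ((b - x) powr \<nu> / \<nu>)) {x..b}"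
proof -
  have "((\<lambda>s. s powr (\<nu> - 1)) has_integral ((b - x) powr \<nu> / \<nu>)) {0..b - x}"
    using has_integral_powr_from_0[of "\<nu> - 1" "b - x"] assms by simp
  then show ?thesis
    using has_integral_shift_Icc_real[of "\<lambda>s. (s - x) powr (\<nu> - 1)" x _ 0 "b - x"]
    by (simp add: o_def)
qed

lemma volterra_integrable:
  fixes x b \<nu> :: real and K :: "real \<Rightarrow> real \<Rightarrow> real" and u :: "real \<Rightarrow> real"
  assumes \<nu>: "\<nu> > 0" and x: "x \<le> b"
    and K: "continuous_on {x..b} (K x)" and u: "continuous_on {x..b} u"
  shows "(\<lambda>s. (s - x) powr (\<nu> - 1) * K x s * u s) integrable_on {x..b}"
proof -
  have c: "continuous_on {x..b} (\<lambda>s. K x s * u s)"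
    using K u by (intro continuous_intros)
  have "(\<lambda>s. (s - x) powr (\<nu> - 1)) absolutely_integrable_on {x..b}"
    using weakly_singular_has_integral[OF \<nu> x]
    by (intro nonnegative_absolutely_integrable_1) (auto simp: has_integral_iff)
  then have "(\<lambda>s. (K x s * u s) * (s - x) powr (\<nu> - 1)) absolutely_integrable_on {x..b}"
  proof (rule absolutely_integrable_bounded_measurable_product_real[rotated 3])
    show "(\<lambda>s. K x s * u s) \<in> borel_measurable (lebesgue_on {x..b})"
      using c by (intro continuous_imp_measurable_on_sets_lebesgue) auto
    show "bounded ((\<lambda>s. K x s * u s) ` {x..b})"
      using c by (intro compact_imp_bounded compact_continuous_image) auto
  qed auto
  then show ?thesis
    by (auto simp: absolutely_integrable_on_def mult_ac)
qed

lemma adjoint_rhs_add: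
  assumes "\<nu> > 0" "x \<le> b" "continuous_on {x..b} (K x)"
    and "continuous_on {x..b} u" "continuous_on {x..b} v"
  shows "adjoint_rhs b \<nu> a (\<lambda>x. g x + h x) K (\<lambda>s. u s + v s) x
       = adjoint_rhs b \<nu> a g K u x + adjoint_rhs b \<nu> a h K v x"
  using volterra_integrable[of \<nu> x b K u] volterra_integrable[of \<nu> x b K v] assms
  by (simp add: adjoint_rhs_def distrib_left integral_add)

lemma adjoint_rhs_cmult:
  "adjoint_rhs b \<nu> a (\<lambda>x. c * g x) K (\<lambda>s. c * u s) x = c * adjoint_rhs b \<nu> a g K u x"
proof -
  have "integral {x..b} (\<lambda>s. (s - x) powr (\<nu> - 1) * K x s * (c * u s))
      = integral {x..b} (\<lambda>s. c * ((s - x) powr (\<nu> - 1) * K x s * u s))"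
    by (intro arg_cong[where f = "integral _"]) (auto simp: mult_ac)
  also have "\<dots> = c * integral {x..b} (\<lambda>s. (s - x) powr (\<nu> - 1) * K x s * u s)"
    by (rule integral_mult_right)
  finally show ?thesis
    by (simp add: adjoint_rhs_def algebra_simps)
qed

lemma adjoint_rhs_diff:
  assumes "\<nu> > 0" "x \<le> b" "continuous_on {x..b} (K x)"
    and "continuous_on {x..b} u" "continuous_on {x..b} v"
  shows "adjoint_rhs b \<nu> a g K u x - adjoint_rhs b \<nu> a g K v x
       = adjoint_rhs b \<nu> a (\<lambda>_. 0) K (\<lambda>s. u s - v s) x"
  using volterra_integrable[of \<nu> x b K u] volterra_integrable[of \<nu> x b K v] assms
  by (simp add: adjoint_rhs_def right_diff_distrib integral_diff)

lemma adjoint_rhs_cong: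
  assumes "x \<le> b" "\<And>s. s \<in> {x..b} \<Longrightarrow> u s = v s"
  shows "adjoint_rhs b \<nu> a g K u x = adjoint_rhs b \<nu> a g K v x"
proof -
  have "integral {x..b} (\<lambda>s. (s - x) powr (\<nu> - 1) * K x s * u s)
      = integral {x..b} (\<lambda>s. (s - x) powr (\<nu> - 1) * K x s * v s)"
    by (rule integral_cong) (use assms in auto)
  then show ?thesis using assms by (simp add: adjoint_rhs_def)
qed

lemma adjoint_rhs_bound:
  assumes \<nu>: "\<nu> > 0" and x: "0 \<le> x" "x \<le> b"
    and K: "continuous_on {x..b} (K x)" "\<And>s. s \<in> {x..b} \<Longrightarrow> \<bar>K x s\<bar> \<le> KB"
    and a: "\<bar>a x\<bar> \<le> aB"
    and u: "continuous_on {x..b} u" "\<And>s. s \<in> {x..b} \<Longrightarrow> \<bar>u s\<bar> \<le> S"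
  shows "\<bar>adjoint_rhs b \<nu> a (\<lambda>_. 0) K u x\<bar> \<le> (aB + KB * (b powr \<nu> / \<nu>)) * S"
proof -
  have S: "0 \<le> S" using u(2)[of x] x by auto
  have KB: "0 \<le> KB" using K(2)[of x] x by auto
  have W: "((\<lambda>s. (s - x) powr (\<nu> - 1) * (KB * S)) has_integral ((b - x) powr \<nu> / \<nu>) * (KB * S)) {x..b}"
    by (intro has_integral_mult_left weakly_singular_has_integral \<nu> x)
  have "\<bar>integral {x..b} (\<lambda>s. (s - x) powr (\<nu> - 1) * K x s * u s)\<bar>
      \<le> integral {x..b} (\<lambda>s. (s - x) powr (\<nu> - 1) * (KB * S))"
    unfolding real_norm_def[symmetric]
  proof (rule integral_norm_bound_integral)
    show "(\<lambda>s. (s - x) powr (\<nu> - 1) * K x s * u s) integrable_on {x..b}"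
      using \<nu> x(2) K(1) u(1) by (rule volterra_integrable)
    show "(\<lambda>s. (s - x) powr (\<nu> - 1) * (KB * S)) integrable_on {x..b}"
      using W by (rule has_integral_integrable)
    show "norm ((s - x) powr (\<nu> - 1) * K x s * u s) \<le> (s - x) powr (\<nu> - 1) * (KB * S)"
      if "s \<in> {x..b}" for s
      using K(2)[OF that] u(2)[OF that] KB
      by (simp add: abs_mult mult.assoc) (intro mult_left_mono mult_mono; simp)
  qed
  also have "\<dots> = ((b - x) powr \<nu> / \<nu>) * (KB * S)"
    using W by (rule integral_unique)
  also have "\<dots> \<le> (b powr \<nu> / \<nu>) * (KB * S)"
    using x \<nu> KB S by (intro mult_right_mono divide_right_mono powr_mono2) auto
  finally have 1: "\<bar>integral {x..b} (\<lambda>s. (s - x) powr (\<nu> - 1) * K x s * u s)\<bar>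
      \<le> (b powr \<nu> / \<nu>) * (KB * S)" .
  have "\<bar>a x * u x\<bar> \<le> aB * S"
    unfolding abs_mult using a u(2)[of x] x by (intro mult_mono) auto
  with 1 show ?thesis
    unfolding adjoint_rhs_def by (simp add: algebra_simps)
qed

section \<open>The graded mesh\<close>

text \<open>Bernoulli's inequality for exponents at least \<open>1\<close>; smaller ones only decrease the left-hand side.
  It turns the grading of the mesh into bounds for its widths.\<close>

lemma one_minus_powr_le:
  fixes p v :: real
  assumes p: "p > 0" and v: "0 \<le> v" "v \<le> 1"
  shows "1 - v powr p \<le> max 1 p * (1 - v)"
proof (cases "v = 0 \<or> v = 1")
  case True
  then show ?thesis by auto
next
  case False
  then have v: "0 < v" "v < 1" using v by auto
  show ?thesis
  proof (cases "p \<ge> 1")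
    case True
    have "\<exists>z>v. z < 1 \<and> 1 powr p - v powr p = (1 - v) * (p * z powr (p - 1))"
      using v by (intro MVT2) (auto intro!: derivative_eq_intros)
    then obtain z where z: "v < z" "z < 1" "1 powr p - v powr p = (1 - v) * (p * z powr (p - 1))"
      by blast
    have "z powr (p - 1) \<le> 1" using z v True by (intro powr_le1) auto
    then have "(1 - v) * (p * z powr (p - 1)) \<le> (1 - v) * (p * 1)"
      using v p by (intro mult_left_mono) auto
    then show ?thesis using z(3) True by (simp add: max_def mult.commute)
  next
    case False
    have "v powr 1 \<le> v powr p" using v p False by (intro powr_mono') auto
    then show ?thesis using v False by (simp add: max_def)
  qed
qed

text \<open>The variable \<open>\<rho>\<close> in which the approximations are piecewise polynomials; the inverse of \<open>tau\<close>.\<close>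

definition frac_coord :: "real \<Rightarrow> real \<Rightarrow> real \<Rightarrow> real" where
  "frac_coord b \<mu> s = b - (b - s) powr \<mu>"

lemma tau_frac_coord: "\<mu> > 0 \<Longrightarrow> s \<le> b \<Longrightarrow> tau b \<mu> (frac_coord b \<mu> s) = s"
  by (simp add: tau_def frac_coord_def powr_powr)

lemma frac_coord_tau: "\<mu> > 0 \<Longrightarrow> \<rho> \<le> b \<Longrightarrow> frac_coord b \<mu> (tau b \<mu> \<rho>) = \<rho>"
  by (simp add: tau_def frac_coord_def powr_powr)

lemma frac_coord_mono: "\<mu> > 0 \<Longrightarrow> s \<le> t \<Longrightarrow> t \<le> b \<Longrightarrow> frac_coord b \<mu> s \<le> frac_coord b \<mu> t"
  by (simp add: frac_coord_def powr_mono2)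

lemma frac_coord_strict_mono:
  "\<mu> > 0 \<Longrightarrow> s < t \<Longrightarrow> t \<le> b \<Longrightarrow> frac_coord b \<mu> s < frac_coord b \<mu> t"
  by (simp add: frac_coord_def powr_less_mono2)

lemma tau_mono: "\<mu> > 0 \<Longrightarrow> \<rho> \<le> \<sigma> \<Longrightarrow> \<sigma> \<le> b \<Longrightarrow> tau b \<mu> \<rho> \<le> tau b \<mu> \<sigma>"
  by (simp add: tau_def powr_mono2)

lemma continuous_on_frac_coord:
  "\<mu> > 0 \<Longrightarrow> S \<subseteq> {..b} \<Longrightarrow> continuous_on S (frac_coord b \<mu>)"
  unfolding frac_coord_def by (intro continuous_intros continuous_on_powr') auto

locale graded_mesh =
  fixes b \<mu> q :: real and n :: nat and \<xi> :: "nat \<Rightarrow> real" and M :: nat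
  assumes b: "b > 0" and mu: "0 < \<mu>" "\<mu> < 1" and q: "q \<ge> 1" and n: "n \<ge> 2"
    and xi: "0 \<le> \<xi> 1" "strict_mono_on {1..n} \<xi>" "\<xi> n \<le> 1" and M: "M \<ge> 1"
begin

abbreviation "x \<equiv> mesh_pt b q M"
abbreviation "rp \<equiv> rho_pt b \<mu> q M"
abbreviation "cp \<equiv> colloc_pt b \<mu> q \<xi> M"

text \<open>The position within the \<open>j\<close>-th interval, measured in the variable \<open>\<rho>\<close>. In this coordinate the
  collocation points are the \<open>\<xi> l\<close> and the fractional Lagrange basis is the ordinary one, on every
  interval.\<close>

definition "zeta j s = (frac_coord b \<mu> s - rp (j - 1)) / (rp j - rp (j - 1))"

lemma inj_xi: "inj_on \<xi> {1..n}"
  using xi(2) strict_mono_on_imp_inj_on by blast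

lemma xi_range: "k \<in> {1..n} \<Longrightarrow> \<xi> k \<in> {0..1}"
proof -
  assume k: "k \<in> {1..n}"
  have "\<xi> 1 \<le> \<xi> k" "\<xi> k \<le> \<xi> n"
    using k strict_mono_on_leD[OF xi(2)] by auto
  then show ?thesis using xi by auto
qed

lemma mesh_complement: "j \<le> M \<Longrightarrow> b - x j = b * (real (M - j) / real M) powr q"
  by (simp add: mesh_pt_def algebra_simps of_nat_diff)

lemma mesh_0: "x 0 = 0" and mesh_M: "x M = b"
  using M by (auto simp: mesh_pt_def)

lemma mesh_strict: "j \<in> {1..M} \<Longrightarrow> x (j - 1) < x j"
proof -
  assume j: "j \<in> {1..M}"
  have "(real (M - j) / real M) powr q < (real (M - (j - 1)) / real M) powr q"
    using j q by (intro powr_less_mono2 divide_strict_right_mono) auto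
  then have "b * (real (M - j) / real M) powr q < b * (real (M - (j - 1)) / real M) powr q"
    using b by (rule mult_strict_left_mono)
  then have "b - x j < b - x (j - 1)"
    using j by (subst (1 2) mesh_complement) auto
  then show ?thesis by simp
qed

lemma mesh_mono: "i \<le> j \<Longrightarrow> j \<le> M \<Longrightarrow> x i \<le> x j"
proof (induction j rule: dec_induct)
  case (step m)
  then show ?case using mesh_strict[of "Suc m"] by auto
qed simp

lemma mesh_range: "j \<le> M \<Longrightarrow> 0 \<le> x j" "j \<le> M \<Longrightarrow> x j \<le> b"
  using mesh_mono[of 0 j] mesh_mono[of j M] mesh_0 mesh_M by auto

lemma rho_pt_eq: "rp j = frac_coord b \<mu> (x j)"
  by (simp add: rho_pt_def frac_coord_def)

lemma rho_strict: "j \<in> {1..M} \<Longrightarrow> rp (j - 1) < rp j"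
  unfolding rho_pt_eq using mesh_strict[of j] mesh_range[of j] mu
  by (intro frac_coord_strict_mono) auto

lemma rho_le_b: "rp j \<le> b"
  by (simp add: rho_pt_def)

lemma zeta_range:
  assumes j: "j \<in> {1..M}" and s: "s \<in> {x (j - 1)..x j}"
  shows "zeta j s \<in> {0..1}"
proof -
  have "rp (j - 1) \<le> frac_coord b \<mu> s" "frac_coord b \<mu> s \<le> rp j"
    unfolding rho_pt_eq using assms mesh_range[of j] mu by (auto intro!: frac_coord_mono)
  then show ?thesis using rho_strict[OF j] by (auto simp: zeta_def field_simps)
qed

lemma zeta_ends: "j \<in> {1..M} \<Longrightarrow> zeta j (x (j - 1)) = 0" "j \<in> {1..M} \<Longrightarrow> zeta j (x j) = 1"
  using rho_strict[of j] by (auto simp: zeta_def rho_pt_eq)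

lemma frac_coord_zeta: "j \<in> {1..M} \<Longrightarrow> frac_coord b \<mu> s = rp (j - 1) + zeta j s * (rp j - rp (j - 1))"
  using rho_strict[of j] by (simp add: zeta_def)

lemma eta_range:
  assumes j: "j \<in> {1..M}" and l: "l \<in> {1..n}"
  shows "eta_pt b \<mu> q \<xi> M j l \<in> {rp (j - 1)..rp j}"
proof -
  have "0 \<le> \<xi> l * (rp j - rp (j - 1))" "\<xi> l * (rp j - rp (j - 1)) \<le> 1 * (rp j - rp (j - 1))"
    using xi_range[OF l] rho_strict[OF j] by (auto intro!: mult_right_mono)
  then show ?thesis by (auto simp: eta_pt_def)
qed

lemma frac_coord_colloc:
  "j \<in> {1..M} \<Longrightarrow> l \<in> {1..n} \<Longrightarrow> frac_coord b \<mu> (cp j l) = eta_pt b \<mu> q \<xi> M j l"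
  unfolding colloc_pt_def using eta_range[of j l] rho_le_b[of j] mu
  by (intro frac_coord_tau) auto

lemma colloc_range:
  assumes j: "j \<in> {1..M}" and l: "l \<in> {1..n}"
  shows "cp j l \<in> {x (j - 1)..x j}"
proof -
  have "tau b \<mu> (rp (j - 1)) \<le> cp j l" "cp j l \<le> tau b \<mu> (rp j)"
    unfolding colloc_pt_def using eta_range[OF assms] rho_le_b[of j] mu
    by (auto intro!: tau_mono)
  moreover have "tau b \<mu> (rp (j - 1)) = x (j - 1)" "tau b \<mu> (rp j) = x j"
    using j mu mesh_range[of j] mesh_range[of "j - 1"] by (auto simp: rho_pt_eq tau_frac_coord)
  ultimately show ?thesis by simp
qed

lemma colloc_range': "j \<in> {1..M} \<Longrightarrow> l \<in> {1..n} \<Longrightarrow> 0 \<le> cp j l \<and> cp j l \<le> b"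
  using colloc_range[of j l] mesh_range(1)[of "j - 1", OF order_trans[OF diff_le_self]]
    mesh_range(2)[of j] by auto

lemma zeta_colloc: "j \<in> {1..M} \<Longrightarrow> l \<in> {1..n} \<Longrightarrow> zeta j (cp j l) = \<xi> l"
  using rho_strict[of j] by (simp add: zeta_def frac_coord_colloc eta_pt_def)

lemma frac_lagrange_eq:
  assumes j: "j \<in> {1..M}" and k: "k \<in> {1..n}"
  shows "frac_lagrange b \<mu> q \<xi> n M j k s = lagrange_basis \<xi> n k (zeta j s)"
  unfolding frac_lagrange_def lagrange_basis_def
proof (intro prod.cong refl)
  fix i assume i: "i \<in> {1..n} - {k}"
  define h where "h = rp j - rp (j - 1)"
  have h: "h > 0" using rho_strict[OF j] by (simp add: h_def)
  have c: "(b - cp j l) powr \<mu> = b - rp (j - 1) - \<xi> l * h" if "l \<in> {1..n}" for l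
    using frac_coord_colloc[OF j that] by (simp add: frac_coord_def eta_pt_def h_def)
  have s: "(b - s) powr \<mu> = b - rp (j - 1) - zeta j s * h"
    using frac_coord_zeta[OF j, of s] by (simp add: frac_coord_def h_def)
  have "((b - s) powr \<mu> - (b - cp j i) powr \<mu>) / ((b - cp j k) powr \<mu> - (b - cp j i) powr \<mu>)
      = ((\<xi> i - zeta j s) * h) / ((\<xi> i - \<xi> k) * h)"
    unfolding s c[OF k] c[OF DiffD1[OF i]] by (simp add: left_diff_distrib)
  also have "\<dots> = (\<xi> i - zeta j s) / (\<xi> i - \<xi> k)" using h by simp
  also have "\<dots> = (zeta j s - \<xi> i) / (\<xi> k - \<xi> i)"
    using minus_divide_divide[of "\<xi> i - zeta j s" "\<xi> i - \<xi> k"] by simp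
  finally show "((b - s) powr \<mu> - (b - cp j i) powr \<mu>) / ((b - cp j k) powr \<mu> - (b - cp j i) powr \<mu>)
      = (zeta j s - \<xi> i) / (\<xi> k - \<xi> i)" .
qed

lemma psi_piece_eq:
  "j \<in> {1..M} \<Longrightarrow> psi_piece b \<mu> q \<xi> n M Y j s = (\<Sum>k=1..n. Y j k * lagrange_basis \<xi> n k (zeta j s))"
  unfolding psi_piece_def by (intro sum.cong) (auto simp: frac_lagrange_eq)

lemma continuous_on_zeta: "S \<subseteq> {..b} \<Longrightarrow> continuous_on S (zeta j)"
  unfolding zeta_def divide_inverse using mu by (intro continuous_intros continuous_on_frac_coord) auto

lemma continuous_on_psi_piece:
  assumes "j \<in> {1..M}" "S \<subseteq> {..b}"
  shows "continuous_on S (psi_piece b \<mu> q \<xi> n M Y j)"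
proof -
  have "continuous_on S (\<lambda>s. \<Sum>k=1..n. Y j k * lagrange_basis \<xi> n k (zeta j s))"
    using assms by (intro continuous_intros continuous_on_zeta) auto
  then show ?thesis using assms by (simp add: psi_piece_eq)
qed

lemma psi_piece_colloc:
  assumes j: "j \<in> {1..M}" and l: "l \<in> {1..n}"
  shows "psi_piece b \<mu> q \<xi> n M Y j (cp j l) = Y j l"
proof -
  have "psi_piece b \<mu> q \<xi> n M Y j (cp j l) = (\<Sum>k=1..n. if k = l then Y j k else 0)"
    unfolding psi_piece_eq[OF j] zeta_colloc[OF j l]
    using lagrange_basis_node[OF inj_xi _ l] by (intro sum.cong) auto
  then show ?thesis using l by simp
qed

text \<open>The intervals are counted from the singular end \<open>b\<close>: the \<open>j\<close>-th one is the \<open>i\<close>-th from there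
  for \<open>i = M + 1 - j\<close>.\<close>

lemma mesh_width:
  assumes j: "j \<in> {1..M}"
  shows "x j - x (j - 1) \<le> q / real (M + 1 - j) * (b - x (j - 1))"
    and "x j - x (j - 1) \<le> b * q / real M"
    and "rp j - rp (j - 1) \<le> max 1 (q * \<mu>) / real (M + 1 - j) * (b - x (j - 1)) powr \<mu>"
proof -
  define i where "i = real (M + 1 - j)"
  have i: "i \<ge> 1" "i \<le> real M" "real (M - j) = i - 1" "real (M - (j - 1)) = i"
    using j by (auto simp: i_def of_nat_diff)
  define v where "v = (i - 1) / i"
  have v: "0 \<le> v" "v \<le> 1" "1 - v = 1 / i" using i by (auto simp: v_def field_simps)
  define y where "y = b - x (j - 1)"
  have "y = b * (real (M - (j - 1)) / real M) powr q"
    unfolding y_def using j by (intro mesh_complement) auto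
  then have y: "y = b * (i / real M) powr q" "y > 0"
    unfolding i(4) using i b M by auto
  have "(i - 1) / real M = (i / real M) * v" using i by (simp add: v_def)
  then have yv: "b - x j = y * v powr q"
    using j v y mesh_complement[of j] powr_mult[of "i / real M" v q] i(1) unfolding i(3) by simp
  have 1: "1 - v powr q \<le> q / i"
    using one_minus_powr_le[of q v] v q by (simp add: max_def)
  have d: "x j - x (j - 1) = y * (1 - v powr q)"
    using yv by (simp add: y_def algebra_simps)
  then have "x j - x (j - 1) \<le> y * (q / i)"
    using mult_left_mono[OF 1, of y] y by simp
  then show A: "x j - x (j - 1) \<le> q / real (M + 1 - j) * (b - x (j - 1))"
    by (simp add: y_def i_def mult.commute)
  have "(i / real M) powr q \<le> (i / real M) powr 1"
    using i q by (intro powr_mono') auto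
  then have "(i / real M) powr q \<le> i / real M" using i by simp
  then have "y \<le> b * (i / real M)" unfolding y(1) using b by (intro mult_left_mono) auto
  then have "y * (q / i) \<le> b * (i / real M) * (q / i)"
    using q i by (intro mult_right_mono) auto
  also have "\<dots> = b * q / real M" using i by simp
  finally show "x j - x (j - 1) \<le> b * q / real M"
    using \<open>x j - x (j - 1) \<le> y * (q / i)\<close> by linarith
  have "rp j - rp (j - 1) = y powr \<mu> - (y * v powr q) powr \<mu>"
    using yv by (simp add: rho_pt_def y_def)
  also have "\<dots> = y powr \<mu> * (1 - v powr (q * \<mu>))"
    using y v by (simp add: powr_mult powr_powr algebra_simps)
  also have "\<dots> \<le> y powr \<mu> * (max 1 (q * \<mu>) * (1 - v))"
    using v q mu by (intro mult_left_mono one_minus_powr_le) auto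
  finally show "rp j - rp (j - 1) \<le> max 1 (q * \<mu>) / real (M + 1 - j) * (b - x (j - 1)) powr \<mu>"
    using v by (simp add: y_def i_def mult.commute)
qed

text \<open>Apart from the interval at \<open>b\<close>, the distance to the singularity is comparable at both ends.\<close>

lemma mesh_ratio:
  assumes j: "j \<in> {1..<M}"
  shows "(b - x (j - 1)) powr \<mu> \<le> 2 powr (q * \<mu>) * (b - x j) powr \<mu>"
proof -
  have "real (M - (j - 1)) / real M \<le> 2 * (real (M - j) / real M)"
  proof -
    have "M - (j - 1) \<le> 2 * (M - j)" using j by auto
    then have "real (M - (j - 1)) \<le> 2 * real (M - j)" by linarith
    then show ?thesis using divide_right_mono[of _ _ "real M"] by fastforce
  qed
  then have "(real (M - (j - 1)) / real M) powr q \<le> (2 * (real (M - j) / real M)) powr q"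
    using q by (intro powr_mono2) auto
  also have "\<dots> = 2 powr q * (real (M - j) / real M) powr q"
    using powr_mult[of 2 "real (M - j) / real M" q] by simp
  finally have "b * (real (M - (j - 1)) / real M) powr q
      \<le> b * (2 powr q * (real (M - j) / real M) powr q)"
    using b by (intro mult_left_mono) auto
  also have "b * (real (M - (j - 1)) / real M) powr q = b - x (j - 1)"
    using j by (intro mesh_complement[symmetric]) auto
  also have "b * (2 powr q * (real (M - j) / real M) powr q) = 2 powr q * (b - x j)"
    using j by (subst mesh_complement) auto
  finally have "b - x (j - 1) \<le> 2 powr q * (b - x j)" .
  then have "(b - x (j - 1)) powr \<mu> \<le> (2 powr q * (b - x j)) powr \<mu>"
    using mu mesh_range[of "j - 1"] j by (intro powr_mono2) auto
  also have "\<dots> = 2 powr (q * \<mu>) * (b - x j) powr \<mu>"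
    using mesh_range[of j] j by (simp add: powr_mult powr_powr)
  finally show ?thesis .
qed

end

lemma one_le_width_factor:
  fixes q \<mu> :: real
  assumes "q \<ge> 1" "\<mu> > 0"
  shows "1 \<le> max 1 (q * \<mu>) * 2 powr (q * \<mu>)"
proof -
  have "1 \<le> 2 powr (q * \<mu>)" using assms by (intro ge_one_powr_ge_zero) auto
  then show ?thesis using mult_mono[of 1 "max 1 (q * \<mu>)" 1 "2 powr (q * \<mu>)"] by simp
qed

context graded_mesh
begin

abbreviation "width_const \<equiv> max 1 (q * \<mu>) * 2 powr (q * \<mu>)"

lemma width_const_ge_1: "width_const \<ge> 1"
  using one_le_width_factor[OF q mu(1)] .

text \<open>In the variable \<open>\<rho>\<close> the \<open>i\<close>-th interval counted from the singular end has a width of at most the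
  order of \<open>1 / i\<close> times the distance of its far end to the singularity. Hence each power of the width that
  accompanies a derivative compensates the growth of its weight and leaves a factor \<open>1 / i\<close>.\<close>

lemma scaled_weight_le:
  assumes j: "j \<in> {1..<M}" and m: "\<alpha> \<le> real m" "m \<le> n + 1" and \<alpha>: "\<alpha> > 0"
    and w: "(b - x j) powr \<mu> \<le> w"
  shows "(rp j - rp (j - 1)) ^ m * w powr (\<alpha> - real m)
     \<le> width_const ^ (n + 1) / real (M + 1 - j) ^ m * ((b - x (j - 1)) powr \<mu>) powr \<alpha>"
proof -
  define z where "z = (b - x (j - 1)) powr \<mu>"
  define T where "T = 2 powr (q * \<mu>)"
  define P where "P = max 1 (q * \<mu>)"
  define i where "i = real (M + 1 - j)"
  have i: "i > 0" using j by (simp add: i_def)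
  have T: "T \<ge> 1" unfolding T_def using q mu by (intro ge_one_powr_ge_zero) auto
  have P: "P \<ge> 1" by (simp add: P_def)
  have "x (j - 1) < b" using mesh_strict[of j] mesh_range(2)[of j] j by auto
  then have z: "z > 0" by (simp add: z_def)
  have h: "0 \<le> rp j - rp (j - 1)" using rho_strict[of j] j by auto
  have "rp j - rp (j - 1) \<le> P / i * z"
    unfolding P_def i_def z_def using j by (intro mesh_width) auto
  then have 1: "(rp j - rp (j - 1)) ^ m \<le> (P / i * z) ^ m"
    using h by (rule power_mono)
  have "z \<le> T * w"
    unfolding z_def T_def using order_trans[OF mesh_ratio[OF j] mult_left_mono[OF w]] by simp
  then have "z / T \<le> w"
    using T by (simp add: divide_le_eq mult.commute)
  then have "w powr (\<alpha> - real m) \<le> (z / T) powr (\<alpha> - real m)"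
    using m z T by (intro powr_mono2') auto
  also have "\<dots> = z powr (\<alpha> - real m) * T powr (real m - \<alpha>)"
    using z T by (simp add: powr_divide powr_minus_divide[of T "\<alpha> - real m", simplified])
  also have "\<dots> \<le> z powr (\<alpha> - real m) * T powr real m"
    using T \<alpha> by (intro mult_left_mono powr_mono) auto
  also have "\<dots> = z powr \<alpha> / z ^ m * T ^ m"
    using z T by (simp add: powr_diff powr_realpow)
  finally have 2: "w powr (\<alpha> - real m) \<le> z powr \<alpha> / z ^ m * T ^ m" .
  have "(rp j - rp (j - 1)) ^ m * w powr (\<alpha> - real m) \<le> (P / i * z) ^ m * (z powr \<alpha> / z ^ m * T ^ m)"
    using 1 2 P i z by (intro mult_mono) auto
  also have "\<dots> = (P * T) ^ m / i ^ m * z powr \<alpha>"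
    using z i by (simp add: power_mult_distrib power_divide)
  also have "\<dots> \<le> (P * T) ^ (n + 1) / i ^ m * z powr \<alpha>"
    using m i width_const_ge_1
    by (intro mult_right_mono divide_right_mono power_increasing) (auto simp: P_def T_def)
  finally show ?thesis by (simp add: P_def T_def i_def z_def)
qed

text \<open>The substitution to the reference interval has the non-constant Jacobian
  \<open>h (b - s) powr (1 - \<mu>) / \<mu>\<close>. Integration by parts moves the derivative onto it, because the
  primitive of the nodal polynomial vanishes at both ends; this gains a factor \<open>1 / i\<close>.\<close>

lemma integral_nodal_poly:
  assumes j: "j \<in> {1..<M}" and orth: "integral {0..1} (\<lambda>\<zeta>. \<Prod>l=1..n. (\<zeta> - \<xi> l)) = 0"
  shows "\<bar>integral {x (j - 1)..x j} (\<lambda>s. \<Prod>l=1..n. (zeta j s - \<xi> l))\<bar>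
     \<le> width_const / \<mu> / real (M + 1 - j) * (x j - x (j - 1))"
proof -
  have j': "j \<in> {1..M}" using j by auto
  define Q where "Q t = (\<Prod>l=1..n. (t - \<xi> l))" for t
  define QI where "QI t = integral {0..t} Q" for t
  define h where "h = rp j - rp (j - 1)"
  have h: "h > 0" using rho_strict[OF j'] by (simp add: h_def)
  have jb: "x j < b" using mesh_strict[of "Suc j"] mesh_range(2)[of "Suc j"] j by auto
  have jj: "x (j - 1) < x j" using mesh_strict[OF j'] .
  have contQ: "continuous_on S Q" for S
    unfolding Q_def by (intro continuous_intros)
  have Q1: "\<bar>Q t\<bar> \<le> 1" if "t \<in> {0..1}" for t
    unfolding Q_def abs_prod
  proof (rule prod_le_1)
    show "0 \<le> \<bar>t - \<xi> l\<bar> \<and> \<bar>t - \<xi> l\<bar> \<le> 1" if "l \<in> {1..n}" for l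
      using xi_range[OF that] \<open>t \<in> {0..1}\<close> by auto
  qed
  have QI: "(QI has_real_derivative Q t) (at t within {0..1})" if "t \<in> {0..1}" for t
    unfolding QI_def using integral_has_real_derivative[OF contQ that] .
  have QI_bound: "\<bar>QI t\<bar> \<le> 1" if t: "t \<in> {0..1}" for t
  proof -
    have "norm (integral {0..t} Q) \<le> 1 * (t - 0)"
      using t Q1 contQ by (intro integral_bound) auto
    then show ?thesis using t by (simp add: QI_def)
  qed
  have QI_ends: "QI 0 = 0" "QI 1 = 0" using orth by (simp_all add: QI_def Q_def[abs_def])
  \<comment> \<open>\<open>V\<close> is the boundary term of the integration by parts, \<open>U\<close> the new integrand\<close>
  define V where "V s = h / \<mu> * (QI (zeta j s) * (b - s) powr (1 - \<mu>))" for s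
  define U where "U s = h * (1 - \<mu>) / \<mu> * (QI (zeta j s) * (b - s) powr (- \<mu>))" for s
  have V: "(V has_real_derivative (Q (zeta j s) - U s)) (at s within {x (j - 1)..x j})"
    if s: "s \<in> {x (j - 1)..x j}" for s
  proof -
    have sb: "s < b" using s jb by auto
    have z: "(zeta j has_real_derivative (\<mu> * (b - s) powr (\<mu> - 1) / h)) (at s within {x (j - 1)..x j})"
      unfolding zeta_def[abs_def] frac_coord_def h_def[symmetric] using sb h
      by (auto intro!: derivative_eq_intros)
    have "(QI has_real_derivative Q (zeta j s)) (at (zeta j s) within zeta j ` {x (j - 1)..x j})"
      using zeta_range[OF j'] s by (intro has_field_derivative_subset[OF QI]) auto
    from DERIV_image_chain[OF this z]
    have c: "((\<lambda>s. QI (zeta j s)) has_real_derivative (Q (zeta j s) * (\<mu> * (b - s) powr (\<mu> - 1) / h)))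
        (at s within {x (j - 1)..x j})" by (simp add: o_def)
    have p: "((\<lambda>s. (b - s) powr (1 - \<mu>)) has_real_derivative (- ((1 - \<mu>) * (b - s) powr (- \<mu>))))
        (at s within {x (j - 1)..x j})"
      using sb by (auto intro!: derivative_eq_intros)
    have pp: "(b - s) powr (\<mu> - 1) * (b - s) powr (1 - \<mu>) = 1"
      using sb by (simp add: powr_add[symmetric])
    have e: "h / \<mu> * (QI (zeta j s) * - ((1 - \<mu>) * (b - s) powr (- \<mu>))
          + Q (zeta j s) * (\<mu> * (b - s) powr (\<mu> - 1) / h) * (b - s) powr (1 - \<mu>))
        = Q (zeta j s) * ((b - s) powr (\<mu> - 1) * (b - s) powr (1 - \<mu>)) - U s"
      using h mu unfolding U_def by (simp add: field_simps)
    show ?thesis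
      unfolding V_def[abs_def]
      by (rule DERIV_cong[OF DERIV_cmult[OF DERIV_mult'[OF c p]]]) (use e pp in simp)
  qed
  have "((\<lambda>s. Q (zeta j s) - U s) has_integral (V (x j) - V (x (j - 1)))) {x (j - 1)..x j}"
    using jj V by (intro fundamental_theorem_of_calculus)
      (auto simp: has_real_derivative_iff_has_vector_derivative[symmetric])
  moreover have "V (x j) = 0" "V (x (j - 1)) = 0"
    unfolding V_def zeta_ends[OF j'] QI_ends by simp_all
  ultimately have I1: "((\<lambda>s. Q (zeta j s) - U s) has_integral 0) {x (j - 1)..x j}" by simp
  have contz: "continuous_on {x (j - 1)..x j} (zeta j)"
    using jb by (intro continuous_on_zeta) auto
  have "continuous_on {x (j - 1)..x j} (\<lambda>s. Q (zeta j s))"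
    unfolding Q_def by (intro continuous_intros contz)
  then have Qint: "(\<lambda>s. Q (zeta j s)) integrable_on {x (j - 1)..x j}"
    by (rule integrable_continuous_real)
  have "((\<lambda>s. Q (zeta j s) - (Q (zeta j s) - U s)) has_integral
      (integral {x (j - 1)..x j} (\<lambda>s. Q (zeta j s)) - 0)) {x (j - 1)..x j}"
    by (intro has_integral_diff I1 integrable_integral Qint)
  then have Uint: "(U has_integral (integral {x (j - 1)..x j} (\<lambda>s. Q (zeta j s)))) {x (j - 1)..x j}"
    by simp
  have Ub: "norm (U s) \<le> width_const / \<mu> / real (M + 1 - j)" if s: "s \<in> {x (j - 1)..x j}" for s
  proof -
    define i where "i = real (M + 1 - j)"
    have i: "i > 0" using j by (simp add: i_def)
    define Z where "Z = (b - x j) powr \<mu>"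
    have Z: "Z > 0" using jb by (simp add: Z_def)
    have "h \<le> max 1 (q * \<mu>) / i * (b - x (j - 1)) powr \<mu>"
      unfolding h_def i_def by (rule mesh_width(3)[OF j'])
    also have "\<dots> \<le> max 1 (q * \<mu>) / i * (2 powr (q * \<mu>) * Z)"
      unfolding Z_def using i by (intro mult_left_mono mesh_ratio j) auto
    finally have hZ: "h \<le> width_const / i * Z" by simp
    have "(b - s) powr (- \<mu>) \<le> (b - x j) powr (- \<mu>)"
      using s jb mu by (intro powr_mono2') auto
    then have p: "(b - s) powr (- \<mu>) \<le> 1 / Z" by (simp add: Z_def powr_minus_divide)
    have "norm (U s) = h * (1 - \<mu>) / \<mu> * (\<bar>QI (zeta j s)\<bar> * (b - s) powr (- \<mu>))"
      using h mu by (simp add: U_def abs_mult)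
    also have "\<dots> \<le> (width_const / i * Z) * 1 / \<mu> * (1 * (1 / Z))"
      using hZ p QI_bound[OF zeta_range[OF j' s]] h mu Z i
      by (intro mult_mono divide_right_mono) auto
    also have "\<dots> = width_const / \<mu> / i" using Z by simp
    finally show ?thesis by (simp add: i_def)
  qed
  have "norm (integral {x (j - 1)..x j} (\<lambda>s. Q (zeta j s)))
      \<le> width_const / \<mu> / real (M + 1 - j) * measure lborel {x (j - 1)..x j}"
    by (rule has_integral_bound_real[OF _ finite.emptyI Uint]) (use width_const_ge_1 mu Ub in auto)
  then show ?thesis using jj by (simp add: Q_def)
qed

end

section \<open>Interpolation of a singular function on the graded mesh\<close>

text \<open>\<open>F k\<close> is the \<open>k\<close>-th derivative of a function with a singularity of order \<open>\<alpha>\<close> at \<open>b\<close>. On the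
  interval next to \<open>b\<close> the weight of the \<open>n\<close>-th derivative is relaxed: trading half of the exponent
  \<open>\<alpha>\<close> for the length of this interval leaves room for a logarithm there, and \<open>D\<close> may then depend
  on the mesh.\<close>

locale graded_interpolation = graded_mesh b \<mu> q n \<xi> M
  for b \<mu> q :: real and n :: nat and \<xi> :: "nat \<Rightarrow> real" and M :: nat +
  fixes F :: "nat \<Rightarrow> real \<Rightarrow> real" and \<alpha> D \<Lambda> :: real
  assumes alpha: "0 < \<alpha>" "\<alpha> \<le> real n" and D: "D \<ge> 0" and Lam: "\<Lambda> \<ge> 0"
    and cont: "continuous_on {b - b powr \<mu>..b} (F 0)"
    and deriv: "\<And>k \<rho>. k < n + 1 \<Longrightarrow> \<rho> \<in> {b - b powr \<mu>..<b} \<Longrightarrow>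
        (F k has_real_derivative F (Suc k) \<rho>) (at \<rho> within {b - b powr \<mu>..<b})"
    and away: "\<And>m \<rho>. m \<in> {n, n + 1} \<Longrightarrow> \<rho> \<in> {b - b powr \<mu>..<b} \<Longrightarrow>
        (b - x (M - 1)) powr \<mu> \<le> b - \<rho> \<Longrightarrow> \<bar>F m \<rho>\<bar> \<le> D * (b - \<rho>) powr (\<alpha> - real m)"
    and near: "\<And>\<rho>. \<rho> \<in> {b - b powr \<mu>..<b} \<Longrightarrow> b - \<rho> \<le> (b - x (M - 1)) powr \<mu> \<Longrightarrow>
        \<bar>F n \<rho>\<bar> \<le> D * ((b - x (M - 1)) powr \<mu>) powr (\<alpha> / 2) * (b - \<rho>) powr (\<alpha> / 2 - real n)"
    and lag: "\<And>k t. k \<in> {1..n} \<Longrightarrow> t \<in> {0..1} \<Longrightarrow> \<bar>lagrange_basis \<xi> n k t\<bar> \<le> \<Lambda>"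
    and orth: "integral {0..1} (\<lambda>\<zeta>. \<Prod>l=1..n. (\<zeta> - \<xi> l)) = 0"
begin

text \<open>The interpolation error of \<open>F 0\<close> at the collocation points as a function of \<open>s\<close>; \<open>G j m\<close> is the
  \<open>m\<close>-th derivative of \<open>F 0\<close> with respect to the coordinate \<open>zeta\<close> of the \<open>j\<close>-th interval.\<close>

definition "res j s = F 0 (frac_coord b \<mu> s)
    - psi_piece b \<mu> q \<xi> n M (\<lambda>j k. F 0 (eta_pt b \<mu> q \<xi> M j k)) j s"

definition "G j m t = (rp j - rp (j - 1)) ^ m * F m (rp (j - 1) + t * (rp j - rp (j - 1)))"

abbreviation scale :: "nat \<Rightarrow> real" where "scale j \<equiv> ((b - x (j - 1)) powr \<mu>) powr \<alpha>"
abbreviation "point_const \<equiv> (1 + real n * \<Lambda>) * (width_const ^ (n + 1) + 2 / \<alpha>)"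
abbreviation "cell_const \<equiv> point_const + width_const ^ (n + 1) * (width_const / \<mu>)"

lemma res_eq:
  assumes j: "j \<in> {1..M}"
  shows "res j s = G j 0 (zeta j s) - (\<Sum>k=1..n. G j 0 (\<xi> k) * lagrange_basis \<xi> n k (zeta j s))"
  unfolding res_def psi_piece_eq[OF j] frac_coord_zeta[OF j] G_def eta_pt_def by simp

lemma rho_0: "rp 0 = b - b powr \<mu>"
  using mesh_0 by (simp add: rho_pt_def)

lemma ref_range:
  assumes j: "j \<in> {1..M}" and t: "t \<in> {0..1}"
  shows "rp (j - 1) + t * (rp j - rp (j - 1)) \<in> {rp (j - 1)..rp j}" "rp (j - 1) \<ge> b - b powr \<mu>"
proof -
  have "0 \<le> t * (rp j - rp (j - 1))" "t * (rp j - rp (j - 1)) \<le> 1 * (rp j - rp (j - 1))"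
    using t rho_strict[OF j] by (auto intro!: mult_right_mono)
  then show "rp (j - 1) + t * (rp j - rp (j - 1)) \<in> {rp (j - 1)..rp j}" by auto
  show "rp (j - 1) \<ge> b - b powr \<mu>"
    unfolding rho_0[symmetric] rho_pt_eq using mesh_mono[of 0 "j - 1"] mesh_range(2)[of "j - 1"] j mu
    by (intro frac_coord_mono) auto
qed

lemma ref_range':
  assumes j: "j \<in> {1..M}" and t: "t \<in> {0..<1}"
  shows "rp (j - 1) + t * (rp j - rp (j - 1)) \<in> {b - b powr \<mu>..<b}"
proof -
  define h where "h = rp j - rp (j - 1)"
  have h: "h > 0" "rp (j - 1) + h \<le> b" using rho_strict[OF j] rho_le_b[of j] by (auto simp: h_def)
  have "t * h < 1 * h"
    using t h by (intro mult_strict_right_mono) auto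
  then have "rp (j - 1) + t * (rp j - rp (j - 1)) < b" using h(2) unfolding h_def[symmetric] by linarith
  moreover have "rp (j - 1) + t * (rp j - rp (j - 1)) \<ge> b - b powr \<mu>"
    using ref_range[OF j, of t] t by auto
  ultimately show ?thesis by simp
qed

lemma continuous_on_G: "j \<in> {1..M} \<Longrightarrow> continuous_on {0..1} (G j 0)"
  unfolding G_def power_0 mult_1_left
proof (rule continuous_on_compose2[OF cont])
  show "(\<lambda>t. rp (j - 1) + t * (rp j - rp (j - 1))) ` {0..1} \<subseteq> {b - b powr \<mu>..b}" if "j \<in> {1..M}"
    using ref_range[OF that] rho_le_b[of j] by fastforce
qed (intro continuous_intros)

lemma deriv_G:
  assumes j: "j \<in> {1..M}" and k: "k < n + 1" and t: "t \<in> {0..<1}"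
  shows "(G j k has_real_derivative G j (Suc k) t) (at t within {0..<1})"
proof -
  define h where "h = rp j - rp (j - 1)"
  define u where "u = (\<lambda>t. rp (j - 1) + t * h)"
  have "(F k has_real_derivative F (Suc k) (u t)) (at (u t) within u ` {0..<1})"
    using ref_range'[OF j] t unfolding u_def h_def
    by (intro has_field_derivative_subset[OF deriv[OF k]]) auto
  moreover have "(u has_real_derivative h) (at t within {0..<1})"
    unfolding u_def by (auto intro!: derivative_eq_intros)
  ultimately have "(F k \<circ> u has_real_derivative F (Suc k) (u t) * h) (at t within {0..<1})"
    by (rule DERIV_image_chain)
  from DERIV_cmult[OF this, of "h ^ k"] show ?thesis
    unfolding G_def[abs_def] h_def[symmetric] by (simp add: u_def o_def mult_ac)
qed

lemma G_bound_away:
  assumes j: "j \<in> {1..<M}" and m: "m \<in> {n, n + 1}" and t: "t \<in> {0..<1}"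
  shows "\<bar>G j m t\<bar> \<le> width_const ^ (n + 1) * (D / real (M + 1 - j) ^ m * scale j)"
proof -
  have j': "j \<in> {1..M}" using j by auto
  define h where "h = rp j - rp (j - 1)"
  have h: "h \<ge> 0" using rho_strict[OF j'] by (simp add: h_def)
  define \<rho> where "\<rho> = rp (j - 1) + t * h"
  have \<rho>: "\<rho> \<in> {b - b powr \<mu>..<b}" using ref_range'[OF j' t] by (simp add: \<rho>_def h_def)
  have "\<rho> \<le> rp j" using ref_range(1)[OF j', of t] t by (simp add: \<rho>_def h_def)
  then have w: "(b - x j) powr \<mu> \<le> b - \<rho>" by (simp add: rho_pt_def)
  have "(b - x (M - 1)) powr \<mu> \<le> (b - x j) powr \<mu>"
    using mesh_mono[of j "M - 1"] mesh_range(2)[of "M - 1"] j mu by (intro powr_mono2) auto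
  then have "\<bar>F m \<rho>\<bar> \<le> D * (b - \<rho>) powr (\<alpha> - real m)"
    using w by (intro away[OF m \<rho>]) linarith
  then have "\<bar>G j m t\<bar> \<le> h ^ m * (D * (b - \<rho>) powr (\<alpha> - real m))"
    using h unfolding G_def h_def[symmetric] \<rho>_def[symmetric] abs_mult
    by (auto intro!: mult_left_mono)
  also have "\<dots> = D * (h ^ m * (b - \<rho>) powr (\<alpha> - real m))" by (simp add: mult_ac)
  also have "\<dots> \<le> D * (width_const ^ (n + 1) / real (M + 1 - j) ^ m * scale j)"
    unfolding h_def using m alpha w by (intro mult_left_mono D scaled_weight_le j) auto
  finally show ?thesis by (simp add: mult_ac)
qed

lemma G_bound_near:
  assumes t: "t \<in> {0..<1}"
  shows "\<bar>G M n t\<bar> \<le> D * scale M * (1 - t) powr (\<alpha> / 2 - real n)"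
proof -
  have j: "M \<in> {1..M}" using M by auto
  define z where "z = (b - x (M - 1)) powr \<mu>"
  have h: "rp M - rp (M - 1) = z"
    using mesh_M by (simp add: rho_pt_def z_def)
  have z: "z > 0" using rho_strict[OF j] h by simp
  define \<rho> where "\<rho> = rp (M - 1) + t * z"
  have \<rho>: "\<rho> \<in> {b - b powr \<mu>..<b}" using ref_range'[OF j t] unfolding \<rho>_def h .
  have b\<rho>: "b - \<rho> = z * (1 - t)"
    by (simp add: \<rho>_def rho_pt_def z_def algebra_simps)
  have "z * (1 - t) \<le> z" using t z by (simp add: mult_le_cancel_left1)
  then have "\<bar>F n \<rho>\<bar> \<le> D * z powr (\<alpha> / 2) * (b - \<rho>) powr (\<alpha> / 2 - real n)"
    using near[OF \<rho>] b\<rho> by (simp add: z_def)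
  then have "\<bar>G M n t\<bar> \<le> z ^ n * (D * z powr (\<alpha> / 2) * (z * (1 - t)) powr (\<alpha> / 2 - real n))"
    using z unfolding G_def h \<rho>_def[symmetric] abs_mult b\<rho>[symmetric]
    by (auto intro!: mult_left_mono)
  also have "\<dots> = D * (z powr real n * z powr (\<alpha> / 2) * z powr (\<alpha> / 2 - real n))
      * (1 - t) powr (\<alpha> / 2 - real n)"
    using z t by (simp add: powr_mult powr_realpow)
  also have "z powr real n * z powr (\<alpha> / 2) * z powr (\<alpha> / 2 - real n) = z powr \<alpha>"
    by (simp add: powr_add[symmetric])
  finally show ?thesis by (simp add: z_def)
qed

lemma point_const_bounds:
  "(1 + real n * \<Lambda>) * width_const ^ (n + 1) \<le> point_const"
  "(1 + real n * \<Lambda>) * (2 / \<alpha>) \<le> point_const" "0 \<le> point_const" "0 \<le> width_const ^ (n + 1)"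
proof -
  have w: "0 \<le> width_const ^ (n + 1)" using width_const_ge_1 by simp
  then show "0 \<le> width_const ^ (n + 1)" .
  have L: "0 \<le> 1 + real n * \<Lambda>" using Lam by simp
  show "(1 + real n * \<Lambda>) * width_const ^ (n + 1) \<le> point_const"
    using w L alpha by (intro mult_left_mono) auto
  show "(1 + real n * \<Lambda>) * (2 / \<alpha>) \<le> point_const"
    using w L alpha by (intro mult_left_mono) auto
  show "0 \<le> point_const"
    using w L alpha Lam by (intro mult_nonneg_nonneg add_nonneg_nonneg) auto
qed

text \<open>The expansion point is always the end of the interval away from \<open>b\<close>. The singular interval needs
  the weighted form of Taylor's formula, the other ones the form for bounded derivatives.\<close>

lemma res_pointwise:
  assumes j: "j \<in> {1..M}" and s: "s \<in> {x (j - 1)..x j}"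
  shows "\<bar>res j s\<bar> \<le> point_const * (D / real (M + 1 - j) ^ n * scale j)"
proof (cases "j = M")
  case True
  have "\<bar>G j 0 (zeta j s) - (\<Sum>k=1..n. G j 0 (\<xi> k) * lagrange_basis \<xi> n k (zeta j s))
      - (if n = n + 1 then G j n 0 / fact n else 0) * (\<Prod>l=1..n. (zeta j s - \<xi> l))\<bar>
      \<le> (1 + real n * \<Lambda>) * (D * scale M / (\<alpha> / 2))"
    using n alpha D G_bound_near unfolding True
    by (intro interpolation_error_taylor inj_xi xi_range lag continuous_on_G deriv_G zeta_range
        j[unfolded True] s[unfolded True]) auto
  then have "\<bar>res j s\<bar> \<le> (1 + real n * \<Lambda>) * (D * scale M / (\<alpha> / 2))"
    by (simp add: res_eq[OF j])
  also have "\<dots> = (1 + real n * \<Lambda>) * (2 / \<alpha>) * (D * scale M)" by simp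
  also have "\<dots> \<le> point_const * (D * scale M)"
    using point_const_bounds(2) D by (intro mult_right_mono) auto
  finally show ?thesis using True by simp
next
  case False
  then have j': "j \<in> {1..<M}" using j by auto
  define B where "B = width_const ^ (n + 1) * (D / real (M + 1 - j) ^ n * scale j)"
  have B: "0 \<le> B" unfolding B_def using point_const_bounds(4) D by (intro mult_nonneg_nonneg) auto
  have "\<bar>G j 0 (zeta j s) - (\<Sum>k=1..n. G j 0 (\<xi> k) * lagrange_basis \<xi> n k (zeta j s))
      - (if n = n + 1 then G j n 0 / fact n else 0) * (\<Prod>l=1..n. (zeta j s - \<xi> l))\<bar>
      \<le> (1 + real n * \<Lambda>) * (B / real n)"
    using n B G_bound_away[OF j', of n]
    by (intro interpolation_error_taylor inj_xi xi_range lag continuous_on_G deriv_G zeta_range j s)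
       (auto simp: B_def)
  then have "\<bar>res j s\<bar> \<le> (1 + real n * \<Lambda>) * (B / real n)"
    by (simp add: res_eq[OF j])
  also have "\<dots> \<le> (1 + real n * \<Lambda>) * B"
    using B n Lam by (intro mult_left_mono) (auto simp: divide_le_eq mult_le_cancel_left1)
  also have "\<dots> = (1 + real n * \<Lambda>) * width_const ^ (n + 1) * (D / real (M + 1 - j) ^ n * scale j)"
    by (simp add: B_def mult.assoc)
  also have "\<dots> \<le> point_const * (D / real (M + 1 - j) ^ n * scale j)"
    using point_const_bounds(1) D by (intro mult_right_mono) auto
  finally show ?thesis .
qed

lemma continuous_on_res:
  assumes j: "j \<in> {1..M}"
  shows "continuous_on {x (j - 1)..x j} (res j)"
proof -
  have "continuous_on {x (j - 1)..x j} (\<lambda>s. G j 0 (zeta j s))"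
    using zeta_range[OF j] mesh_range(2)[of j] j
    by (intro continuous_on_compose2[OF continuous_on_G[OF j]] continuous_on_zeta) auto
  then show ?thesis
    unfolding res_eq[OF j, abs_def] using mesh_range(2)[of j] j
    by (intro continuous_intros continuous_on_zeta) auto
qed

lemma integral_res_partial:
  assumes j: "j \<in> {1..M}" and s: "s \<in> {x (j - 1)..x j}"
  shows "\<bar>integral {s..x j} (res j)\<bar>
      \<le> point_const * (D / real (M + 1 - j) ^ n * scale j) * (x j - x (j - 1))"
proof -
  have "norm (integral {s..x j} (res j)) \<le> point_const * (D / real (M + 1 - j) ^ n * scale j) * (x j - s)"
  proof (rule integral_bound)
    show "continuous_on {s..x j} (res j)"
      using s by (intro continuous_on_subset[OF continuous_on_res[OF j]]) auto
    show "norm (res j t) \<le> point_const * (D / real (M + 1 - j) ^ n * scale j)" if "t \<in> {s..x j}" for t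
      using res_pointwise[OF j, of t] that s by auto
  qed (use s in auto)
  also have "\<dots> \<le> point_const * (D / real (M + 1 - j) ^ n * scale j) * (x j - x (j - 1))"
    by (intro mult_left_mono mult_nonneg_nonneg[OF point_const_bounds(3)]) (use s D in auto)
  finally show ?thesis by simp
qed

text \<open>Over a whole interval the leading term of the interpolation error is a multiple of the nodal
  polynomial, whose integral is small by the orthogonality condition. This yields a factor
  \<open>1 / i\<close> more than the pointwise bound; on the interval at \<open>b\<close>, where \<open>i = 1\<close>, nothing is to be gained.\<close>

lemma integral_res_cell:
  assumes j: "j \<in> {1..M}"
  shows "\<bar>integral {x (j - 1)..x j} (res j)\<bar>
      \<le> cell_const * (D / real (M + 1 - j) ^ (n + 1) * scale j) * (x j - x (j - 1))"
proof (cases "j = M")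
  case True
  have jj: "x (j - 1) \<le> x j" using mesh_strict[OF j] by simp
  have "\<bar>integral {x (j - 1)..x j} (res j)\<bar>
      \<le> point_const * (D / real (M + 1 - j) ^ n * scale j) * (x j - x (j - 1))"
    using integral_res_partial[OF j, of "x (j - 1)"] jj by auto
  also have "\<dots> = point_const * (D / real (M + 1 - j) ^ (n + 1) * scale j) * (x j - x (j - 1))"
    using True by simp
  also have "\<dots> \<le> cell_const * (D / real (M + 1 - j) ^ (n + 1) * scale j) * (x j - x (j - 1))"
    using jj D width_const_ge_1 mu by (intro mult_right_mono) auto
  finally show ?thesis .
next
  case False
  then have j': "j \<in> {1..<M}" using j by auto
  define i where "i = real (M + 1 - j)"
  have i: "i > 0" using j by (simp add: i_def)
  have jj: "x (j - 1) \<le> x j" using mesh_strict[OF j] by simp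
  define c where "c = G j n 0 / fact n"
  define Q where "Q s = (\<Prod>l=1..n. (zeta j s - \<xi> l))" for s
  define E where "E = D / i ^ (n + 1) * scale j"
  have E: "0 \<le> E" using D i by (simp add: E_def)
  have zb: "{x (j - 1)..x j} \<subseteq> {..b}" using mesh_range(2)[of j] j by auto
  have cQ: "continuous_on {x (j - 1)..x j} Q"
    unfolding Q_def by (intro continuous_intros continuous_on_zeta zb)
  have rem: "\<bar>res j s - c * Q s\<bar> \<le> point_const * E" if s: "s \<in> {x (j - 1)..x j}" for s
  proof -
    define B where "B = width_const ^ (n + 1) * E"
    have B: "0 \<le> B" unfolding B_def using point_const_bounds(4) E by (rule mult_nonneg_nonneg)
    have "\<bar>G j 0 (zeta j s) - (\<Sum>k=1..n. G j 0 (\<xi> k) * lagrange_basis \<xi> n k (zeta j s))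
      - (if n + 1 = n + 1 then G j n 0 / fact n else 0) * (\<Prod>l=1..n. (zeta j s - \<xi> l))\<bar>
      \<le> (1 + real n * \<Lambda>) * (B / real (n + 1))"
      using n B G_bound_away[OF j', of "n + 1"]
      by (intro interpolation_error_taylor inj_xi xi_range lag continuous_on_G deriv_G zeta_range j s)
         (auto simp: B_def E_def i_def)
    then have "\<bar>res j s - c * Q s\<bar> \<le> (1 + real n * \<Lambda>) * (B / real (n + 1))"
      by (simp add: res_eq[OF j] c_def Q_def)
    also have "\<dots> \<le> (1 + real n * \<Lambda>) * B"
      using B n Lam by (intro mult_left_mono) (auto simp: divide_le_eq mult_le_cancel_left1)
    also have "\<dots> = (1 + real n * \<Lambda>) * width_const ^ (n + 1) * E"
      by (simp add: B_def mult.assoc)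
    also have "\<dots> \<le> point_const * E"
      using point_const_bounds(1) E by (intro mult_right_mono) auto
    finally show ?thesis .
  qed
  have cb: "\<bar>c\<bar> \<le> width_const ^ (n + 1) * (D / i ^ n * scale j)"
  proof -
    have "\<bar>c\<bar> \<le> \<bar>G j n 0\<bar> / 1"
      unfolding c_def abs_divide by (intro divide_left_mono) auto
    also have "\<dots> \<le> width_const ^ (n + 1) * (D / i ^ n * scale j)"
      using G_bound_away[OF j', of n 0] by (simp add: i_def)
    finally show ?thesis .
  qed
  have cr: "continuous_on {x (j - 1)..x j} (\<lambda>s. res j s - c * Q s)"
    by (intro continuous_intros continuous_on_res j cQ)
  have 1: "norm (integral {x (j - 1)..x j} (\<lambda>s. res j s - c * Q s)) \<le> point_const * E * (x j - x (j - 1))"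
    using jj rem by (intro integral_bound cr) auto
  have "integral {x (j - 1)..x j} (\<lambda>s. res j s - c * Q s)
      = integral {x (j - 1)..x j} (res j) - integral {x (j - 1)..x j} (\<lambda>s. c * Q s)"
    by (intro integral_diff integrable_continuous_real continuous_intros continuous_on_res j cQ)
  also have "integral {x (j - 1)..x j} (\<lambda>s. c * Q s) = c * integral {x (j - 1)..x j} Q"
    by (rule integral_mult_right)
  finally have 2: "integral {x (j - 1)..x j} (res j)
     = integral {x (j - 1)..x j} (\<lambda>s. res j s - c * Q s) + c * integral {x (j - 1)..x j} Q" by simp
  have "\<bar>c * integral {x (j - 1)..x j} Q\<bar>
      \<le> (width_const ^ (n + 1) * (D / i ^ n * scale j)) * (width_const / \<mu> / i * (x j - x (j - 1)))"
    unfolding abs_mult using cb integral_nodal_poly[OF j' orth]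
    by (intro mult_mono) (auto simp: Q_def[abs_def] i_def intro: order_trans[OF abs_ge_zero])
  also have "\<dots> = width_const ^ (n + 1) * (width_const / \<mu>) * E * (x j - x (j - 1))"
    by (simp add: E_def mult_ac)
  finally have 3: "\<bar>c * integral {x (j - 1)..x j} Q\<bar>
      \<le> width_const ^ (n + 1) * (width_const / \<mu>) * E * (x j - x (j - 1))" .
  have "\<bar>integral {x (j - 1)..x j} (res j)\<bar> \<le> point_const * E * (x j - x (j - 1))
      + width_const ^ (n + 1) * (width_const / \<mu>) * E * (x j - x (j - 1))"
    unfolding 2 using 1[unfolded real_norm_def] 3 by (rule order_trans[OF abs_triangle_ineq add_mono])
  also have "\<dots> = cell_const * E * (x j - x (j - 1))" by (simp only: distrib_right)
  finally show ?thesis by (simp only: E_def i_def)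
qed

end

section \<open>The weighted smoothness class and sums over the mesh\<close>

lemma one_plus_abs_ln_le:
  fixes z Z :: real
  assumes "0 < z" "z \<le> Z"
  shows "1 + \<bar>ln z\<bar> \<le> (1 + Z + Z\<^sup>2) * z powr (-1)"
proof -
  have "\<bar>ln z\<bar> \<le> z + 1 / z"
  proof -
    have "ln z \<le> z - 1" "- ln z \<le> 1 / z - 1" "0 < 1 / z"
      using ln_le_minus_one[of z] ln_le_minus_one[of "1 / z"] assms by (auto simp: ln_div)
    then show ?thesis using assms by linarith
  qed
  then have "1 + \<bar>ln z\<bar> \<le> (z + z * z + 1) * (1 / z)"
    using assms by (simp add: field_simps)
  also have "\<dots> \<le> (Z + Z * Z + 1) * (1 / z)"
    using assms by (intro mult_right_mono add_mono mult_mono) auto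
  finally show ?thesis using assms by (simp add: powr_minus_divide power2_eq_square add_ac)
qed

text \<open>The excess of the \<open>n\<close>-th derivative over a pure power in the critical case \<open>\<gamma> = n\<close>.\<close>

definition log_factor :: "nat \<Rightarrow> real \<Rightarrow> real \<Rightarrow> real" where
  "log_factor n \<gamma> z = (if real n = \<gamma> then 1 + \<bar>ln z\<bar> else 1)"

text \<open>Only the \<open>n\<close>-th and \<open>(n + 1)\<close>-st derivatives enter the error analysis, and for \<open>\<gamma> > n\<close> they are
  weakened to the case \<open>\<gamma> = n\<close> without a logarithm, since smoothness beyond \<open>n\<close> does not improve the rate.
  The logarithm is evaluated at a fixed distance \<open>z\<close>, later the length of the interval at \<open>b\<close>. At
  distances \<open>w \<ge> z\<close> this is its largest size up to a constant. At distances \<open>w \<le> z\<close> the difference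
  \<open>ln (z / w)\<close> is at most \<open>(z / w) powr (\<alpha> / 2) / (\<alpha> / 2)\<close>, which accounts for the exponent \<open>\<alpha> / 2\<close>
  in the last bound.\<close>

lemma weighted_C_bounds:
  fixes b \<gamma> Z :: real and n :: nat
  assumes Z: "Z > 0" and \<gamma>: "\<gamma> > 0" and n: "n \<ge> 1"
    and f: "weighted_C (n + 1) \<gamma> (b - Z) b f"
  defines "\<alpha> \<equiv> min (real n) \<gamma>"
  obtains F D where "F 0 = f" "D \<ge> 0"
    "\<And>k \<rho>. k < n + 1 \<Longrightarrow> \<rho> \<in> {b - Z..<b} \<Longrightarrow>
        (F k has_real_derivative F (Suc k) \<rho>) (at \<rho> within {b - Z..<b})"
    "\<And>m \<rho> z. m \<in> {n, n + 1} \<Longrightarrow> \<rho> \<in> {b - Z..<b} \<Longrightarrow> 0 < z \<Longrightarrow> z \<le> b - \<rho> \<Longrightarrow>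
        \<bar>F m \<rho>\<bar> \<le> D * log_factor n \<gamma> z * (b - \<rho>) powr (\<alpha> - real m)"
    "\<And>\<rho> z. \<rho> \<in> {b - Z..<b} \<Longrightarrow> b - \<rho> \<le> z \<Longrightarrow>
        \<bar>F n \<rho>\<bar> \<le> D * log_factor n \<gamma> z * z powr (\<alpha> / 2) * (b - \<rho>) powr (\<alpha> / 2 - real n)"
proof -
  obtain F c where F: "F 0 = f"
    and deriv: "\<And>k \<rho>. k < n + 1 \<Longrightarrow> \<rho> \<in> {b - Z..<b} \<Longrightarrow>
        (F k has_real_derivative F (Suc k) \<rho>) (at \<rho> within {b - Z..<b})"
    and bd: "\<And>k \<rho>. k \<le> n + 1 \<Longrightarrow> \<rho> \<in> {b - Z..<b} \<Longrightarrow>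
           (real k < \<gamma> \<longrightarrow> \<bar>F k \<rho>\<bar> \<le> c k) \<and>
           (real k = \<gamma> \<longrightarrow> \<bar>F k \<rho>\<bar> \<le> c k * (1 + \<bar>ln (b - \<rho>)\<bar>)) \<and>
           (real k > \<gamma> \<longrightarrow> \<bar>F k \<rho>\<bar> \<le> c k * (b - \<rho>) powr (\<gamma> - real k))"
    using f unfolding weighted_C_def by blast
  have \<alpha>: "0 < \<alpha>" using \<gamma> n by (simp add: \<alpha>_def)
  define C where "C = \<bar>c n\<bar> + \<bar>c (n + 1)\<bar>"
  have cC: "c m \<le> C" if "m \<in> {n, n + 1}" for m using that by (auto simp: C_def)
  have C0: "0 \<le> C" by (simp add: C_def)
  define A1 where "A1 = (1 + \<bar>ln Z\<bar>) * (1 + 2 / \<alpha>)"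
  define A2 where "A2 = 1 + Z + Z\<^sup>2 + Z powr (\<gamma> - real n)"
  define D where "D = C * (A1 + A2)"
  have A1: "A1 \<ge> 1" "A1 \<ge> 1 + \<bar>ln Z\<bar>" "A1 \<ge> 1 + 2 / \<alpha>"
  proof -
    have p: "0 \<le> \<bar>ln Z\<bar>" "0 \<le> 2 / \<alpha>" "0 \<le> \<bar>ln Z\<bar> * (2 / \<alpha>)"
      using \<alpha> by (auto intro!: mult_nonneg_nonneg)
    have "A1 = 1 + \<bar>ln Z\<bar> + 2 / \<alpha> + \<bar>ln Z\<bar> * (2 / \<alpha>)"
      unfolding A1_def by (simp only: distrib_left distrib_right mult_1_left mult_1_right add.assoc)
    then show "A1 \<ge> 1 + \<bar>ln Z\<bar>" "A1 \<ge> 1 + 2 / \<alpha>"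
      using p by linarith+
    then show "A1 \<ge> 1" using p by linarith
  qed
  have A2: "A2 \<ge> 0" "A2 \<ge> Z" "A2 \<ge> 1 + Z + Z\<^sup>2" "A2 \<ge> Z powr (\<gamma> - real n)"
    using Z by (auto simp: A2_def)
  have D0: "0 \<le> D" using C0 A1 A2 by (simp add: D_def)
  have CD: "c m * t \<le> D" if "m \<in> {n, n + 1}" "0 \<le> t" "t \<le> A1 + A2" for m t
  proof -
    have "c m * t \<le> C * t" using cC[OF that(1)] that(2) by (rule mult_right_mono)
    also have "\<dots> \<le> C * (A1 + A2)" using that(3) C0 by (rule mult_left_mono)
    finally show ?thesis by (simp add: D_def)
  qed
  have lf: "log_factor n \<gamma> z \<ge> 1" for z by (simp add: log_factor_def)
  have pos_le: "0 \<le> u" if "0 \<le> u * v" "0 < v" for u v :: real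
    using that by (simp add: zero_le_mult_iff)
  \<comment> \<open>a logarithm in the derivative of order \<open>n + 1\<close> is dominated by the power \<open>-1\<close>\<close>
  have plain: "\<bar>F m \<rho>\<bar> \<le> D * (b - \<rho>) powr (\<alpha> - real m)"
    if m: "m \<in> {n, n + 1}" and \<rho>: "\<rho> \<in> {b - Z..<b}" and ne: "real m \<noteq> \<gamma> \<or> m = n + 1"
      and ne': "m = n \<Longrightarrow> real n \<noteq> \<gamma>" for m \<rho>
  proof -
    define w where "w = b - \<rho>"
    have w: "0 < w" "w \<le> Z" using \<rho> by (auto simp: w_def)
    have bd': "(real m < \<gamma> \<longrightarrow> \<bar>F m \<rho>\<bar> \<le> c m) \<and>
           (real m = \<gamma> \<longrightarrow> \<bar>F m \<rho>\<bar> \<le> c m * (1 + \<bar>ln w\<bar>)) \<and>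
           (real m > \<gamma> \<longrightarrow> \<bar>F m \<rho>\<bar> \<le> c m * w powr (\<gamma> - real m))"
      using bd[of m \<rho>] m \<rho> by (auto simp: w_def)
    have key: "\<bar>F m \<rho>\<bar> \<le> D * w powr (\<alpha> - real m)"
      if "\<bar>F m \<rho>\<bar> \<le> c m * (t * w powr (\<alpha> - real m))" "0 \<le> t" "t \<le> A1 + A2" for t
    proof -
      have "c m * t * w powr (\<alpha> - real m) \<le> D * w powr (\<alpha> - real m)"
        using CD[OF m that(2,3)] by (rule mult_right_mono) simp
      with that(1) show ?thesis by (simp add: mult.assoc)
    qed
    consider "\<gamma> < real m" "\<gamma> \<le> real n" | "m = n" "real n < \<gamma>"
      | "m = n + 1" "real n < \<gamma>" "real m < \<gamma>" | "m = n + 1" "real n < \<gamma>" "real m = \<gamma>"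
      | "m = n + 1" "real n < \<gamma>" "\<gamma> < real m"
      using m ne ne' by fastforce
    then have "\<bar>F m \<rho>\<bar> \<le> D * w powr (\<alpha> - real m)"
    proof cases
      case 1
      then have "\<alpha> = \<gamma>" by (simp add: \<alpha>_def)
      then show ?thesis using bd' 1 A1 A2 by (intro key[of 1]) auto
    next
      case 2
      then have "\<alpha> = real m" by (simp add: \<alpha>_def)
      then show ?thesis using bd' 2 A1 A2 w by (intro key[of 1]) auto
    next
      case 3
      then have e: "\<alpha> - real m = -1" by (simp add: \<alpha>_def)
      have cm: "0 \<le> c m" using bd' 3 by auto
      have "1 \<le> Z * w powr (-1)" using w by (simp add: powr_minus_divide)
      from mult_left_mono[OF this cm] have "c m \<le> c m * (Z * w powr (-1))" by simp
      then have "\<bar>F m \<rho>\<bar> \<le> c m * (Z * w powr (\<alpha> - real m))" using bd' 3 unfolding e by linarith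
      then show ?thesis by (rule key) (use A1 A2 Z in linarith)+
    next
      case 4
      then have e: "\<alpha> - real m = -1" by (simp add: \<alpha>_def)
      have l: "\<bar>F m \<rho>\<bar> \<le> c m * (1 + \<bar>ln w\<bar>)" using bd' 4 by simp
      have "0 \<le> c m * (1 + \<bar>ln w\<bar>)" using l by linarith
      moreover have "0 < 1 + \<bar>ln w\<bar>" by (rule add_pos_nonneg) auto
      ultimately have cm: "0 \<le> c m" by (rule pos_le)
      have "c m * (1 + \<bar>ln w\<bar>) \<le> c m * ((1 + Z + Z\<^sup>2) * w powr (-1))"
        using one_plus_abs_ln_le[OF w] cm by (rule mult_left_mono)
      then have "\<bar>F m \<rho>\<bar> \<le> c m * ((1 + Z + Z\<^sup>2) * w powr (\<alpha> - real m))" using l unfolding e by linarith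
      then show ?thesis by (rule key) (use A1 A2 Z in auto)
    next
      case 5
      then have e: "\<alpha> - real m = -1" by (simp add: \<alpha>_def)
      have l: "\<bar>F m \<rho>\<bar> \<le> c m * w powr (\<gamma> - real m)" using bd' 5 by simp
      have "0 \<le> c m * w powr (\<gamma> - real m)" using l by linarith
      then have cm: "0 \<le> c m" using w by (simp add: zero_le_mult_iff)
      have "\<gamma> - real m = (\<gamma> - real n) + (-1)" using 5 by simp
      then have "w powr (\<gamma> - real m) = w powr (\<gamma> - real n) * w powr (-1)"
        by (simp only: powr_add)
      also have "\<dots> \<le> Z powr (\<gamma> - real n) * w powr (-1)"
        using w 5 by (intro mult_right_mono powr_mono2) auto
      finally have "c m * w powr (\<gamma> - real m) \<le> c m * (Z powr (\<gamma> - real n) * w powr (-1))"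
        using cm by (rule mult_left_mono)
      then have "\<bar>F m \<rho>\<bar> \<le> c m * (Z powr (\<gamma> - real n) * w powr (\<alpha> - real m))" using l unfolding e by linarith
      then show ?thesis by (rule key) (use A1 A2 in auto)
    qed
    then show ?thesis by (simp add: w_def)
  qed
  have logc: "\<bar>F n \<rho>\<bar> \<le> c n * (1 + \<bar>ln (b - \<rho>)\<bar>) \<and> 0 \<le> c n"
    if "real n = \<gamma>" "\<rho> \<in> {b - Z..<b}" for \<rho>
  proof -
    have l: "\<bar>F n \<rho>\<bar> \<le> c n * (1 + \<bar>ln (b - \<rho>)\<bar>)" using bd[of n \<rho>] that by simp
    have "0 \<le> c n * (1 + \<bar>ln (b - \<rho>)\<bar>)" using l by linarith
    moreover have "0 < 1 + \<bar>ln (b - \<rho>)\<bar>" by (rule add_pos_nonneg) auto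
    ultimately have "0 \<le> c n" by (rule pos_le)
    then show ?thesis using l by simp
  qed
  show thesis
  proof (rule that[OF F D0 deriv])
    fix m \<rho> z assume m: "m \<in> {n, n + 1}" and \<rho>: "\<rho> \<in> {b - Z..<b}" and z: "0 < z" "z \<le> b - \<rho>"
    define w where "w = b - \<rho>"
    have w: "0 < w" "w \<le> Z" "z \<le> w" using \<rho> z by (auto simp: w_def)
    show "\<bar>F m \<rho>\<bar> \<le> D * log_factor n \<gamma> z * (b - \<rho>) powr (\<alpha> - real m)"
    proof (cases "m = n \<and> real n = \<gamma>")
      case True
      then have a: "\<alpha> - real m = 0" by (simp add: \<alpha>_def)
      have "\<bar>ln w\<bar> \<le> \<bar>ln z\<bar> + \<bar>ln Z\<bar>"
      proof -
        have "ln z \<le> ln w" "ln w \<le> ln Z" using z w by simp_all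
        then show ?thesis by linarith
      qed
      moreover have "0 \<le> \<bar>ln z\<bar> * \<bar>ln Z\<bar>" by simp
      ultimately have "1 + \<bar>ln w\<bar> \<le> (1 + \<bar>ln Z\<bar>) * (1 + \<bar>ln z\<bar>)"
        unfolding distrib_left distrib_right by (simp only: mult_1_left mult_1_right mult.commute)
      then have "c n * (1 + \<bar>ln w\<bar>) \<le> c n * ((1 + \<bar>ln Z\<bar>) * (1 + \<bar>ln z\<bar>))"
        using logc True \<rho> by (intro mult_left_mono) auto
      also have "\<dots> \<le> D * (1 + \<bar>ln z\<bar>)"
        unfolding mult.assoc[symmetric] using A1 A2 by (intro mult_right_mono CD) auto
      finally show ?thesis using logc[of \<rho>] True \<rho> w a by (simp add: w_def log_factor_def)
    next
      case False
      have "\<bar>F m \<rho>\<bar> \<le> D * 1 * (b - \<rho>) powr (\<alpha> - real m)"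
        using plain[OF m \<rho>] False m by auto
      also have "\<dots> \<le> D * log_factor n \<gamma> z * (b - \<rho>) powr (\<alpha> - real m)"
        using D0 lf by (intro mult_right_mono mult_left_mono) auto
      finally show ?thesis .
    qed
  next
    fix \<rho> z assume \<rho>: "\<rho> \<in> {b - Z..<b}" and z: "b - \<rho> \<le> z"
    define w where "w = b - \<rho>"
    have w: "0 < w" "w \<le> Z" "w \<le> z" using \<rho> z by (auto simp: w_def)
    show "\<bar>F n \<rho>\<bar> \<le> D * log_factor n \<gamma> z * z powr (\<alpha> / 2) * (b - \<rho>) powr (\<alpha> / 2 - real n)"
    proof (cases "real n = \<gamma>")
      case True
      then have a: "\<alpha> = real n" by (simp add: \<alpha>_def)
      define Q where "Q = (z / w) powr (\<alpha> / 2)"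
      have Q1: "1 \<le> Q" using w \<alpha> by (auto simp: Q_def intro!: ge_one_powr_ge_zero)
      have "ln (z / w) \<le> Q / (\<alpha> / 2)"
        unfolding Q_def using w \<alpha> by (intro ln_powr_bound) auto
      moreover have "ln w = ln z - ln (z / w)" using w by (simp add: ln_div)
      moreover have "0 \<le> ln (z / w)" using w by simp
      moreover have "Q / (\<alpha> / 2) = 2 / \<alpha> * Q" by simp
      ultimately have "1 + \<bar>ln w\<bar> \<le> 1 + \<bar>ln z\<bar> + 2 / \<alpha> * Q" by linarith
      also have "\<dots> \<le> (1 + \<bar>ln z\<bar>) * Q + (1 + \<bar>ln z\<bar>) * (2 / \<alpha> * Q)"
      proof (rule add_mono)
        show "1 + \<bar>ln z\<bar> \<le> (1 + \<bar>ln z\<bar>) * Q"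
          using mult_left_mono[OF Q1, of "1 + \<bar>ln z\<bar>"] by simp
        show "2 / \<alpha> * Q \<le> (1 + \<bar>ln z\<bar>) * (2 / \<alpha> * Q)"
          using mult_right_mono[of 1 "1 + \<bar>ln z\<bar>" "2 / \<alpha> * Q"] Q1 \<alpha> by simp
      qed
      also have "\<dots> = (1 + 2 / \<alpha>) * ((1 + \<bar>ln z\<bar>) * Q)"
      proof -
        have "u * Q + u * (v * Q) = (1 + v) * (u * Q)" for u v :: real
          by (simp add: algebra_simps)
        then show ?thesis .
      qed
      finally have "c n * (1 + \<bar>ln w\<bar>) \<le> c n * ((1 + 2 / \<alpha>) * ((1 + \<bar>ln z\<bar>) * Q))"
        using logc True \<rho> by (intro mult_left_mono) auto
      also have "\<dots> \<le> D * ((1 + \<bar>ln z\<bar>) * Q)"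
        unfolding mult.assoc[symmetric, of "c n"] using A1 A2 Q1 \<alpha>
        by (intro mult_right_mono CD) auto
      also have "Q = z powr (\<alpha> / 2) * w powr (\<alpha> / 2 - real n)"
      proof -
        have "\<alpha> / 2 - real n = - (\<alpha> / 2)" using a by simp
        then show ?thesis
          unfolding Q_def by (subst powr_divide) (use w in \<open>simp_all only: powr_minus divide_inverse\<close>)
      qed
      finally show ?thesis using logc[of \<rho>] True \<rho> by (simp add: w_def log_factor_def)
    next
      case False
      have "\<bar>F n \<rho>\<bar> \<le> D * w powr (\<alpha> - real n)"
        using plain[of n \<rho>] False \<rho> by (simp add: w_def)
      also have "w powr (\<alpha> - real n) = w powr (\<alpha> / 2) * w powr (\<alpha> / 2 - real n)"
        by (simp add: powr_add[symmetric])
      also have "D * (w powr (\<alpha> / 2) * w powr (\<alpha> / 2 - real n))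
          \<le> D * (z powr (\<alpha> / 2) * w powr (\<alpha> / 2 - real n))"
        using D0 w \<alpha> by (intro mult_left_mono mult_right_mono powr_mono2) auto
      finally show ?thesis using False by (simp add: log_factor_def w_def mult.assoc)
    qed
  qed
qed

lemma ln_ge_1: "M \<ge> 3 \<Longrightarrow> 1 \<le> ln (real M)"
proof -
  assume M: "M \<ge> 3"
  have "exp 1 \<le> real M" using exp_le M by linarith
  then show ?thesis using M by (subst ln_ge_iff) auto
qed

text \<open>Comparison with the integral of the power: the sum is bounded, of the order of a logarithm, or
  dominated by its largest terms. These cases give the three cases of \<open>varpi\<close>.\<close>

lemma sum_powr_bound:
  fixes p :: real
  obtains C where "C \<ge> 0" "\<And>M. M \<ge> 3 \<Longrightarrow>
     (\<Sum>i=1..M. real i powr (p - 1)) \<le> C * (if p = 0 then ln (real M) else real M powr (max 0 p))"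
proof -
  consider "p < 0" | "p = 0" | "0 < p" by linarith
  then show thesis
  proof cases
    case 1
    then have s: "summable (\<lambda>i. real i powr (p - 1))"
      by (subst summable_real_powr_iff) simp
    have "(\<Sum>i=1..M. real i powr (p - 1)) \<le> (\<Sum>i. real i powr (p - 1))" for M
      by (rule sum_le_suminf[OF s]) auto
    moreover have "(\<Sum>i. real i powr (p - 1)) \<ge> 0" by (intro suminf_nonneg s) simp
    ultimately show thesis using 1 by (intro that[of "\<Sum>i. real i powr (p - 1)"]) auto
  next
    case 2
    have "(\<Sum>i=1..M. real i powr (p - 1)) \<le> 2 * ln (real M)" if M: "M \<ge> 3" for M
    proof -
      have "1 \<le> ln (real M)" using M by (rule ln_ge_1)
      moreover have "(\<Sum>i=1..M. real i powr (p - 1)) = harm M"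
        unfolding harm_def 2 by (intro sum.cong) (auto simp: powr_minus)
      moreover have "harm M \<le> ln (real M) + (1 :: real)" using decseqD[OF decseq_harm_diff_ln, of 0 "M - 1"] M by (simp add: harm_expand)
      ultimately show ?thesis by linarith
    qed
    then show thesis using 2 by (intro that[of 2]) auto
  next
    case 3
    have step: "real (Suc M) powr (p - 1) \<le> max 1 (1 / p) * (real (Suc M) powr p - real M powr p)"
      if p1: "p \<le> 1" for M
    proof (cases "M = 0")
      case False
      have "\<exists>z>real M. z < real (Suc M) \<and> real (Suc M) powr p - real M powr p
          = (real (Suc M) - real M) * (p * z powr (p - 1))"
        using False by (intro MVT2) (auto intro!: derivative_eq_intros)
      then obtain z where z: "real M < z" "z < real (Suc M)"
          "real (Suc M) powr p - real M powr p = p * z powr (p - 1)" by auto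
      have "real (Suc M) powr (p - 1) \<le> z powr (p - 1)"
        using z p1 False by (intro powr_mono2') auto
      also have "\<dots> = (1 / p) * (real (Suc M) powr p - real M powr p)"
        using 3 z by simp
      also have "\<dots> \<le> max 1 (1 / p) * (real (Suc M) powr p - real M powr p)"
        using 3 by (intro mult_right_mono) (auto intro!: powr_mono2)
      finally show ?thesis .
    qed simp
    have "(\<Sum>i=1..M. real i powr (p - 1)) \<le> max 1 (1 / p) * real M powr p" for M
    proof (cases "p \<le> 1")
      case True
      show ?thesis
      proof (induction M)
        case (Suc M)
        have "(\<Sum>i=1..Suc M. real i powr (p - 1))
            = (\<Sum>i=1..M. real i powr (p - 1)) + real (Suc M) powr (p - 1)" by simp
        also have "\<dots> \<le> max 1 (1 / p) * real M powr p
            + max 1 (1 / p) * (real (Suc M) powr p - real M powr p)"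
          by (rule add_mono[OF Suc.IH step[OF True]])
        also have "\<dots> = max 1 (1 / p) * real (Suc M) powr p" by (simp add: right_diff_distrib)
        finally show ?case .
      qed simp
    next
      case False
      have "(\<Sum>i=1..M. real i powr (p - 1)) \<le> (\<Sum>i=1..M. real M powr (p - 1))"
        using False by (intro sum_mono powr_mono2) auto
      also have "\<dots> = real M powr p"
        by (cases "M = 0") (auto simp: powr_diff)
      also have "\<dots> \<le> max 1 (1 / p) * real M powr p"
        by (simp add: mult_le_cancel_right1)
      finally show ?thesis .
    qed
    then show thesis using 3 by (intro that[of "max 1 (1 / p)"]) (auto simp: max_def)
  qed
qed

lemma graded_sum_bound:
  fixes r s :: real
  obtains C where "C \<ge> 0" "\<And>M. M \<ge> 3 \<Longrightarrow>
     (\<Sum>i=1..M. (real i / real M) powr r * real i powr (- s - 1)) \<le> C * varpi r s M"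
proof -
  obtain C where C: "C \<ge> 0" "\<And>M. M \<ge> 3 \<Longrightarrow>
     (\<Sum>i=1..M. real i powr (r - s - 1)) \<le> C * (if r - s = 0 then ln (real M) else real M powr (max 0 (r - s)))"
    using sum_powr_bound[of "r - s"] by metis
  have "(\<Sum>i=1..M. (real i / real M) powr r * real i powr (- s - 1)) \<le> C * varpi r s M" if M: "M \<ge> 3" for M
  proof -
    have "(\<Sum>i=1..M. (real i / real M) powr r * real i powr (- s - 1))
        = (\<Sum>i=1..M. real M powr (- r) * real i powr (r - s - 1))"
      using M by (intro sum.cong)
        (auto simp: powr_divide powr_minus_divide powr_add[symmetric] algebra_simps)
    also have "\<dots> = real M powr (- r) * (\<Sum>i=1..M. real i powr (r - s - 1))"
      by (simp add: sum_distrib_left)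
    also have "\<dots> \<le> real M powr (- r) * (C * (if r - s = 0 then ln (real M) else real M powr (max 0 (r - s))))"
      using C(2)[OF M] by (rule mult_left_mono) simp
    also have "\<dots> = C * varpi r s M"
      by (auto simp: varpi_def min_def max_def powr_add[symmetric])
    finally show ?thesis .
  qed
  then show thesis using C(1) that by blast
qed

lemma graded_term_bound:
  fixes r s :: real
  assumes M: "M \<ge> 3" and i: "1 \<le> i" "i \<le> M"
  shows "(real i / real M) powr r * real i powr (- s) \<le> varpi r s M"
proof -
  have "(real i / real M) powr r * real i powr (- s) = real M powr (- r) * real i powr (r - s)"
    using M i by (auto simp: powr_divide powr_minus_divide powr_diff)
  also have "\<dots> \<le> real M powr (- r) * real M powr (max 0 (r - s))"
  proof (rule mult_left_mono)
    have "real i powr (r - s) \<le> real i powr (max 0 (r - s))" using i by (intro powr_mono) auto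
    also have "\<dots> \<le> real M powr (max 0 (r - s))" using i by (intro powr_mono2) auto
    finally show "real i powr (r - s) \<le> real M powr (max 0 (r - s))" .
  qed simp
  also have "\<dots> = real M powr (- min r s)"
    by (auto simp: min_def max_def powr_add[symmetric])
  also have "\<dots> \<le> varpi r s M"
    using ln_ge_1[OF M] by (auto simp: varpi_def mult_le_cancel_left1)
  finally show ?thesis .
qed

lemma varpi_lower_order:
  fixes r s :: real
  assumes M: "M \<ge> 3"
  shows "varpi r (s + 1) M \<le> varpi r s M"
proof -
  have l: "1 \<le> ln (real M)" by (rule ln_ge_1[OF M])
  show ?thesis
  proof (cases "r = s + 1")
    case True
    have "ln (real M) \<le> real M" using ln_le_minus_one[of "real M"] M by simp
    then have "real M powr (- (s + 1)) * ln (real M) \<le> real M powr (- (s + 1)) * real M powr 1"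
      using M by (intro mult_left_mono) auto
    also have "\<dots> = real M powr (- s)" unfolding powr_add[symmetric] by simp
    finally show ?thesis using True by (simp add: varpi_def min_def)
  next
    case False
    have "real M powr (- min r (s + 1)) \<le> real M powr (- min r s)"
      using M by (intro powr_mono) auto
    also have "\<dots> \<le> varpi r s M"
      using l by (auto simp: varpi_def mult_le_cancel_left1)
    finally show ?thesis using False by (simp add: varpi_def)
  qed
qed

section \<open>Stability and solvability of the collocation equations\<close>

context graded_mesh
begin

lemma mesh_cover:
  assumes s: "s \<in> {0..b}"
  obtains j where "j \<in> {1..M}" "s \<in> {x (j - 1)..x j}" "s \<noteq> 0 \<Longrightarrow> s \<in> {x (j - 1)<..x j}"
proof -
  define j where "j = (LEAST j. 1 \<le> j \<and> s \<le> x j)"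
  have ex: "1 \<le> M \<and> s \<le> x M" using M s mesh_M by auto
  have j: "1 \<le> j \<and> s \<le> x j" unfolding j_def by (rule LeastI[where P = "\<lambda>j. 1 \<le> j \<and> s \<le> x j", OF ex])
  have jM: "j \<le> M" unfolding j_def using ex by (rule Least_le)
  have low: "x (j - 1) < s \<or> (j = 1 \<and> s = 0)"
  proof (cases "j = 1")
    case True
    then show ?thesis using s mesh_0 by auto
  next
    case False
    have "j \<le> j - 1" if "1 \<le> j - 1 \<and> s \<le> x (j - 1)"
      using Least_le[of "\<lambda>j. 1 \<le> j \<and> s \<le> x j", OF that] unfolding j_def[symmetric] .
    then show ?thesis using False j by force
  qed
  show thesis
    by (rule that[of j]) (use j jM low mesh_0 in auto)
qed

lemma Least_cell:
  assumes j: "j \<in> {1..M}" and s: "s \<in> {x (j - 1)<..x j}"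
  shows "(LEAST j. 1 \<le> j \<and> s \<le> x j) = j"
proof (rule Least_equality)
  show "1 \<le> j \<and> s \<le> x j" using j s by auto
  fix i assume i: "1 \<le> i \<and> s \<le> x i"
  show "j \<le> i"
  proof (rule ccontr)
    assume "\<not> j \<le> i"
    then have "x i \<le> x (j - 1)" using j by (intro mesh_mono) auto
    then show False using i s by auto
  qed
qed

lemma continuous_on_mesh:
  fixes f :: "real \<Rightarrow> real"
  assumes "\<And>j. j \<in> {1..M} \<Longrightarrow> continuous_on {x (j - 1)..x j} f"
  shows "continuous_on {0..b} f"
proof -
  have "continuous_on {x 0..x k} f" if "k \<le> M" for k
    using that
  proof (induction k)
    case (Suc k)
    have "continuous_on ({x 0..x k} \<union> {x k..x (Suc k)}) f"
      using Suc assms[of "Suc k"] by (intro continuous_on_closed_Un) auto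
    moreover have "{x 0..x k} \<union> {x k..x (Suc k)} = {x 0..x (Suc k)}"
      using Suc.prems mesh_mono[of 0 k] mesh_mono[of k "Suc k"] by auto
    ultimately show ?case by simp
  qed simp
  from this[of M] show ?thesis by (simp add: mesh_0 mesh_M)
qed

lemma continuous_on_cell_primitive:
  assumes j: "j \<in> {1..M}"
    and f: "\<And>s. s \<in> {x (j - 1)..x j} \<Longrightarrow> f s = f (x j) - integral {s..x j} (psi_piece b \<mu> q \<xi> n M Y j)"
  shows "continuous_on {x (j - 1)..x j} f"
proof -
  have "psi_piece b \<mu> q \<xi> n M Y j integrable_on {x (j - 1)..x j}"
    using mesh_range(2)[of j] j by (intro integrable_continuous_real continuous_on_psi_piece) auto
  then have "continuous_on {x (j - 1)..x j} (\<lambda>s. f (x j) - integral {s..x j} (psi_piece b \<mu> q \<xi> n M Y j))"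
    by (intro continuous_intros indefinite_integral_continuous_1')
  then show ?thesis by (rule continuous_on_eq) (rule f[symmetric])
qed

lemma has_integral_cell:
  assumes j: "j \<in> {1..M}" and s: "s \<in> {x (j - 1)..x j}"
    and eq: "\<And>t. t \<in> {x (j - 1)<..x j} \<Longrightarrow> f t = psi_piece b \<mu> q \<xi> n M Y j t"
  shows "(f has_integral integral {s..x j} (psi_piece b \<mu> q \<xi> n M Y j)) {s..x j}"
proof (rule has_integral_spike_finite[of "{x (j - 1)}"])
  show "(psi_piece b \<mu> q \<xi> n M Y j has_integral integral {s..x j} (psi_piece b \<mu> q \<xi> n M Y j)) {s..x j}"
    using mesh_range(2)[of j] j
    by (intro integrable_integral integrable_continuous_real continuous_on_psi_piece) auto
  show "f t = psi_piece b \<mu> q \<xi> n M Y j t" if "t \<in> {s..x j} - {x (j - 1)}" for t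
    using that s by (intro eq) auto
qed simp

lemma psi_piece_diff:
  "psi_piece b \<mu> q \<xi> n M Y j s - psi_piece b \<mu> q \<xi> n M Y' j s
     = psi_piece b \<mu> q \<xi> n M (\<lambda>j k. Y j k - Y' j k) j s"
  by (simp add: psi_piece_def left_diff_distrib sum_subtractf)

lemma integral_psi_piece_diff:
  assumes j: "j \<in> {1..M}"
  shows "integral {s..x j} (psi_piece b \<mu> q \<xi> n M (\<lambda>j k. Y j k - Y' j k) j)
     = integral {s..x j} (psi_piece b \<mu> q \<xi> n M Y j) - integral {s..x j} (psi_piece b \<mu> q \<xi> n M Y' j)"
proof -
  have "psi_piece b \<mu> q \<xi> n M Y j integrable_on {s..x j}" for Y
    using mesh_range(2)[of j] j by (intro integrable_continuous_real continuous_on_psi_piece) auto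
  then have "integral {s..x j} (\<lambda>t. psi_piece b \<mu> q \<xi> n M Y j t - psi_piece b \<mu> q \<xi> n M Y' j t)
     = integral {s..x j} (psi_piece b \<mu> q \<xi> n M Y j) - integral {s..x j} (psi_piece b \<mu> q \<xi> n M Y' j)"
    by (intro integral_diff)
  then show ?thesis by (simp add: psi_piece_diff)
qed

end

text \<open>The last assumption says that the mesh is fine enough for one step of the discrete problem to be
  a contraction.\<close>

locale volterra_collocation = graded_mesh b \<mu> q n \<xi> M
  for b \<mu> q :: real and n :: nat and \<xi> :: "nat \<Rightarrow> real" and M :: nat +
  fixes \<nu> :: real and a :: "real \<Rightarrow> real" and K :: "real \<Rightarrow> real \<Rightarrow> real" and aB KB \<Lambda> :: real
  assumes nu: "0 < \<nu>"
    and K_cont: "\<And>y. 0 \<le> y \<Longrightarrow> continuous_on {y..b} (K y)"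
    and K_bound: "\<And>y s. 0 \<le> y \<Longrightarrow> y \<le> s \<Longrightarrow> s \<le> b \<Longrightarrow> \<bar>K y s\<bar> \<le> KB"
    and a_bound: "\<And>y. y \<in> {0..b} \<Longrightarrow> \<bar>a y\<bar> \<le> aB"
    and lag_bound: "\<And>k t. k \<in> {1..n} \<Longrightarrow> t \<in> {0..1} \<Longrightarrow> \<bar>lagrange_basis \<xi> n k t\<bar> \<le> \<Lambda>"
    and fine: "b * q / real M * (real n * \<Lambda> * (aB + KB * (b powr \<nu> / \<nu>))) \<le> 1 / 2"
begin

abbreviation "op_const \<equiv> aB + KB * (b powr \<nu> / \<nu>)"
abbreviation "gain \<equiv> real n * \<Lambda> * op_const"
abbreviation "hom_rhs \<equiv> adjoint_rhs b \<nu> a (\<lambda>_. 0) K"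

lemma consts_nonneg: "0 \<le> \<Lambda>" "0 \<le> op_const"
proof -
  show "0 \<le> \<Lambda>" using lag_bound[of 1 0] n by auto
  have "0 \<le> aB" "0 \<le> KB" using a_bound[of 0] K_bound[of 0 0] b by auto
  then show "0 \<le> op_const" using nu by simp
qed

lemma hom_rhs_bound:
  assumes e: "continuous_on {0..b} e" and j: "j \<in> {1..M}" and k: "k \<in> {1..n}"
    and S: "\<And>t. t \<in> {x (j - 1)..b} \<Longrightarrow> \<bar>e t\<bar> \<le> S"
  shows "\<bar>hom_rhs e (cp j k)\<bar> \<le> op_const * S"
proof -
  have c: "0 \<le> cp j k" "cp j k \<le> b" using colloc_range'[OF j k] by auto
  have ce: "continuous_on {cp j k..b} e" using c by (intro continuous_on_subset[OF e]) auto
  have S': "\<bar>e s\<bar> \<le> S" if "s \<in> {cp j k..b}" for s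
    using that colloc_range[OF j k] by (intro S) auto
  have KB: "\<bar>K (cp j k) s\<bar> \<le> KB" if "s \<in> {cp j k..b}" for s
    using that c by (intro K_bound) auto
  have aB: "\<bar>a (cp j k)\<bar> \<le> aB" using c by (intro a_bound) auto
  show ?thesis
    by (rule adjoint_rhs_bound[where x = "cp j k" and K = K and a = a and u = e, OF nu c K_cont[OF c(1)] KB aB ce S'])
qed

lemma piece_integral_bound:
  assumes j: "j \<in> {1..M}" and Z: "\<And>k. k \<in> {1..n} \<Longrightarrow> \<bar>Z j k\<bar> \<le> B" and s: "s \<in> {x (j - 1)..x j}"
  shows "\<bar>integral {s..x j} (psi_piece b \<mu> q \<xi> n M Z j)\<bar> \<le> b * q / real M * (real n * \<Lambda> * B)"
proof -
  have B: "0 \<le> B" using Z[of 1] n by auto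
  have "norm (integral {s..x j} (psi_piece b \<mu> q \<xi> n M Z j)) \<le> (real n * \<Lambda> * B) * (x j - s)"
  proof (rule integral_bound)
    show "continuous_on {s..x j} (psi_piece b \<mu> q \<xi> n M Z j)"
      using mesh_range(2)[of j] j by (intro continuous_on_psi_piece) auto
    fix t assume t: "t \<in> {s..x j}"
    then have zt: "zeta j t \<in> {0..1}" using s by (intro zeta_range j) auto
    have "norm (psi_piece b \<mu> q \<xi> n M Z j t) \<le> (\<Sum>k=1..n. \<bar>Z j k\<bar> * \<bar>lagrange_basis \<xi> n k (zeta j t)\<bar>)"
      unfolding psi_piece_eq[OF j] real_norm_def abs_mult[symmetric] by (rule sum_abs)
    also have "\<dots> \<le> (\<Sum>k=1..n. B * \<Lambda>)"
      using zt B by (intro sum_mono mult_mono Z lag_bound) auto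
    finally show "norm (psi_piece b \<mu> q \<xi> n M Z j t) \<le> real n * \<Lambda> * B" by (simp add: mult_ac)
  qed (use s in auto)
  also have "\<dots> \<le> (real n * \<Lambda> * B) * (b * q / real M)"
    using mesh_width(2)[OF j] s B consts_nonneg(1) by (intro mult_left_mono) auto
  finally show ?thesis by (simp only: real_norm_def mult.commute)
qed

text \<open>The discrete problem is stable: a defect in the integrated equation enters the solution with
  its values at the mesh points summed up, and with its values in between only once.\<close>

lemma stability:
  assumes e: "continuous_on {0..b} e" "e b = 0" and R: "R \<ge> 0"
    and Z: "\<And>j k. j \<in> {1..M} \<Longrightarrow> k \<in> {1..n} \<Longrightarrow> Z j k = hom_rhs e (cp j k)"
    and step: "\<And>j s. j \<in> {1..M} \<Longrightarrow> s \<in> {x (j - 1)..x j} \<Longrightarrow>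
        \<bar>e s - e (x j) + integral {s..x j} (psi_piece b \<mu> q \<xi> n M Z j)\<bar> \<le> R"
    and step_node: "\<And>j. j \<in> {1..M} \<Longrightarrow>
        \<bar>e (x (j - 1)) - e (x j) + integral {x (j - 1)..x j} (psi_piece b \<mu> q \<xi> n M Z j)\<bar> \<le> d j"
    and t: "t \<in> {0..b}"
  shows "\<bar>e t\<bar> \<le> exp (2 * (b * q * gain)) * (R + (\<Sum>j=1..M. d j))"
proof -
  define h where "h = b * q / real M * gain"
  have h: "h \<ge> 0" "h \<le> 1 / 2"
    using fine consts_nonneg b q by (auto simp: h_def intro!: mult_nonneg_nonneg)
  have int: "\<bar>integral {s..x j} (psi_piece b \<mu> q \<xi> n M Z j)\<bar> \<le> h * S"
    if j: "j \<in> {1..M}" and S: "\<And>t. t \<in> {x (j - 1)..x M} \<Longrightarrow> \<bar>e t\<bar> \<le> S"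
      and s: "s \<in> {x (j - 1)..x j}" for j S s
  proof -
    have "\<bar>integral {s..x j} (psi_piece b \<mu> q \<xi> n M Z j)\<bar> \<le> b * q / real M * (real n * \<Lambda> * (op_const * S))"
    proof (rule piece_integral_bound[OF j _ s])
      fix k assume k: "k \<in> {1..n}"
      show "\<bar>Z j k\<bar> \<le> op_const * S"
        unfolding Z[OF j k] by (rule hom_rhs_bound[OF e(1) j k]) (use S mesh_M in auto)
    qed
    then show ?thesis by (simp add: h_def mult.assoc)
  qed
  have "\<bar>e t\<bar> \<le> exp (2 * h * real M) * (R + (\<Sum>j=1..M. d j))"
  proof (rule backward_gronwall[where x = x and e = e and t = t and d = d and h = h and R = R and M = M])
    show "continuous_on {x 0..x M} e" "e (x M) = 0" "t \<in> {x 0..x M}"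
      using e t by (simp_all add: mesh_0 mesh_M)
    show "x (j - 1) \<le> x j" if "j \<in> {1..M}" for j using mesh_strict[OF that] by simp
    show "0 \<le> d j" if "j \<in> {1..M}" for j
      using step_node[OF that] by (rule order_trans[OF abs_ge_zero])
    show "\<bar>e s - e (x j)\<bar> \<le> h * S + R"
      if "j \<in> {1..M}" "\<And>t. t \<in> {x (j - 1)..x M} \<Longrightarrow> \<bar>e t\<bar> \<le> S" "s \<in> {x (j - 1)..x j}" for j S s
      using step[OF that(1,3)] int[OF that] by linarith
    show "\<bar>e (x (j - 1)) - e (x j)\<bar> \<le> h * S + d j"
      if "j \<in> {1..M}" "\<And>t. t \<in> {x (j - 1)..x M} \<Longrightarrow> \<bar>e t\<bar> \<le> S" for j S
    proof -
      have "x (j - 1) \<in> {x (j - 1)..x j}" using mesh_strict[OF that(1)] by simp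
      from int[OF that this] step_node[OF that(1)] show ?thesis by linarith
    qed
  qed (use h R in auto)
  moreover have "2 * h * real M = 2 * (b * q * gain)" using M by (simp add: h_def)
  ultimately show ?thesis by simp
qed

lemma colloc_approx_cell:
  assumes c: "colloc_approx b \<mu> \<nu> q \<xi> n a g K \<phi>b M Y \<psi>h \<phi>h"
    and j: "j \<in> {1..M}" and s: "s \<in> {x (j - 1)..x j}"
  shows "\<phi>h s = \<phi>h (x j) - integral {s..x j} (psi_piece b \<mu> q \<xi> n M Y j)"
proof -
  have "\<phi>h s = \<phi>h (x j) - integral {s..x j} \<psi>h"
    using c j s unfolding colloc_approx_def by blast
  moreover have "integral {s..x j} \<psi>h = integral {s..x j} (psi_piece b \<mu> q \<xi> n M Y j)"
    by (rule integral_unique, rule has_integral_cell[OF j s])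
       (use c j in \<open>unfold colloc_approx_def, blast\<close>)
  ultimately show ?thesis by simp
qed

lemma colloc_approx_continuous:
  assumes c: "colloc_approx b \<mu> \<nu> q \<xi> n a g K \<phi>b M Y \<psi>h \<phi>h"
  shows "continuous_on {0..b} \<phi>h"
  by (intro continuous_on_mesh continuous_on_cell_primitive[where Y = Y] colloc_approx_cell[OF c])

lemma hom_rhs_diff:
  assumes "continuous_on {0..b} u" "continuous_on {0..b} v" "j \<in> {1..M}" "k \<in> {1..n}"
  shows "adjoint_rhs b \<nu> a g K u (cp j k) - adjoint_rhs b \<nu> a g K v (cp j k)
       = hom_rhs (\<lambda>s. u s - v s) (cp j k)"
  using colloc_range'[OF assms(3,4)] assms(1,2) nu K_cont
  by (intro adjoint_rhs_diff) (auto intro: continuous_on_subset)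

text \<open>Stability without any defect. Applied to the difference of two approximations it gives uniqueness,
  and applied to a solution of the homogeneous linear system it gives existence.\<close>

lemma homogeneous_unique:
  assumes e: "continuous_on {0..b} e" "e b = 0"
    and Z: "\<And>j k. j \<in> {1..M} \<Longrightarrow> k \<in> {1..n} \<Longrightarrow> Z j k = hom_rhs e (cp j k)"
    and step: "\<And>j s. j \<in> {1..M} \<Longrightarrow> s \<in> {x (j - 1)..x j} \<Longrightarrow>
        e s = e (x j) - integral {s..x j} (psi_piece b \<mu> q \<xi> n M Z j)"
  shows "t \<in> {0..b} \<Longrightarrow> e t = 0" "j \<in> {1..M} \<Longrightarrow> k \<in> {1..n} \<Longrightarrow> Z j k = 0"
proof -
  have e0: "e t = 0" if "t \<in> {0..b}" for t
  proof -
    have "\<bar>e t\<bar> \<le> exp (2 * (b * q * gain)) * (0 + (\<Sum>j=1..M. 0))"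
    proof (rule stability[where Z = Z and R = 0 and d = "\<lambda>_. 0", OF e _ Z _ _ that])
      fix j s assume j: "j \<in> {1..M}"
      show "\<bar>e s - e (x j) + integral {s..x j} (psi_piece b \<mu> q \<xi> n M Z j)\<bar> \<le> 0"
        if "s \<in> {x (j - 1)..x j}" using step[OF j that] by linarith
      have "x (j - 1) \<in> {x (j - 1)..x j}" using mesh_strict[OF j] by simp
      then show "\<bar>e (x (j - 1)) - e (x j) + integral {x (j - 1)..x j} (psi_piece b \<mu> q \<xi> n M Z j)\<bar> \<le> 0"
        using step[OF j, of "x (j - 1)"] by linarith
    qed auto
    then show ?thesis by simp
  qed
  then show "t \<in> {0..b} \<Longrightarrow> e t = 0" .
  show "Z j k = 0" if j: "j \<in> {1..M}" and k: "k \<in> {1..n}"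
  proof -
    have "0 \<le> x (j - 1)" using mesh_range(1)[of "j - 1"] j by auto
    then have "\<bar>hom_rhs e (cp j k)\<bar> \<le> op_const * 0"
      by (intro hom_rhs_bound[OF e(1) j k]) (use e0 in auto)
    then show ?thesis using Z[OF j k] by simp
  qed
qed

lemma colloc_approx_unique:
  assumes c: "colloc_approx b \<mu> \<nu> q \<xi> n a g K \<phi>b M Y \<psi>h \<phi>h"
    and c': "colloc_approx b \<mu> \<nu> q \<xi> n a g K \<phi>b M Y' \<psi>h' \<phi>h'"
  shows "\<forall>j\<in>{1..M}. \<forall>l\<in>{1..n}. Y' j l = Y j l" "\<forall>s\<in>{0..b}. \<psi>h' s = \<psi>h s \<and> \<phi>h' s = \<phi>h s"
proof -
  define e where "e s = \<phi>h' s - \<phi>h s" for s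
  have cont: "continuous_on {0..b} \<phi>h" "continuous_on {0..b} \<phi>h'"
    using colloc_approx_continuous c c' by blast+
  have ce: "continuous_on {0..b} e" unfolding e_def by (intro continuous_intros cont)
  have eb: "e b = 0" using c c' by (simp add: e_def colloc_approx_def)
  have Z: "Y' j k - Y j k = hom_rhs e (cp j k)" if "j \<in> {1..M}" "k \<in> {1..n}" for j k
  proof -
    have "Y' j k - Y j k = adjoint_rhs b \<nu> a g K \<phi>h' (cp j k) - adjoint_rhs b \<nu> a g K \<phi>h (cp j k)"
      using c c' that by (simp add: colloc_approx_def)
    then show ?thesis unfolding e_def[abs_def] using hom_rhs_diff[OF cont(2,1) that] by simp
  qed
  have step: "e s = e (x j) - integral {s..x j} (psi_piece b \<mu> q \<xi> n M (\<lambda>j k. Y' j k - Y j k) j)"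
    if j: "j \<in> {1..M}" and s: "s \<in> {x (j - 1)..x j}" for j s
    using colloc_approx_cell[OF c j s] colloc_approx_cell[OF c' j s]
    by (simp add: e_def integral_psi_piece_diff[OF j])
  have e0: "e t = 0" if "t \<in> {0..b}" for t
    using homogeneous_unique(1)[OF ce eb Z step that] .
  have YY: "Y' j k = Y j k" if "j \<in> {1..M}" "k \<in> {1..n}" for j k
    using homogeneous_unique(2)[OF ce eb Z step that] by simp
  then show "\<forall>j\<in>{1..M}. \<forall>l\<in>{1..n}. Y' j l = Y j l" by blast
  have pp: "psi_piece b \<mu> q \<xi> n M Y' j s = psi_piece b \<mu> q \<xi> n M Y j s" if "j \<in> {1..M}" for j s
    unfolding psi_piece_def using YY[OF that] by simp
  show "\<forall>s\<in>{0..b}. \<psi>h' s = \<psi>h s \<and> \<phi>h' s = \<phi>h s"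
  proof (intro ballI conjI)
    fix s assume s: "s \<in> {0..b}"
    show "\<phi>h' s = \<phi>h s" using e0[OF s] by (simp add: e_def)
    show "\<psi>h' s = \<psi>h s"
    proof (cases "s = 0")
      case True
      then show ?thesis using c c' pp[of 1] M by (simp add: colloc_approx_def)
    next
      case False
      with mesh_cover[OF s] obtain j where j: "j \<in> {1..M}" "s \<in> {x (j - 1)<..x j}" by metis
      then have "\<psi>h s = psi_piece b \<mu> q \<xi> n M Y j s" "\<psi>h' s = psi_piece b \<mu> q \<xi> n M Y' j s"
        using c c' unfolding colloc_approx_def by blast+
      then show ?thesis using pp[OF j(1)] by simp
    qed
  qed
qed

text \<open>For \<open>s\<close> in \<open>(x\<^sub>j\<^sub>-\<^sub>1, x\<^sub>j]\<close> the least index is \<open>j\<close>, and at \<open>0\<close> it is \<open>1\<close>, as the values of \<open>\<psi>\<^sub>h\<close> require.\<close>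

definition "glued Y s = psi_piece b \<mu> q \<xi> n M Y (LEAST j. 1 \<le> j \<and> s \<le> x j) s"

definition "primitive Y s = - integral {s..b} (glued Y)"

lemma glued_cell: "j \<in> {1..M} \<Longrightarrow> s \<in> {x (j - 1)<..x j} \<Longrightarrow> glued Y s = psi_piece b \<mu> q \<xi> n M Y j s"
  by (simp only: glued_def Least_cell)

lemma glued_0: "glued Y 0 = psi_piece b \<mu> q \<xi> n M Y 1 0"
proof -
  have "(LEAST j. 1 \<le> j \<and> 0 \<le> x j) = 1"
    using mesh_range(1)[of 1] M by (intro Least_equality) auto
  then show ?thesis by (simp add: glued_def)
qed

lemma glued_integrable: "glued Y integrable_on {0..b}"
proof -
  have "glued Y integrable_on {x 0..x k}" if "k \<le> M" for k
    using that
  proof (induction k)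
    case (Suc k)
    then have k: "Suc k \<in> {1..M}" by simp
    have m: "x 0 \<le> x k" "x k \<le> x (Suc k)"
      using Suc.prems mesh_mono[of 0 k] mesh_mono[of k "Suc k"] by simp_all
    have "x (Suc k - 1) \<in> {x (Suc k - 1)..x (Suc k)}" using m by simp
    from has_integral_integrable[OF has_integral_cell[OF k this glued_cell[OF k]]]
    have "glued Y integrable_on {x k..x (Suc k)}" by simp
    moreover have "glued Y integrable_on {x 0..x k}" using Suc by simp
    ultimately show ?case
      using m by (intro Henstock_Kurzweil_Integration.integrable_combine[of "x 0" "x k" "x (Suc k)"])
  next
    case 0
    then show ?case using integrable_on_refl[of "glued Y" "x 0"] by simp
  qed
  from this[of M] show ?thesis by (simp add: mesh_0 mesh_M)
qed

lemma glued_integrable': "0 \<le> s \<Longrightarrow> glued Y integrable_on {s..b}"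
  by (rule integrable_on_subinterval[OF glued_integrable]) auto

lemma primitive_cell:
  assumes j: "j \<in> {1..M}" and s: "s \<in> {x (j - 1)..x j}"
  shows "primitive Y s = primitive Y (x j) - integral {s..x j} (psi_piece b \<mu> q \<xi> n M Y j)"
proof -
  have s0: "0 \<le> s" using s mesh_range(1)[of "j - 1", OF order_trans[OF diff_le_self]] j by auto
  have "integral {s..x j} (glued Y) + integral {x j..b} (glued Y) = integral {s..b} (glued Y)"
    using s mesh_range(2)[of j] j glued_integrable'[OF s0]
    by (intro Henstock_Kurzweil_Integration.integral_combine) auto
  moreover have "integral {s..x j} (glued Y) = integral {s..x j} (psi_piece b \<mu> q \<xi> n M Y j)"
    by (intro integral_unique has_integral_cell[OF j s] glued_cell[OF j])
  ultimately show ?thesis by (simp add: primitive_def)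
qed

lemma primitive_continuous: "continuous_on {0..b} (primitive Y)"
  unfolding primitive_def by (intro continuous_intros indefinite_integral_continuous_1' glued_integrable)

lemma primitive_add:
  assumes "0 \<le> s"
  shows "primitive (\<lambda>j k. Y j k + Y' j k) s = primitive Y s + primitive Y' s"
proof -
  have "integral {s..b} (glued (\<lambda>j k. Y j k + Y' j k)) = integral {s..b} (\<lambda>t. glued Y t + glued Y' t)"
    by (intro arg_cong[where f = "integral _"]) (auto simp: glued_def psi_piece_def distrib_right sum.distrib)
  then show ?thesis
    using assms by (simp add: primitive_def integral_add glued_integrable')
qed

lemma primitive_cmult: "primitive (\<lambda>j k. c * Y j k) s = c * primitive Y s"
proof -
  have "integral {s..b} (glued (\<lambda>j k. c * Y j k)) = integral {s..b} (\<lambda>t. c * glued Y t)"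
    by (intro arg_cong[where f = "integral _"])
       (auto simp: glued_def psi_piece_def sum_distrib_left mult.assoc)
  then show ?thesis by (simp add: primitive_def)
qed

lemma primitive_cong:
  assumes "\<And>j k. j \<in> {1..M} \<Longrightarrow> k \<in> {1..n} \<Longrightarrow> Y j k = Y' j k" and s: "s \<in> {0..b}"
  shows "primitive Y s = primitive Y' s"
proof -
  have "glued Y t = glued Y' t" if t: "t \<in> {s..b}" for t
  proof -
    have *: "psi_piece b \<mu> q \<xi> n M Y j t = psi_piece b \<mu> q \<xi> n M Y' j t" if "j \<in> {1..M}" for j
      unfolding psi_piece_def using assms(1)[OF that] by simp
    show ?thesis
    proof (cases "t = 0")
      case True
      then show ?thesis using *[of 1] M by (simp add: glued_0)
    next
      case False
      have "t \<in> {0..b}" using t s by auto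
      with False mesh_cover[of t] obtain j where "j \<in> {1..M}" "t \<in> {x (j - 1)<..x j}" by metis
      then show ?thesis using * by (simp add: glued_cell)
    qed
  qed
  then have "integral {s..b} (glued Y) = integral {s..b} (glued Y')" by (rule integral_cong)
  then show ?thesis by (simp add: primitive_def)
qed

text \<open>The collocation equations are a square linear system for the coefficients \<open>Y\<close>: the operator \<open>T\<close>
  below is the contribution of \<open>\<psi>\<^sub>h\<close>, and \<open>c\<close> that of the data \<open>g\<close> and \<open>\<phi>b\<close>.\<close>

lemma colloc_approx_exists: "\<exists>Y \<psi>h \<phi>h. colloc_approx b \<mu> \<nu> q \<xi> n a g K \<phi>b M Y \<psi>h \<phi>h"
proof -
  define I where "I = {1..M} \<times> {1..n}"
  define T where "T f = (\<lambda>(j, k). hom_rhs (primitive (curry f)) (cp j k))" for f :: "nat \<times> nat \<Rightarrow> real"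
  define c where "c = (\<lambda>(j, k). adjoint_rhs b \<nu> a g K (\<lambda>_. \<phi>b) (cp j k))"
  have sub: "continuous_on {cp j k..b} (primitive Y)" if "(j, k) \<in> I" for j k Y
    using colloc_range'[of j k] that
    by (intro continuous_on_subset[OF primitive_continuous]) (auto simp: I_def)
  have cp: "0 \<le> cp j k" "cp j k \<le> b" if "(j, k) \<in> I" for j k
    using colloc_range'[of j k] that by (auto simp: I_def)
  have "\<exists>f. \<forall>i\<in>I. f i = T f i + c i"
  proof (rule linear_fixed_point_exists)
    show "finite I" by (simp add: I_def)
  next
    fix f h :: "nat \<times> nat \<Rightarrow> real" and i assume "i \<in> I"
    then obtain j k where i: "i = (j, k)" "(j, k) \<in> I" by (cases i) auto
    have "T (\<lambda>p. f p + h p) i = hom_rhs (\<lambda>s. primitive (curry f) s + primitive (curry h) s) (cp j k)"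
      unfolding T_def i(1) prod.case
      by (rule adjoint_rhs_cong) (use cp[OF i(2)] in \<open>auto simp: curry_def primitive_add\<close>)
    also have "\<dots> = hom_rhs (primitive (curry f)) (cp j k) + hom_rhs (primitive (curry h)) (cp j k)"
      using adjoint_rhs_add[of \<nu> "cp j k" b K "primitive (curry f)" "primitive (curry h)" a "\<lambda>_. 0" "\<lambda>_. 0"]
        nu cp[OF i(2)] K_cont sub[OF i(2)] by simp
    finally show "T (\<lambda>p. f p + h p) i = T f i + T h i" by (simp add: T_def i)
  next
    fix r and f :: "nat \<times> nat \<Rightarrow> real" and i assume "i \<in> I"
    then obtain j k where i: "i = (j, k)" "(j, k) \<in> I" by (cases i) auto
    have "T (\<lambda>p. r * f p) i = hom_rhs (\<lambda>s. r * primitive (curry f) s) (cp j k)"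
      unfolding T_def i(1) prod.case curry_def by (simp add: primitive_cmult[abs_def])
    then show "T (\<lambda>p. r * f p) i = r * T f i"
      using adjoint_rhs_cmult[of b \<nu> a r "\<lambda>_. 0" K "primitive (curry f)" "cp j k"] by (simp add: T_def i)
  next
    fix f h :: "nat \<times> nat \<Rightarrow> real" and i assume "i \<in> I" and eq: "\<And>k. k \<in> I \<Longrightarrow> f k = h k"
    then obtain j k where i: "i = (j, k)" "(j, k) \<in> I" by (cases i) auto
    show "T f i = T h i"
      unfolding T_def i(1) prod.case
      by (intro adjoint_rhs_cong primitive_cong) (use cp[OF i(2)] eq in \<open>auto simp: I_def\<close>)
  next
    fix f :: "nat \<times> nat \<Rightarrow> real" and i assume f: "\<And>i. i \<in> I \<Longrightarrow> f i = T f i" and "i \<in> I"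
    then obtain j k where i: "i = (j, k)" "j \<in> {1..M}" "k \<in> {1..n}" by (cases i) (auto simp: I_def)
    have "curry f j k = 0"
    proof (rule homogeneous_unique(2)[where e = "primitive (curry f)" and Z = "curry f"])
      show "primitive (curry f) b = 0" by (simp add: primitive_def)
      show "curry f j k = hom_rhs (primitive (curry f)) (cp j k)" if "j \<in> {1..M}" "k \<in> {1..n}" for j k
        using f[of "(j, k)"] that by (simp add: I_def T_def)
    qed (fact primitive_continuous i primitive_cell)+
    then show "f i = 0" by (simp add: i)
  qed
  then obtain f where f: "\<And>i. i \<in> I \<Longrightarrow> f i = T f i + c i" by blast
  define Y where "Y = curry f"
  define \<phi>h where "\<phi>h s = \<phi>b + primitive Y s" for s
  have "Y j l = adjoint_rhs b \<nu> a g K \<phi>h (cp j l)" if "j \<in> {1..M}" "l \<in> {1..n}" for j l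
  proof -
    have I: "(j, l) \<in> I" using that by (simp add: I_def)
    have "Y j l = hom_rhs (primitive Y) (cp j l) + adjoint_rhs b \<nu> a g K (\<lambda>_. \<phi>b) (cp j l)"
      using f[OF I] by (simp add: T_def c_def Y_def)
    also have "\<dots> = adjoint_rhs b \<nu> a g K \<phi>h (cp j l)"
      using adjoint_rhs_add[of \<nu> "cp j l" b K "\<lambda>_. \<phi>b" "primitive Y" a g "\<lambda>_. 0"]
        nu cp[OF I] K_cont sub[OF I] by (simp add: \<phi>h_def[abs_def])
    finally show ?thesis .
  qed
  moreover have "\<phi>h s = \<phi>h (x j) - integral {s..x j} (glued Y)"
    if j: "j \<in> {1..M}" and s: "s \<in> {x (j - 1)..x j}" for j s
  proof -
    have "integral {s..x j} (glued Y) = integral {s..x j} (psi_piece b \<mu> q \<xi> n M Y j)"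
      by (intro integral_unique has_integral_cell[OF j s] glued_cell[OF j])
    then show ?thesis using primitive_cell[OF j s, of Y] by (simp add: \<phi>h_def)
  qed
  moreover have "\<phi>h b = \<phi>b" by (simp add: \<phi>h_def primitive_def)
  ultimately have "colloc_approx b \<mu> \<nu> q \<xi> n a g K \<phi>b M Y (glued Y) \<phi>h"
    unfolding colloc_approx_def using glued_cell glued_0 by blast
  then show ?thesis by blast
qed

end

section \<open>Convergence rates\<close>

context graded_interpolation
begin

abbreviation "rate \<equiv> q * (1 + \<mu> * \<alpha>)"
abbreviation "size_const \<equiv> q * b powr (1 + \<mu> * \<alpha>)"

lemma point_const_D: "0 \<le> point_const * D"
  by (rule mult_nonneg_nonneg[OF point_const_bounds(3) D])

lemma cell_const_D: "0 \<le> cell_const * D"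
  by (rule mult_nonneg_nonneg[OF add_nonneg_nonneg[OF point_const_bounds(3)
        mult_nonneg_nonneg[OF point_const_bounds(4)]] D])
     (use width_const_ge_1 mu in simp)

lemma mesh_complement': "j \<in> {1..M} \<Longrightarrow> b - x (j - 1) = b * (real (M + 1 - j) / real M) powr q"
  using mesh_complement[of "j - 1"] by (cases j) auto

lemma scale_width:
  assumes j: "j \<in> {1..M}"
  shows "scale j * (x j - x (j - 1))
     \<le> size_const * ((real (M + 1 - j) / real M) powr rate / real (M + 1 - j))"
proof -
  define i where "i = real (M + 1 - j)"
  have i: "i > 0" using j by (simp add: i_def)
  define y where "y = b - x (j - 1)"
  have y: "y = b * (i / real M) powr q" unfolding y_def i_def by (rule mesh_complement'[OF j])
  have y0: "y > 0" using y i b M by simp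
  have "scale j * (x j - x (j - 1)) \<le> y powr (\<mu> * \<alpha>) * (q / i * y)"
    unfolding powr_powr y_def i_def by (rule mult_left_mono[OF mesh_width(1)[OF j]]) simp
  also have "\<dots> = q * (y powr 1 * y powr (\<mu> * \<alpha>)) / i" using y0 by simp
  also have "y powr 1 * y powr (\<mu> * \<alpha>) = y powr (1 + \<mu> * \<alpha>)" by (rule powr_add[symmetric])
  also have "y powr (1 + \<mu> * \<alpha>) = b powr (1 + \<mu> * \<alpha>) * (i / real M) powr rate"
    unfolding y using b i M by (simp add: powr_mult powr_powr)
  finally show ?thesis by (simp add: i_def)
qed

lemma res_partial_order:
  assumes j: "j \<in> {1..M}" and s: "s \<in> {x (j - 1)..x j}" and M3: "M \<ge> 3"
  shows "\<bar>integral {s..x j} (res j)\<bar> \<le> point_const * D * size_const * varpi rate (real n + 1) M"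
proof -
  define i where "i = M + 1 - j"
  have i: "1 \<le> i" "i \<le> M" using j by (auto simp: i_def)
  have "\<bar>integral {s..x j} (res j)\<bar> \<le> point_const * (D / real i ^ n * scale j) * (x j - x (j - 1))"
    unfolding i_def by (rule integral_res_partial[OF j s])
  also have "\<dots> = point_const * D / real i ^ n * (scale j * (x j - x (j - 1)))" by simp
  also have "\<dots> \<le> point_const * D / real i ^ n * (size_const * ((real i / real M) powr rate / real i))"
    unfolding i_def by (rule mult_left_mono[OF scale_width[OF j] divide_nonneg_nonneg[OF point_const_D]]) simp
  also have "\<dots> = point_const * D * size_const * ((real i / real M) powr rate * real i powr (- (real n + 1)))"
  proof -
    have "real i powr (- (real n + 1)) = 1 / (real i ^ n * real i)"
    proof -
      have "real i powr (real n + 1) = real i ^ n * real i"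
        using i by (simp add: powr_add powr_realpow)
      then show ?thesis by (simp only: powr_minus_divide)
    qed
    then show ?thesis by simp
  qed
  also have "\<dots> \<le> point_const * D * size_const * varpi rate (real n + 1) M"
    by (rule mult_left_mono[OF graded_term_bound[OF M3 i] mult_nonneg_nonneg[OF point_const_D]])
       (use q in simp)
  finally show ?thesis .
qed

text \<open>The interval \<open>i\<close> from the end contributes a multiple of \<open>(i / M) powr rate\<close> and \<open>1 / i\<close> to the
  power \<open>n + 2\<close>: a factor \<open>i powr (- n)\<close> from interpolation, one more from the orthogonality condition, and
  one more from the length of the interval in the variable \<open>s\<close>.\<close>

lemma res_cell_order:
  "(\<Sum>j=1..M. \<bar>integral {x (j - 1)..x j} (res j)\<bar>) \<le> cell_const * D * size_const *
     (\<Sum>i=1..M. (real i / real M) powr rate * real i powr (- (real n + 1) - 1))"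
proof -
  define h where "h i = (real i / real M) powr rate * real i powr (- (real n + 1) - 1)" for i
  have "(\<Sum>j=1..M. \<bar>integral {x (j - 1)..x j} (res j)\<bar>)
      \<le> (\<Sum>j=1..M. cell_const * D * size_const * h (M + 1 - j))"
  proof (rule sum_mono)
    fix j assume j: "j \<in> {1..M}"
    define i where "i = M + 1 - j"
    have i: "1 \<le> i" "i \<le> M" using j by (auto simp: i_def)
    have "\<bar>integral {x (j - 1)..x j} (res j)\<bar>
        \<le> cell_const * (D / real i ^ (n + 1) * scale j) * (x j - x (j - 1))"
      unfolding i_def by (rule integral_res_cell[OF j])
    also have "\<dots> = cell_const * D / real i ^ (n + 1) * (scale j * (x j - x (j - 1)))"
      by (simp only: times_divide_eq_left times_divide_eq_right mult_ac)
    also have "\<dots> \<le> cell_const * D / real i ^ (n + 1) * (size_const * ((real i / real M) powr rate / real i))"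
      unfolding i_def
      by (rule mult_left_mono[OF scale_width[OF j] divide_nonneg_nonneg[OF cell_const_D]]) simp
    also have "\<dots> = cell_const * D * size_const * h i"
    proof -
      have "- (real n + 1) - 1 = - (real (n + 1) + 1)" by simp
      then have "real i powr (- (real n + 1) - 1) = 1 / (real i ^ (n + 1) * real i)"
        using i by (simp only: powr_minus_divide powr_add) (simp add: powr_realpow powr_add)
      then show ?thesis by (simp add: h_def)
    qed
    finally show "\<bar>integral {x (j - 1)..x j} (res j)\<bar> \<le> cell_const * D * size_const * h (M + 1 - j)"
      by (simp add: i_def)
  qed
  also have "\<dots> = cell_const * D * size_const * (\<Sum>j=1..M. h (M + 1 - j))"
    by (rule sum_distrib_left[symmetric])
  also have "(\<Sum>j=1..M. h (M + 1 - j)) = (\<Sum>i=1..M. h i)"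
    using sum.atLeastAtMost_rev[of h 1 M] by (simp add: add.commute)
  finally show ?thesis by (simp only: h_def)
qed

lemma res_0_order:
  assumes M3: "M \<ge> 3"
  shows "\<bar>res 1 0\<bar> \<le> point_const * D * b powr (\<mu> * \<alpha>) * varpi rate (real n) M"
proof -
  have M1: "1 \<in> {1..M}" using M by simp
  have "\<bar>res 1 0\<bar> \<le> point_const * (D / real M ^ n * scale 1)"
    using res_pointwise[OF M1, of 0] mesh_0 mesh_range(1)[OF M] by simp
  also have "scale 1 = b powr (\<mu> * \<alpha>)" using mesh_0 by (simp add: powr_powr)
  also have "point_const * (D / real M ^ n * b powr (\<mu> * \<alpha>))
      = point_const * D * b powr (\<mu> * \<alpha>) * ((real M / real M) powr rate * real M powr (- real n))"
    using M by (simp add: powr_minus_divide powr_realpow)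
  also have "\<dots> \<le> point_const * D * b powr (\<mu> * \<alpha>) * varpi rate (real n) M"
    by (rule mult_left_mono[OF graded_term_bound[OF M3 M order_refl] mult_nonneg_nonneg[OF point_const_D]])
       simp
  finally show ?thesis .
qed

end

text \<open>The error \<open>e = \<phi> - \<phi>\<^sub>h\<close> satisfies the discrete problem with the coefficients
  \<open>Z = \<psi> - Y\<close> in the collocation points, up to the integrals of the interpolation error of \<open>\<psi>\<close>. Those
  are the defects in the stability estimate.\<close>

locale collocation_error =
  graded_interpolation b \<mu> q n \<xi> M F \<alpha> D \<Lambda> + volterra_collocation b \<mu> q n \<xi> M \<nu> a K aB KB \<Lambda>
  for b \<mu> q :: real and n :: nat and \<xi> :: "nat \<Rightarrow> real" and M :: nat
    and F :: "nat \<Rightarrow> real \<Rightarrow> real" and \<alpha> D \<Lambda> \<nu> :: real and a :: "real \<Rightarrow> real"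
    and K :: "real \<Rightarrow> real \<Rightarrow> real" and aB KB :: real +
  fixes g \<phi> \<psi> :: "real \<Rightarrow> real"
  assumes phi_deriv: "\<And>s. s \<in> {0..b} \<Longrightarrow> (\<phi> has_real_derivative \<psi> s) (at s within {0..b})"
    and psi_eq: "\<And>s. s \<in> {0..b} \<Longrightarrow> \<psi> s = adjoint_rhs b \<nu> a g K \<phi> s"
    and F_psi: "F 0 = (\<lambda>\<rho>. \<psi> (tau b \<mu> \<rho>))"
begin

lemma psi_decomp:
  assumes j: "j \<in> {1..M}" and s: "s \<le> b"
  shows "\<psi> s = res j s + psi_piece b \<mu> q \<xi> n M (\<lambda>j k. \<psi> (cp j k)) j s"
  using mu s by (simp add: res_def F_psi tau_frac_coord colloc_pt_def)

lemma phi_continuous: "continuous_on {0..b} \<phi>"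
  using phi_deriv by (intro DERIV_continuous_on)

lemma phi_cell:
  assumes j: "j \<in> {1..M}" and s: "s \<in> {x (j - 1)..x j}"
  shows "\<phi> s = \<phi> (x j) - (integral {s..x j} (res j)
      + integral {s..x j} (psi_piece b \<mu> q \<xi> n M (\<lambda>j k. \<psi> (cp j k)) j))"
proof -
  have sub: "{s..x j} \<subseteq> {0..b}" "{s..x j} \<subseteq> {x (j - 1)..x j}"
    using s mesh_range(2)[of j] mesh_range(1)[of "j - 1", OF order_trans[OF diff_le_self]] j by auto
  have "(\<psi> has_integral (\<phi> (x j) - \<phi> s)) {s..x j}"
  proof (rule fundamental_theorem_of_calculus)
    show "(\<phi> has_vector_derivative \<psi> t) (at t within {s..x j})" if "t \<in> {s..x j}" for t
      using DERIV_subset[OF phi_deriv sub(1)] that sub(1)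
      by (auto simp: has_real_derivative_iff_has_vector_derivative[symmetric])
  qed (use s in simp)
  then have "\<phi> (x j) - \<phi> s = integral {s..x j} \<psi>" by (simp add: integral_unique)
  also have "\<dots> = integral {s..x j} (\<lambda>t. res j t + psi_piece b \<mu> q \<xi> n M (\<lambda>j k. \<psi> (cp j k)) j t)"
    using sub(1) by (intro integral_cong psi_decomp j) auto
  also have "\<dots> = integral {s..x j} (res j)
      + integral {s..x j} (psi_piece b \<mu> q \<xi> n M (\<lambda>j k. \<psi> (cp j k)) j)"
    using sub by (intro integral_add integrable_continuous_real continuous_on_psi_piece j
        continuous_on_subset[OF continuous_on_res[OF j]]) auto
  finally show ?thesis by simp
qed

abbreviation "stab_const \<equiv> exp (2 * (b * q * gain))"

lemma collocation_errors:
  assumes c: "colloc_approx b \<mu> \<nu> q \<xi> n a g K (\<phi> b) M Y \<psi>h \<phi>h" and M3: "M \<ge> 3"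
    and Cs: "(\<Sum>i=1..M. (real i / real M) powr rate * real i powr (- (real n + 1) - 1))
        \<le> Cs * varpi rate (real n + 1) M"
  defines "E \<equiv> stab_const * ((point_const + cell_const * Cs) * D * size_const * varpi rate (real n + 1) M)"
  shows "\<And>t. t \<in> {0..b} \<Longrightarrow> \<bar>\<phi> t - \<phi>h t\<bar> \<le> E"
    and "\<And>j k. j \<in> {1..M} \<Longrightarrow> k \<in> {1..n} \<Longrightarrow> \<bar>\<psi> (cp j k) - Y j k\<bar> \<le> op_const * E"
    and "\<bar>\<psi> 0 - \<psi>h 0\<bar> \<le> point_const * D * b powr (\<mu> * \<alpha>) * varpi rate (real n) M
           + real n * \<Lambda> * (op_const * E)"
proof -
  define e where "e s = \<phi> s - \<phi>h s" for s
  define Z where "Z j k = \<psi> (cp j k) - Y j k" for j k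
  have contp: "continuous_on {0..b} \<phi>h" by (rule colloc_approx_continuous[OF c])
  have ce: "continuous_on {0..b} e" unfolding e_def by (intro continuous_intros contp phi_continuous)
  have eb: "e b = 0" using c by (simp add: e_def colloc_approx_def)
  have Z: "Z j k = hom_rhs e (cp j k)" if jk: "j \<in> {1..M}" "k \<in> {1..n}" for j k
  proof -
    have "Z j k = adjoint_rhs b \<nu> a g K \<phi> (cp j k) - adjoint_rhs b \<nu> a g K \<phi>h (cp j k)"
      using c jk colloc_range'[OF jk] by (simp add: Z_def colloc_approx_def psi_eq)
    then show ?thesis unfolding e_def[abs_def] using hom_rhs_diff[OF phi_continuous contp jk] by simp
  qed
  have step: "e s - e (x j) + integral {s..x j} (psi_piece b \<mu> q \<xi> n M Z j) = - integral {s..x j} (res j)"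
    if j: "j \<in> {1..M}" and s: "s \<in> {x (j - 1)..x j}" for j s
    using phi_cell[OF j s] colloc_approx_cell[OF c j s]
    unfolding e_def Z_def[abs_def] integral_psi_piece_diff[OF j] by linarith
  define w where "w = varpi rate (real n + 1) M"
  define R where "R = point_const * D * size_const * w"
  have w: "0 \<le> w" unfolding w_def varpi_def using ln_ge_1[OF M3] by auto
  have R: "0 \<le> R" unfolding R_def
    by (rule mult_nonneg_nonneg[OF mult_nonneg_nonneg[OF point_const_D] w]) (use q in simp)
  have main: "\<bar>e t\<bar> \<le> E" if t: "t \<in> {0..b}" for t
  proof -
    have "\<bar>e t\<bar> \<le> stab_const * (R + (\<Sum>j=1..M. \<bar>integral {x (j - 1)..x j} (res j)\<bar>))"
    proof (rule stability[where Z = Z, OF ce eb R Z _ _ t])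
      fix j assume j: "j \<in> {1..M}"
      show "\<bar>e s - e (x j) + integral {s..x j} (psi_piece b \<mu> q \<xi> n M Z j)\<bar> \<le> R"
        if "s \<in> {x (j - 1)..x j}" for s
        unfolding step[OF j that] abs_minus_cancel R_def w_def by (rule res_partial_order[OF j that M3])
      have "x (j - 1) \<in> {x (j - 1)..x j}" using mesh_strict[OF j] by simp
      from step[OF j this]
      show "\<bar>e (x (j - 1)) - e (x j) + integral {x (j - 1)..x j} (psi_piece b \<mu> q \<xi> n M Z j)\<bar>
          \<le> \<bar>integral {x (j - 1)..x j} (res j)\<bar>" by linarith
    qed
    also have "\<dots> \<le> stab_const * (R + cell_const * D * size_const * (Cs * w))"
    proof (rule mult_left_mono[OF add_left_mono])
      have "cell_const * D * size_const * (\<Sum>i=1..M. (real i / real M) powr rate * real i powr (- (real n + 1) - 1))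
          \<le> cell_const * D * size_const * (Cs * w)"
        unfolding w_def
        by (rule mult_left_mono[OF Cs mult_nonneg_nonneg[OF cell_const_D]]) (use q in simp)
      with res_cell_order
      show "(\<Sum>j=1..M. \<bar>integral {x (j - 1)..x j} (res j)\<bar>) \<le> cell_const * D * size_const * (Cs * w)"
        by (rule order_trans)
    qed simp
    also have "R + cell_const * D * size_const * (Cs * w) = (point_const + cell_const * Cs) * D * size_const * w"
    proof -
      have "u * D * v * w + u' * D * v * (Cs * w) = (u + u' * Cs) * D * v * w" for u u' v
        by (simp add: algebra_simps)
      then show ?thesis unfolding R_def .
    qed
    finally show ?thesis by (simp only: E_def w_def)
  qed
  then show "\<And>t. t \<in> {0..b} \<Longrightarrow> \<bar>\<phi> t - \<phi>h t\<bar> \<le> E" by (simp add: e_def)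
  have Zb: "\<bar>Z j k\<bar> \<le> op_const * E" if jk: "j \<in> {1..M}" "k \<in> {1..n}" for j k
    unfolding Z[OF jk]
  proof (rule hom_rhs_bound[OF ce jk])
    show "\<bar>e t\<bar> \<le> E" if "t \<in> {x (j - 1)..b}" for t
      using that jk mesh_range(1)[of "j - 1", OF order_trans[OF diff_le_self]] by (intro main) auto
  qed
  then show "\<And>j k. j \<in> {1..M} \<Longrightarrow> k \<in> {1..n} \<Longrightarrow> \<bar>\<psi> (cp j k) - Y j k\<bar> \<le> op_const * E"
    by (simp add: Z_def)
  have M1: "1 \<in> {1..M}" using M by simp
  have z0: "zeta 1 0 \<in> {0..1}"
    using zeta_range[OF M1, of 0] mesh_0 mesh_range(1)[OF M] by simp
  have "\<psi> 0 - \<psi>h 0 = res 1 0 + psi_piece b \<mu> q \<xi> n M Z 1 0"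
  proof -
    have "\<psi>h 0 = psi_piece b \<mu> q \<xi> n M Y 1 0" using c by (simp add: colloc_approx_def)
    then show ?thesis
      using psi_decomp[OF M1, of 0] b
        psi_piece_diff[of "\<lambda>j k. \<psi> (cp j k)" 1 0 Y] by (simp add: Z_def[abs_def])
  qed
  also have "\<bar>res 1 0 + psi_piece b \<mu> q \<xi> n M Z 1 0\<bar> \<le> \<bar>res 1 0\<bar> + \<bar>psi_piece b \<mu> q \<xi> n M Z 1 0\<bar>"
    by (rule abs_triangle_ineq)
  also have "\<bar>psi_piece b \<mu> q \<xi> n M Z 1 0\<bar> \<le> (\<Sum>k=1..n. \<bar>Z 1 k\<bar> * \<bar>lagrange_basis \<xi> n k (zeta 1 0)\<bar>)"
    unfolding psi_piece_eq[OF M1] abs_mult[symmetric] by (rule sum_abs)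
  also have "\<dots> \<le> (\<Sum>k=1..n. (op_const * E) * \<Lambda>)"
    using z0 order_trans[OF abs_ge_zero Zb[OF M1]] by (intro sum_mono mult_mono Zb M1 lag) auto
  also have "\<dots> = real n * \<Lambda> * (op_const * E)" by simp
  finally show "\<bar>\<psi> 0 - \<psi>h 0\<bar> \<le> point_const * D * b powr (\<mu> * \<alpha>) * varpi rate (real n) M
           + real n * \<Lambda> * (op_const * E)"
    using res_0_order[OF M3] by linarith
qed

end

lemma Linf_norm_le:
  fixes f :: "real \<Rightarrow> real"
  assumes "continuous_on {u..v} f" "\<And>t. t \<in> {u..v} \<Longrightarrow> \<bar>f t\<bar> \<le> B"
  shows "Linf_norm {u..v} f \<le> ereal B"
  unfolding Linf_norm_def
proof (rule esssup_I)
  have "f \<in> borel_measurable (lebesgue_on {u..v})"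
    using assms(1) by (intro continuous_imp_measurable_on_sets_lebesgue) auto
  then show "(\<lambda>t. ereal \<bar>f t\<bar>) \<in> borel_measurable (lebesgue_on {u..v})" by measurable
  show "AE t in lebesgue_on {u..v}. ereal \<bar>f t\<bar> \<le> ereal B"
    by (intro AE_I2) (use assms(2) in simp)
qed

text \<open>The interval at \<open>b\<close> has a length proportional to a power of \<open>1 / M\<close>, so that its logarithm is of the order
  of \<open>ln M\<close>.\<close>

lemma log_factor_first_cell:
  assumes b: "b > 0" and mu: "0 < \<mu>" and q: "q \<ge> 1" and M: "M \<ge> 3"
  shows "log_factor n \<gamma> ((b * (1 / real M) powr q) powr \<mu>)
     \<le> (1 + \<mu> * \<bar>ln b\<bar> + q * \<mu>) * (if real n \<noteq> \<gamma> then 1 else ln (real M))"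
proof -
  have l: "1 \<le> ln (real M)" by (rule ln_ge_1[OF M])
  have p: "0 \<le> \<mu> * \<bar>ln b\<bar>" "0 \<le> q * \<mu>" using mu q by simp_all
  have "ln ((b * (1 / real M) powr q) powr \<mu>) = \<mu> * ln b - q * \<mu> * ln (real M)"
    using b M by (simp add: ln_powr ln_mult ln_div algebra_simps)
  also have "\<bar>\<dots>\<bar> \<le> \<bar>\<mu> * ln b\<bar> + \<bar>q * \<mu> * ln (real M)\<bar>" by (rule abs_triangle_ineq4)
  also have "\<dots> = \<mu> * \<bar>ln b\<bar> + q * \<mu> * ln (real M)" using mu q l by (simp add: abs_mult)
  finally have 1: "1 + \<bar>ln ((b * (1 / real M) powr q) powr \<mu>)\<bar> \<le> 1 + \<mu> * \<bar>ln b\<bar> + q * \<mu> * ln (real M)"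
    by simp
  have "(1 + \<mu> * \<bar>ln b\<bar>) * 1 \<le> (1 + \<mu> * \<bar>ln b\<bar>) * ln (real M)"
    using l p by (intro mult_left_mono) auto
  with 1 have "1 + \<bar>ln ((b * (1 / real M) powr q) powr \<mu>)\<bar> \<le> (1 + \<mu> * \<bar>ln b\<bar> + q * \<mu>) * ln (real M)"
    by (simp only: distrib_right)
  then show ?thesis using p by (simp add: log_factor_def)
qed

theorem theorem6p2:
  fixes b \<nu> \<mu> q \<gamma> \<phi>b :: real and n :: nat and \<xi> :: "nat \<Rightarrow> real"
    and a g \<phi> \<psi> :: "real \<Rightarrow> real" and K :: "real \<Rightarrow> real \<Rightarrow> real"
  assumes "b > 0" and "0 < \<nu>" "\<nu> < 1" and "0 < \<mu>" "\<mu> < 1" and "q \<ge> 1" and "\<gamma> > 0"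
    and "n \<ge> 2"
    and "0 \<le> \<xi> 1" and "strict_mono_on {1..n} \<xi>" and "\<xi> n \<le> 1"
    and "integral {0..1} (\<lambda>\<zeta>. \<Prod>l=1..n. (\<zeta> - \<xi> l)) = 0"
    and "continuous_on {0..b} a" and "continuous_on {0..b} g" and "C1_triangle b K"
    and "\<forall>x\<in>{0..b}. (\<phi> has_real_derivative \<psi> x) (at x within {0..b})"
    and "\<forall>x\<in>{0..b}. \<psi> x = adjoint_rhs b \<nu> a g K \<phi> x"
    and "\<phi> b = \<phi>b"
    and "weighted_C (n + 1) \<gamma> (b - b powr \<mu>) b (\<lambda>\<rho>. \<psi> (tau b \<mu> \<rho>))"
  shows "\<exists>M0\<ge>1. \<exists>C. \<forall>M>M0.
    (\<exists>Y \<psi>h \<phi>h. colloc_approx b \<mu> \<nu> q \<xi> n a g K \<phi>b M Y \<psi>h \<phi>h \<and>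
       (\<forall>Y' \<psi>h' \<phi>h'. colloc_approx b \<mu> \<nu> q \<xi> n a g K \<phi>b M Y' \<psi>h' \<phi>h' \<longrightarrow>
          (\<forall>j\<in>{1..M}. \<forall>l\<in>{1..n}. Y' j l = Y j l) \<and>
          (\<forall>x\<in>{0..b}. \<psi>h' x = \<psi>h x \<and> \<phi>h' x = \<phi>h x))) \<and>
    (\<forall>Y \<psi>h \<phi>h. colloc_approx b \<mu> \<nu> q \<xi> n a g K \<phi>b M Y \<psi>h \<phi>h \<longrightarrow>
       Linf_norm {0..b} (\<lambda>x. \<phi> x - \<phi>h x)
         \<le> ereal (C * (if real n \<noteq> \<gamma>
              then varpi (q * (1 + \<mu> * min (real n) \<gamma>)) (real n + 1) M
              else varpi (q * (\<mu> * real n + 1)) (real n + 1) M * ln (real M))) \<and>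
       colloc_max_err b \<mu> q \<xi> n M \<psi> Y
         \<le> C * (if real n \<noteq> \<gamma>
              then varpi (q * (1 + \<mu> * min (real n) \<gamma>)) (real n + 1) M
              else varpi (q * (\<mu> * real n + 1)) (real n + 1) M * ln (real M)) \<and>
       \<bar>\<psi> 0 - \<psi>h 0\<bar>
         \<le> C * (if real n \<noteq> \<gamma>
              then varpi (q * (1 + \<mu> * min (real n) \<gamma>)) (real n) M
              else varpi (q * (\<mu> * real n + 1)) (real n) M * ln (real M)))"
proof -
  note b = assms(1) and nu = assms(2) and mu = assms(4,5) and q = assms(6) and gamma = assms(7)
    and n = assms(8) and xi = assms(9-11) and orth = assms(12)
  define \<alpha> where "\<alpha> = min (real n) \<gamma>"
  have alpha: "0 < \<alpha>" "\<alpha> \<le> real n" using gamma n by (auto simp: \<alpha>_def)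
  obtain KB where KB0: "0 \<le> KB"
    and KB: "\<And>x s. 0 \<le> x \<Longrightarrow> x \<le> s \<Longrightarrow> s \<le> b \<Longrightarrow> \<bar>K x s\<bar> \<le> KB"
    and Kc: "\<And>x. 0 \<le> x \<Longrightarrow> continuous_on {x..b} (K x)"
    using kernel_bounds[OF assms(15) b] by metis
  obtain aB where aB: "\<And>x. x \<in> {0..b} \<Longrightarrow> \<bar>a x\<bar> \<le> aB"
  proof -
    have "bounded (a ` {0..b})"
      using assms(13) by (intro compact_imp_bounded compact_continuous_image) auto
    then show thesis using that unfolding bounded_iff by (metis imageI real_norm_def)
  qed
  obtain \<Lambda> where Lam: "\<Lambda> \<ge> 0"
      "\<And>k t. k \<in> {1..n} \<Longrightarrow> t \<in> {0..1} \<Longrightarrow> \<bar>lagrange_basis \<xi> n k t\<bar> \<le> \<Lambda>"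
    using lagrange_basis_bounded[of n \<xi>] by metis
  have Z: "b powr \<mu> > 0" using b by simp
  have n1: "n \<ge> 1" using n by simp
  obtain F D0 where F: "F 0 = (\<lambda>\<rho>. \<psi> (tau b \<mu> \<rho>))" and D0: "D0 \<ge> 0"
    and deriv: "\<And>k \<rho>. k < n + 1 \<Longrightarrow> \<rho> \<in> {b - b powr \<mu>..<b} \<Longrightarrow>
        (F k has_real_derivative F (Suc k) \<rho>) (at \<rho> within {b - b powr \<mu>..<b})"
    and away: "\<And>m \<rho> z. m \<in> {n, n + 1} \<Longrightarrow> \<rho> \<in> {b - b powr \<mu>..<b} \<Longrightarrow> 0 < z \<Longrightarrow> z \<le> b - \<rho> \<Longrightarrow>
        \<bar>F m \<rho>\<bar> \<le> D0 * log_factor n \<gamma> z * (b - \<rho>) powr (\<alpha> - real m)"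
    and near: "\<And>\<rho> z. \<rho> \<in> {b - b powr \<mu>..<b} \<Longrightarrow> b - \<rho> \<le> z \<Longrightarrow>
        \<bar>F n \<rho>\<bar> \<le> D0 * log_factor n \<gamma> z * z powr (\<alpha> / 2) * (b - \<rho>) powr (\<alpha> / 2 - real n)"
    by (rule weighted_C_bounds[OF Z gamma n1 assms(19), folded \<alpha>_def]) (rule that; assumption)
  define r where "r = q * (1 + \<mu> * \<alpha>)"
  obtain Cs where Cs0: "Cs \<ge> 0" and Cs: "\<And>M. M \<ge> 3 \<Longrightarrow>
     (\<Sum>i=1..M. (real i / real M) powr r * real i powr (- (real n + 1) - 1)) \<le> Cs * varpi r (real n + 1) M"
    by (rule graded_sum_bound[of r "real n + 1"]) (rule that; assumption)
  \<comment> \<open>the constants, all of them independent of the number of intervals\<close>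
  define op where "op = aB + KB * (b powr \<nu> / \<nu>)"
  define gn where "gn = real n * \<Lambda> * op"
  define wc where "wc = max 1 (q * \<mu>) * 2 powr (q * \<mu>)"
  define pc where "pc = (1 + real n * \<Lambda>) * (wc ^ (n + 1) + 2 / \<alpha>)"
  define cc where "cc = pc + wc ^ (n + 1) * (wc / \<mu>)"
  define sc where "sc = q * b powr (1 + \<mu> * \<alpha>)"
  define L where "L = 1 + \<mu> * \<bar>ln b\<bar> + q * \<mu>"
  define C1 where "C1 = exp (2 * (b * q * gn)) * ((pc + cc * Cs) * (D0 * L) * sc)"
  define C2 where "C2 = pc * (D0 * L) * b powr (\<mu> * \<alpha>)"
  define C where "C = C1 + op * C1 + (C2 + gn * C1)"
  define lam where "lam M = (if real n \<noteq> \<gamma> then 1 else ln (real M))" for M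
  have op: "0 \<le> op" using aB[of 0] KB0 b nu by (auto simp: op_def)
  have gn: "0 \<le> gn" using op Lam(1) by (simp add: gn_def)
  have wc: "1 \<le> wc" unfolding wc_def by (rule one_le_width_factor[OF q mu(1)])
  have pc: "0 \<le> pc" unfolding pc_def using wc Lam(1) alpha
    by (intro mult_nonneg_nonneg add_nonneg_nonneg) auto
  have cc: "0 \<le> cc" unfolding cc_def using pc wc mu by (intro add_nonneg_nonneg mult_nonneg_nonneg) auto
  have sc: "0 \<le> sc" unfolding sc_def using q by simp
  have L: "0 \<le> L" using mu q unfolding L_def by simp
  have C1: "0 \<le> C1" unfolding C1_def using pc cc Cs0 D0 L sc
    by (intro mult_nonneg_nonneg add_nonneg_nonneg) auto
  have C2: "0 \<le> C2" unfolding C2_def using pc D0 L by (intro mult_nonneg_nonneg) auto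
  have CC: "C1 \<le> C" "op * C1 \<le> C" "C2 + gn * C1 \<le> C"
    unfolding C_def using C1 C2 op gn by simp_all
  \<comment> \<open>the mesh is fine enough for stability, and \<open>ln M \<ge> 1\<close>\<close>
  define M0 where "M0 = max 3 (nat \<lceil>2 * (b * q * gn)\<rceil>)"
  have main: "(\<exists>Y \<psi>h \<phi>h. colloc_approx b \<mu> \<nu> q \<xi> n a g K \<phi>b M Y \<psi>h \<phi>h \<and>
       (\<forall>Y' \<psi>h' \<phi>h'. colloc_approx b \<mu> \<nu> q \<xi> n a g K \<phi>b M Y' \<psi>h' \<phi>h' \<longrightarrow>
          (\<forall>j\<in>{1..M}. \<forall>l\<in>{1..n}. Y' j l = Y j l) \<and>
          (\<forall>x\<in>{0..b}. \<psi>h' x = \<psi>h x \<and> \<phi>h' x = \<phi>h x))) \<and>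
    (\<forall>Y \<psi>h \<phi>h. colloc_approx b \<mu> \<nu> q \<xi> n a g K \<phi>b M Y \<psi>h \<phi>h \<longrightarrow>
       Linf_norm {0..b} (\<lambda>x. \<phi> x - \<phi>h x) \<le> ereal (C * (varpi r (real n + 1) M * lam M)) \<and>
       colloc_max_err b \<mu> q \<xi> n M \<psi> Y \<le> C * (varpi r (real n + 1) M * lam M) \<and>
       \<bar>\<psi> 0 - \<psi>h 0\<bar> \<le> C * (varpi r (real n) M * lam M))" if M: "M > M0" for M
  proof -
    have M3: "M \<ge> 3" using M by (simp add: M0_def)
    have M1: "M \<ge> 1" using M3 by simp
    have Mg: "2 * (b * q * gn) \<le> real M" using M unfolding M0_def by linarith
    define z1 where "z1 = (b - mesh_pt b q M (M - 1)) powr \<mu>"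
    have z1: "z1 = (b * (1 / real M) powr q) powr \<mu>"
      using M1 by (simp add: z1_def mesh_pt_def of_nat_diff algebra_simps)
    have z1p: "0 < z1" unfolding z1 using b M1 by simp
    define D where "D = D0 * log_factor n \<gamma> z1"
    have "log_factor n \<gamma> z1 \<ge> 1" by (simp add: log_factor_def)
    then have D: "0 \<le> D" using D0 by (simp add: D_def)
    have DL: "D \<le> D0 * L * lam M"
      unfolding D_def z1 L_def lam_def mult.assoc[of D0]
      by (rule mult_left_mono[OF log_factor_first_cell[OF b mu(1) q M3] D0])
    have cont: "continuous_on {b - b powr \<mu>..b} (F 0)"
      using assms(19) unfolding F weighted_C_def by blast
    interpret collocation_error b \<mu> q n \<xi> M F \<alpha> D \<Lambda> \<nu> a K aB KB g \<phi> \<psi>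
    proof unfold_locales
      show "b * q / real M * (real n * \<Lambda> * (aB + KB * (b powr \<nu> / \<nu>))) \<le> 1 / 2"
        using Mg M1 unfolding gn_def[symmetric] op_def[symmetric] by (simp add: field_simps)
    qed (use b mu q n xi M1 alpha D Lam cont deriv orth nu Kc KB aB F assms(16,17)
          away[OF _ _ z1p] near[of _ z1] in \<open>auto simp: D_def z1_def\<close>)
    have ex: "\<exists>Y \<psi>h \<phi>h. colloc_approx b \<mu> \<nu> q \<xi> n a g K \<phi>b M Y \<psi>h \<phi>h"
      by (rule colloc_approx_exists)
    have err: "Linf_norm {0..b} (\<lambda>x. \<phi> x - \<phi>h x) \<le> ereal (C * (varpi r (real n + 1) M * lam M)) \<and>
       colloc_max_err b \<mu> q \<xi> n M \<psi> Y \<le> C * (varpi r (real n + 1) M * lam M) \<and>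
       \<bar>\<psi> 0 - \<psi>h 0\<bar> \<le> C * (varpi r (real n) M * lam M)"
      if c: "colloc_approx b \<mu> \<nu> q \<xi> n a g K \<phi>b M Y \<psi>h \<phi>h" for Y \<psi>h \<phi>h
    proof -
      define V where "V = varpi r (real n + 1) M * lam M"
      define V0 where "V0 = varpi r (real n) M * lam M"
      have lam: "0 \<le> lam M" using ln_ge_1[OF M3] by (simp add: lam_def)
      have vp: "0 \<le> varpi r s M" for s using ln_ge_1[OF M3] by (simp add: varpi_def)
      have V: "0 \<le> V" "V \<le> V0"
        using vp lam varpi_lower_order[OF M3, of r "real n"] by (auto simp: V_def V0_def intro!: mult_right_mono)
      define E where "E = exp (2 * (b * q * gn)) * ((pc + cc * Cs) * D * sc * varpi r (real n + 1) M)"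
      have EV: "E \<le> C1 * V"
      proof -
        have "D * varpi r (real n + 1) M \<le> D0 * L * lam M * varpi r (real n + 1) M"
          using DL vp by (rule mult_right_mono)
        then have "exp (2 * (b * q * gn)) * (pc + cc * Cs) * sc * (D * varpi r (real n + 1) M)
            \<le> exp (2 * (b * q * gn)) * (pc + cc * Cs) * sc * (D0 * L * lam M * varpi r (real n + 1) M)"
          using pc cc Cs0 sc by (intro mult_left_mono mult_nonneg_nonneg add_nonneg_nonneg) auto
        then show ?thesis by (simp only: E_def C1_def V_def mult_ac)
      qed
      note errs = collocation_errors[OF c[folded assms(18)] M3, folded r_def, OF Cs[OF M3],
          folded wc_def, folded pc_def, folded cc_def op_def, folded gn_def sc_def, folded E_def]
      have e1: "\<bar>\<phi> t - \<phi>h t\<bar> \<le> C * V" if "t \<in> {0..b}" for t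
        using errs(1)[OF that] EV mult_right_mono[OF CC(1) V(1)] by linarith
      have "Linf_norm {0..b} (\<lambda>x. \<phi> x - \<phi>h x) \<le> ereal (C * V)"
        using e1 by (intro Linf_norm_le continuous_intros phi_continuous colloc_approx_continuous[OF c])
      moreover have "colloc_max_err b \<mu> q \<xi> n M \<psi> Y \<le> C * V"
        unfolding colloc_max_err_def
      proof (rule Max.boundedI)
        show "(\<lambda>(j, l). \<bar>\<psi> (cp j l) - psi_piece b \<mu> q \<xi> n M Y j (cp j l)\<bar>) ` ({1..M} \<times> {1..n}) \<noteq> {}"
          using M1 n1 by simp
        fix v assume "v \<in> (\<lambda>(j, l). \<bar>\<psi> (cp j l) - psi_piece b \<mu> q \<xi> n M Y j (cp j l)\<bar>) ` ({1..M} \<times> {1..n})"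
        then obtain j l where jl: "j \<in> {1..M}" "l \<in> {1..n}"
          and v: "v = \<bar>\<psi> (cp j l) - psi_piece b \<mu> q \<xi> n M Y j (cp j l)\<bar>" by auto
        have "v \<le> op * E" unfolding v psi_piece_colloc[OF jl] by (rule errs(2)[OF jl])
        also have "\<dots> \<le> op * (C1 * V)" using EV op by (rule mult_left_mono)
        also have "\<dots> \<le> C * V" using mult_right_mono[OF CC(2) V(1)] by (simp only: mult.assoc)
        finally show "v \<le> C * V" .
      qed simp
      moreover have "\<bar>\<psi> 0 - \<psi>h 0\<bar> \<le> C * V0"
      proof -
        have V0: "0 \<le> V0" using V by linarith
        have "\<bar>\<psi> 0 - \<psi>h 0\<bar> \<le> pc * D * b powr (\<mu> * \<alpha>) * varpi r (real n) M + real n * \<Lambda> * (op * E)"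
          by (rule errs(3))
        moreover have "real n * \<Lambda> * (op * E) \<le> gn * C1 * V0"
        proof -
          have "E \<le> C1 * V0" using EV mult_left_mono[OF V(2) C1] by linarith
          then have "gn * E \<le> gn * (C1 * V0)" using gn by (rule mult_left_mono)
          then show ?thesis by (simp only: gn_def mult.assoc)
        qed
        moreover have "pc * D * b powr (\<mu> * \<alpha>) * varpi r (real n) M \<le> C2 * V0"
        proof -
          have "D * varpi r (real n) M \<le> D0 * L * lam M * varpi r (real n) M"
            using DL vp by (rule mult_right_mono)
          then have "pc * b powr (\<mu> * \<alpha>) * (D * varpi r (real n) M)
              \<le> pc * b powr (\<mu> * \<alpha>) * (D0 * L * lam M * varpi r (real n) M)"
            using pc by (intro mult_left_mono) auto
          then show ?thesis by (simp only: C2_def V0_def mult_ac)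
        qed
        ultimately have "\<bar>\<psi> 0 - \<psi>h 0\<bar> \<le> (C2 + gn * C1) * V0" by (simp only: distrib_right)
        also have "\<dots> \<le> C * V0" using CC(3) V0 by (rule mult_right_mono)
        finally show ?thesis .
      qed
      ultimately show ?thesis by (simp only: V_def V0_def)
    qed
    from ex obtain Y \<psi>h \<phi>h where c: "colloc_approx b \<mu> \<nu> q \<xi> n a g K \<phi>b M Y \<psi>h \<phi>h" by blast
    show ?thesis
    proof (rule conjI)
      show "\<exists>Y \<psi>h \<phi>h. colloc_approx b \<mu> \<nu> q \<xi> n a g K \<phi>b M Y \<psi>h \<phi>h \<and>
       (\<forall>Y' \<psi>h' \<phi>h'. colloc_approx b \<mu> \<nu> q \<xi> n a g K \<phi>b M Y' \<psi>h' \<phi>h' \<longrightarrow>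
          (\<forall>j\<in>{1..M}. \<forall>l\<in>{1..n}. Y' j l = Y j l) \<and>
          (\<forall>x\<in>{0..b}. \<psi>h' x = \<psi>h x \<and> \<phi>h' x = \<phi>h x))"
        by (rule exI[of _ Y], rule exI[of _ \<psi>h], rule exI[of _ \<phi>h])
           (intro conjI allI impI c; rule colloc_approx_unique[OF c]; assumption)
    qed (intro allI impI err)
  qed
  have rate: "(if real n \<noteq> \<gamma> then varpi (q * (1 + \<mu> * min (real n) \<gamma>)) s M
      else varpi (q * (\<mu> * real n + 1)) s M * ln (real M)) = varpi r s M * lam M" for s M
    by (auto simp: r_def lam_def \<alpha>_def add.commute)
  have "M0 \<ge> 1" by (simp add: M0_def)
  then show ?thesis
    unfolding rate using main by blast
qed

end
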